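(* Let $F$ be a finitely ramified fractal with a resistance form $\mathcal E$ on $V_*$ for which all harmonic functions are continuous, and assume (WN): the resistance form is weakly nondegenerate, i.e. the space of piecewise harmonic functions is dense in $\mathrm{Dom}\,\mathcal E$. Then $\mathrm{Grad}$ can be extended from the space of piecewise harmonic functions to an isometry $$\mathrm{Grad}:\mathrm{Dom}\,\mathcal E\to L^2_Z$$ (called the weak gradient), where $\mathrm{Dom}\,\mathcal E$ carries the energy seminorm $\mathcal E(f,f)^{1/2}$.
   Context: **Finitely ramified fractal.** A finitely ramified fractal is a compact metric space $F$ with a cell structure $\{F_\alpha\}_{\alpha\in\mathcal A}$ and a vertex (boundary) structure $\{V_\alpha\}_{\alpha\in\mathcal A}$ such that: (A) $\mathcal A$ is a countable index set; (B) the $F_\alpha$ are pairwise distinct compact connected subsets of $F$; (C) each $V_\alpha$ is a finite subset of $F_\alpha$ with at least two elements; (D) if $F_\alpha=\bigcup_{j=1}^kF_{\alpha_j}$ then $V_\alpha\subset\bigcup_{j=1}^kV_{\alpha_j}$; (E) there is a filtration $\{\mathcal A_n\}_{n\ge0}$, $\mathcal A=\bigcup_n\mathcal A_n$, by pairwise disjoint finite sets $\mathcal A_n\subset\mathcal A$ with $\mathcal A_0=\{0\}$, $F_0=F$, and such that for every $\alpha\in\mathcal A_n$ there are $\alpha_1,\dots,\alpha_k\in\mathcal A_{n+1}$ with $F_\alpha=\bigcup_{j=1}^kF_{\alpha_j}$; (F) $F_{\alpha'}\cap F_\alpha=V_{\alpha'}\cap V_\alpha$ for any two distinct $\alpha,\alpha'\in\mathcal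 A_n$; (G) for any strictly decreasing infinite cell sequence $F_{\alpha_1}\supsetneq F_{\alpha_2}\supsetneq\cdots$ there is $x\in F$ with $\bigcap_{n\ge1}F_{\alpha_n}=\{x\}$. A filtration is fixed. Put $V_n=\bigcup_{\alpha\in\mathcal A_n}V_\alpha$ (so $V_n\subset V_{n+1}$) and $V_*=\bigcup_nV_n$. **Resistance form.** $\ell(V)$ is the space of real functions on $V$. A resistance form on the countable set $V_*$ is a pair $(\mathcal E,\mathrm{Dom}\,\mathcal E)$ such that: (RF1) $\mathrm{Dom}\,\mathcal E$ is a linear subspace of $\ell(V_* )$ containing constants, $\mathcal E$ is a nonnegative symmetric quadratic form on it, and $\mathcal E(u,u)=0$ iff $u$ is constant; (RF2) $\mathrm{Dom}\,\mathcal E$ modulo constants is a Hilbert space with respect to $\mathcal E$; (RF3) for every finite $V\subset V_*$ and $v\in\ell(V)$ there is $u\in\mathrm{Dom}\,\mathcal E$ with $u|_V=v$; (RF4) for all $p,q\in V_*$, $\sup\{(u(p)-u(q))^2/\mathcal E(u,u):u\in\mathrm{Dom}\,\mathcal E,\ \mathcal E(u,u)>0\}<\infty$; (RF5) for $u\in\mathrm{Dom}\,\mathcal E$, the function $\bar u=\max(0,\min(u,1))$ satisfies $\mathcal E(\bar u,\bar u)\le\mathcal E(u,u)$. For finite $U\subset V_*$ the trace is $\mathcal E_U(f,f)=\min\{\mathcal E(g,g):g\in\mathrm{Dom}\,\mathcal E,\ g|_U=f\}$. **Standing assumption.** $\mathcal E$ splits over cells: for each $\alpha$ the restriction $\mathcal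 E_\alpha$ of $\mathcal E$ to $F_\alpha$ is a resistance form on $V_*\cap F_\alpha$, and for each $n$, $f\in\mathrm{Dom}\,\mathcal E$ iff $f|_{V_*\cap F_\alpha}\in\mathrm{Dom}\,\mathcal E_\alpha$ for all $\alpha\in\mathcal A_n$, with $\mathcal E(f,f)=\sum_{\alpha\in\mathcal A_n}\mathcal E_\alpha(f|_{F_\alpha},f|_{F_\alpha})$ (and likewise each $\mathcal E_\alpha$ splits over the subcells of $F_\alpha$). With $\mathcal E_{V_\alpha}$ the trace of $\mathcal E_\alpha$ on $V_\alpha$ one has $\mathcal E_{V_n}=\sum_{\alpha\in\mathcal A_n}\mathcal E_{V_\alpha}$. **Harmonic functions.** $h\in\mathrm{Dom}\,\mathcal E$ is harmonic if it minimizes $\mathcal E$ among all functions in $\mathrm{Dom}\,\mathcal E$ with the same values on $V_0$; each function on $V_0$ has a unique harmonic extension. A function on $V_*$ is called continuous if it extends to a continuous function on $F$, and is then identified with this extension. Standing assumption: all harmonic functions are continuous. **Energy measure.** For harmonic $h$, $\nu_h$ is the unique atomless Borel measure on $F$ with $\nu_h(F_\alpha)=\mathcal E_{V_\alpha}(h|_{V_\alpha},h|_{V_\alpha})$ for all $\alpha\in\mathcal A$. Fix harmonic functions $h_1,\dots,h_k$, $k=|V_0|-1$, that are $\mathcal E$-orthonormal and together with constants span all harmonic functions. The Kusuoka energy measure is $\nu=\nu_{h_1}+\dots+\nu_{h_k}$. **The matrix $Z$.** $M_\alpha:\ell(V_0)\to\ell(V_\alpha)$ sends $f$ to $h_f|_{V_\alpha}$,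 where $h_f$ is the harmonic function with $h_f|_{V_0}=f$. $D_\alpha$ is the symmetric matrix with $\mathcal E_{V_\alpha}(f,f)=\langle f,D_\alpha f\rangle$ (standard inner product of $\ell(V_\alpha)$). If $\nu(F_\alpha)\ne0$, $Z_\alpha=M_\alpha^*D_\alpha M_\alpha/\nu(F_\alpha)$; $Z_n(x)=Z_\alpha$ if $\alpha\in\mathcal A_n$, $\nu(F_\alpha)\neq0$, $x\in F_\alpha\setminus V_\alpha$; and $Z(x)=\lim_{n\to\infty}Z_n(x)$, which exists for $\nu$-a.e. $x$. $L^2_Z$ is the Hilbert space of ($\nu$-measurable, modulo null vectors) $\ell(V_0)$-valued functions $u$ on $F$ with norm $\|u\|_{L^2_Z}^2=\int_F\langle u,Zu\rangle\,d\nu$. **Piecewise harmonic functions and Grad.** $f\in\mathrm{Dom}\,\mathcal E$ is $n$-piecewise harmonic if for every $\alpha\in\mathcal A_n$ there is a (globally) harmonic function $h_\alpha$ that coincides with $f$ on $F_\alpha$; it is piecewise harmonic if it is $n$-piecewise harmonic for some $n$. For such $f$ and $\alpha\in\mathcal A_n$, $\mathrm{Tan}_\alpha f\in\ell(V_0)$ is the unique element such that the harmonic function with boundary values $\mathrm{Tan}_\alpha f$ on $V_0$ coincides with $f$ on $F_\alpha$ and has the smallest energy among all harmonic functions coinciding with $f$ on $F_\alpha$. $\mathrm{Grad} f\in L^2_Z$ is the element with $\mathrm{Grad} f(x)=\mathrm{Tan}_\alpha f$ (in the sense of $L^2_Z$) for $\nu$-a.e. $x\in F_\alpha$, $\alpha\in\mathcal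 A_n$. *)

theory Defs
  imports "HOL-Analysis.Analysis"
begin

section \<open>Real functions on subsets of a type\<close>

text \<open>A real function on a set \<open>V\<close> is represented by its extension by zero, so that the
  pointwise operations need no restriction.\<close>

definition ell :: "'a set \<Rightarrow> ('a \<Rightarrow> real) set" where
  "ell V = {f. \<forall>x. x \<notin> V \<longrightarrow> f x = 0}"

definition restr :: "'a set \<Rightarrow> ('a \<Rightarrow> real) \<Rightarrow> 'a \<Rightarrow> real" where
  "restr V f = (\<lambda>x. if x \<in> V then f x else 0)"

section \<open>Resistance forms\<close>

text \<open>Completeness of the domain modulo constants is expressed by Cauchy sequences of
  representatives; positive definiteness of the form on the quotient is \<open>definite\<close>.\<close>

locale resistance_form =
  fixes V :: "'a set"
    and Dm :: "('a \<Rightarrow> real) set"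
    and En :: "('a \<Rightarrow> real) \<Rightarrow> ('a \<Rightarrow> real) \<Rightarrow> real"
  assumes countable_V: "countable V"
    and dom_ell: "Dm \<subseteq> ell V"
    and dom_const: "\<And>c. restr V (\<lambda>_. c) \<in> Dm"
    and dom_add: "\<And>u v. u \<in> Dm \<Longrightarrow> v \<in> Dm \<Longrightarrow> (\<lambda>x. u x + v x) \<in> Dm"
    and dom_scale: "\<And>c u. u \<in> Dm \<Longrightarrow> (\<lambda>x. c * u x) \<in> Dm"
    and En_sym: "\<And>u v. u \<in> Dm \<Longrightarrow> v \<in> Dm \<Longrightarrow> En u v = En v u"
    and add_left: "\<And>u v w. u \<in> Dm \<Longrightarrow> v \<in> Dm \<Longrightarrow> w \<in> Dm \<Longrightarrow>
          En (\<lambda>x. u x + v x) w = En u w + En v w"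
    and scale_left: "\<And>c u v. u \<in> Dm \<Longrightarrow> v \<in> Dm \<Longrightarrow> En (\<lambda>x. c * u x) v = c * En u v"
    and nonneg: "\<And>u. u \<in> Dm \<Longrightarrow> 0 \<le> En u u"
    and definite: "\<And>u. u \<in> Dm \<Longrightarrow> En u u = 0 \<longleftrightarrow> (\<exists>c. \<forall>x\<in>V. u x = c)"
    and complete: "\<And>u :: nat \<Rightarrow> 'a \<Rightarrow> real.
          (\<And>n. u n \<in> Dm) \<Longrightarrow>
          (\<And>e. e > 0 \<Longrightarrow>
            \<exists>N. \<forall>m\<ge>N. \<forall>n\<ge>N. En (\<lambda>x. u m x - u n x) (\<lambda>x. u m x - u n x) < e) \<Longrightarrow>
          \<exists>v\<in>Dm. (\<lambda>n. En (\<lambda>x. u n x - v x) (\<lambda>x. u n x - v x)) \<longlonglongrightarrow> 0"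
    and interpolate: "\<And>W v. finite W \<Longrightarrow> W \<subseteq> V \<Longrightarrow> \<exists>u\<in>Dm. \<forall>x\<in>W. u x = v x"
    and resistance_finite: "\<And>p q. p \<in> V \<Longrightarrow> q \<in> V \<Longrightarrow>
          bdd_above {(u p - u q)\<^sup>2 / En u u | u. u \<in> Dm \<and> En u u > 0}"
    and markov_dom: "\<And>u. u \<in> Dm \<Longrightarrow> (\<lambda>x. max 0 (min (u x) 1)) \<in> Dm"
    and markov: "\<And>u. u \<in> Dm \<Longrightarrow>
          En (\<lambda>x. max 0 (min (u x) 1)) (\<lambda>x. max 0 (min (u x) 1)) \<le> En u u"

text \<open>The trace of a form on a finite set, as a quadratic form.\<close>

definition form_trace ::
  "('a \<Rightarrow> real) set \<Rightarrow> (('a \<Rightarrow> real) \<Rightarrow> ('a \<Rightarrow> real) \<Rightarrow> real) \<Rightarrow> 'a set \<Rightarrow> ('a \<Rightarrow> real) \<Rightarrow> real" where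
  "form_trace Dm En U f = (LEAST e. \<exists>g\<in>Dm. (\<forall>x\<in>U. g x = f x) \<and> e = En g g)"

section \<open>Finitely ramified fractals\<close>

record ('a, 'i) frf =
  carr :: "'a set"
  idx :: "'i set"
  lev :: "nat \<Rightarrow> 'i set"
  base :: 'i
  cell :: "'i \<Rightarrow> 'a set"
  vert :: "'i \<Rightarrow> 'a set"

definition finitely_ramified_fractal :: "('a::metric_space, 'i, 'z) frf_scheme \<Rightarrow> bool" where
  "finitely_ramified_fractal X \<longleftrightarrow>
     compact (carr X) \<and>
     countable (idx X) \<and>
     inj_on (cell X) (idx X) \<and>
     (\<forall>a\<in>idx X. compact (cell X a) \<and> connected (cell X a) \<and> cell X a \<subseteq> carr X) \<and>
     (\<forall>a\<in>idx X. finite (vert X a) \<and> vert X a \<subseteq> cell X a \<and> 2 \<le> card (vert X a)) \<and>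
     (\<forall>a\<in>idx X. \<forall>B. finite B \<and> B \<subseteq> idx X \<and> cell X a = (\<Union>b\<in>B. cell X b) \<longrightarrow>
        vert X a \<subseteq> (\<Union>b\<in>B. vert X b)) \<and>
     idx X = (\<Union>n. lev X n) \<and>
     (\<forall>n. finite (lev X n)) \<and>
     (\<forall>m n. m \<noteq> n \<longrightarrow> lev X m \<inter> lev X n = {}) \<and>
     lev X 0 = {base X} \<and>
     cell X (base X) = carr X \<and>
     (\<forall>n. \<forall>a\<in>lev X n. \<exists>B\<subseteq>lev X (Suc n). cell X a = (\<Union>b\<in>B. cell X b)) \<and>
     (\<forall>n. \<forall>a\<in>lev X n. \<forall>b\<in>lev X n. a \<noteq> b \<longrightarrow> cell X a \<inter> cell X b = vert X a \<inter> vert X b) \<and>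
     (\<forall>s :: nat \<Rightarrow> 'i. (\<forall>n. s n \<in> idx X \<and> cell X (s (Suc n)) \<subset> cell X (s n)) \<longrightarrow>
        (\<exists>x\<in>carr X. (\<Inter>n. cell X (s n)) = {x}))"

definition Vlev :: "('a, 'i, 'z) frf_scheme \<Rightarrow> nat \<Rightarrow> 'a set" where
  "Vlev X n = (\<Union>a\<in>lev X n. vert X a)"

definition Vstar :: "('a, 'i, 'z) frf_scheme \<Rightarrow> 'a set" where
  "Vstar X = (\<Union>n. Vlev X n)"

text \<open>The restrictions \<open>cdom a\<close>, \<open>cenergy a\<close> of the form to the cells are part of the data:
  the form on the whole fractal need not determine how its energy is distributed among cells
  that share several vertices.\<close>

record ('a, 'i) rfrf = "('a, 'i) frf" +
  edom :: "('a \<Rightarrow> real) set"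
  energy :: "('a \<Rightarrow> real) \<Rightarrow> ('a \<Rightarrow> real) \<Rightarrow> real"
  cdom :: "'i \<Rightarrow> ('a \<Rightarrow> real) set"
  cenergy :: "'i \<Rightarrow> ('a \<Rightarrow> real) \<Rightarrow> ('a \<Rightarrow> real) \<Rightarrow> real"

definition cell_restr :: "('a, 'i, 'z) frf_scheme \<Rightarrow> 'i \<Rightarrow> ('a \<Rightarrow> real) \<Rightarrow> 'a \<Rightarrow> real" where
  "cell_restr X a f = restr (Vstar X \<inter> cell X a) f"

definition splits_over ::
  "('a, 'i, 'z) rfrf_scheme \<Rightarrow> 'a set \<Rightarrow> ('a \<Rightarrow> real) set \<Rightarrow>
   (('a \<Rightarrow> real) \<Rightarrow> ('a \<Rightarrow> real) \<Rightarrow> real) \<Rightarrow> 'i set \<Rightarrow> bool" where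
  "splits_over X V Dm En B \<longleftrightarrow>
     (\<forall>f\<in>ell V. f \<in> Dm \<longleftrightarrow> (\<forall>b\<in>B. cell_restr X b f \<in> cdom X b)) \<and>
     (\<forall>f\<in>Dm. En f f = (\<Sum>b\<in>B. cenergy X b (cell_restr X b f) (cell_restr X b f)))"

definition split_resistance_form :: "('a, 'i, 'z) rfrf_scheme \<Rightarrow> bool" where
  "split_resistance_form X \<longleftrightarrow>
     resistance_form (Vstar X) (edom X) (energy X) \<and>
     (\<forall>a\<in>idx X. resistance_form (Vstar X \<inter> cell X a) (cdom X a) (cenergy X a)) \<and>
     (\<forall>n. splits_over X (Vstar X) (edom X) (energy X) (lev X n)) \<and>
     (\<forall>n. \<forall>m\<ge>n. \<forall>a\<in>lev X n.
        splits_over X (Vstar X \<inter> cell X a) (cdom X a) (cenergy X a)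
          {b \<in> lev X m. cell X b \<subseteq> cell X a})"

definition cell_trace :: "('a, 'i, 'z) rfrf_scheme \<Rightarrow> 'i \<Rightarrow> ('a \<Rightarrow> real) \<Rightarrow> real" where
  "cell_trace X a f = form_trace (cdom X a) (cenergy X a) (vert X a) f"

section \<open>Harmonic functions\<close>

definition harmonic :: "('a, 'i, 'z) rfrf_scheme \<Rightarrow> ('a \<Rightarrow> real) \<Rightarrow> bool" where
  "harmonic X h \<longleftrightarrow> h \<in> edom X \<and>
     (\<forall>g\<in>edom X. (\<forall>x\<in>Vlev X 0. g x = h x) \<longrightarrow> energy X h h \<le> energy X g g)"

definition harm_ext :: "('a, 'i, 'z) rfrf_scheme \<Rightarrow> ('a \<Rightarrow> real) \<Rightarrow> 'a \<Rightarrow> real" where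
  "harm_ext X f = (THE h. harmonic X h \<and> (\<forall>x\<in>Vlev X 0. h x = f x))"

definition extends_continuously ::
  "('a::metric_space, 'i, 'z) frf_scheme \<Rightarrow> ('a \<Rightarrow> real) \<Rightarrow> bool" where
  "extends_continuously X f \<longleftrightarrow>
     (\<exists>g. continuous_on (carr X) g \<and> (\<forall>x\<in>Vstar X. g x = f x))"

definition harmonic_orthonormal_basis ::
  "('a, 'i, 'z) rfrf_scheme \<Rightarrow> (nat \<Rightarrow> 'a \<Rightarrow> real) \<Rightarrow> bool" where
  "harmonic_orthonormal_basis X h \<longleftrightarrow>
     (let k = card (Vlev X 0) - 1 in
       (\<forall>i<k. harmonic X (h i)) \<and>
       (\<forall>i<k. \<forall>j<k. energy X (h i) (h j) = (if i = j then 1 else 0)) \<and>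
       (\<forall>g. harmonic X g \<longrightarrow>
          (\<exists>c0 c. \<forall>x\<in>Vstar X. g x = c0 + (\<Sum>i<k. c i * h i x))))"

section \<open>Energy measures\<close>

definition atomless :: "'a measure \<Rightarrow> bool" where
  "atomless M \<longleftrightarrow>
     \<not> (\<exists>A\<in>sets M. emeasure M A > 0 \<and>
          (\<forall>B\<in>sets M. B \<subseteq> A \<longrightarrow> emeasure M B = 0 \<or> emeasure M (A - B) = 0))"

definition energy_measure ::
  "('a::metric_space, 'i, 'z) rfrf_scheme \<Rightarrow> ('a \<Rightarrow> real) \<Rightarrow> 'a measure" where
  "energy_measure X g = (THE M. sets M = sets (restrict_space borel (carr X)) \<and> atomless M \<and>
     (\<forall>a\<in>idx X. emeasure M (cell X a) = ennreal (cell_trace X a g)))"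

definition kusuoka ::
  "('a::metric_space, 'i, 'z) rfrf_scheme \<Rightarrow> (nat \<Rightarrow> 'a \<Rightarrow> real) \<Rightarrow> 'a measure" where
  "kusuoka X h = measure_of (carr X) (sets (restrict_space borel (carr X)))
     (\<lambda>B. \<Sum>i<card (Vlev X 0) - 1. emeasure (energy_measure X (h i)) B)"

section \<open>The matrix field \<open>Z\<close> and the space \<open>L2Z\<close>\<close>

text \<open>Matrices on \<open>ell V\<close> are given by their entries, indexed by points of \<open>V\<close>. The matrix of the
  linear map \<open>Mmap X a\<close> has the entry \<open>Mmap X a (indicator {p}) y\<close> in row \<open>y\<close> and column \<open>p\<close>.\<close>

definition quad :: "'a set \<Rightarrow> ('a \<Rightarrow> 'a \<Rightarrow> real) \<Rightarrow> ('a \<Rightarrow> real) \<Rightarrow> real" where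
  "quad V K f = (\<Sum>p\<in>V. \<Sum>q\<in>V. f p * K p q * f q)"

definition Mmap :: "('a, 'i, 'z) rfrf_scheme \<Rightarrow> 'i \<Rightarrow> ('a \<Rightarrow> real) \<Rightarrow> 'a \<Rightarrow> real" where
  "Mmap X a f = restr (vert X a) (harm_ext X f)"

definition Dmat :: "('a, 'i, 'z) rfrf_scheme \<Rightarrow> 'i \<Rightarrow> 'a \<Rightarrow> 'a \<Rightarrow> real" where
  "Dmat X a = (THE K. (\<forall>y z. K y z = K z y) \<and>
     (\<forall>y z. y \<notin> vert X a \<or> z \<notin> vert X a \<longrightarrow> K y z = 0) \<and>
     (\<forall>f. cell_trace X a f = quad (vert X a) K f))"

definition Zcell ::
  "('a::metric_space, 'i, 'z) rfrf_scheme \<Rightarrow> (nat \<Rightarrow> 'a \<Rightarrow> real) \<Rightarrow> 'i \<Rightarrow> 'a \<Rightarrow> 'a \<Rightarrow> real" where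
  "Zcell X h a p q =
     (\<Sum>y\<in>vert X a. \<Sum>z\<in>vert X a.
        Mmap X a (indicator {p}) y * Dmat X a y z * Mmap X a (indicator {q}) z)
     / measure (kusuoka X h) (cell X a)"

text \<open>There is at most one cell as required below. Where there is none, the value \<open>0\<close> is a dummy:
  these points form a null set.\<close>

definition Zlev ::
  "('a::metric_space, 'i, 'z) rfrf_scheme \<Rightarrow> (nat \<Rightarrow> 'a \<Rightarrow> real) \<Rightarrow> nat \<Rightarrow> 'a \<Rightarrow> 'a \<Rightarrow> 'a \<Rightarrow> real" where
  "Zlev X h n x =
     (let P = (\<lambda>a. a \<in> lev X n \<and> measure (kusuoka X h) (cell X a) \<noteq> 0 \<and> x \<in> cell X a - vert X a)
      in if \<exists>a. P a then Zcell X h (THE a. P a) else (\<lambda>_ _. 0))"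

definition Zlim ::
  "('a::metric_space, 'i, 'z) rfrf_scheme \<Rightarrow> (nat \<Rightarrow> 'a \<Rightarrow> real) \<Rightarrow> 'a \<Rightarrow> 'a \<Rightarrow> 'a \<Rightarrow> real" where
  "Zlim X h x p q = lim (\<lambda>n. Zlev X h n x p q)"

definition L2Z_fun ::
  "('a::metric_space, 'i, 'z) rfrf_scheme \<Rightarrow> (nat \<Rightarrow> 'a \<Rightarrow> real) \<Rightarrow> ('a \<Rightarrow> 'a \<Rightarrow> real) set" where
  "L2Z_fun X h = {u. (\<forall>x\<in>carr X. u x \<in> ell (Vlev X 0)) \<and>
     (\<forall>p\<in>Vlev X 0. (\<lambda>x. u x p) \<in> borel_measurable (completion (kusuoka X h))) \<and>
     integrable (completion (kusuoka X h)) (\<lambda>x. quad (Vlev X 0) (Zlim X h x) (u x))}"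

definition L2Z_seminorm ::
  "('a::metric_space, 'i, 'z) rfrf_scheme \<Rightarrow> (nat \<Rightarrow> 'a \<Rightarrow> real) \<Rightarrow> ('a \<Rightarrow> 'a \<Rightarrow> real) \<Rightarrow> real" where
  "L2Z_seminorm X h u =
     sqrt (LINT x|completion (kusuoka X h). quad (Vlev X 0) (Zlim X h x) (u x))"

definition L2Z_rel ::
  "('a::metric_space, 'i, 'z) rfrf_scheme \<Rightarrow> (nat \<Rightarrow> 'a \<Rightarrow> real) \<Rightarrow>
   (('a \<Rightarrow> 'a \<Rightarrow> real) \<times> ('a \<Rightarrow> 'a \<Rightarrow> real)) set" where
  "L2Z_rel X h = {(u, v). u \<in> L2Z_fun X h \<and> v \<in> L2Z_fun X h \<and>
     L2Z_seminorm X h (\<lambda>x p. u x p - v x p) = 0}"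

definition L2Z ::
  "('a::metric_space, 'i, 'z) rfrf_scheme \<Rightarrow> (nat \<Rightarrow> 'a \<Rightarrow> real) \<Rightarrow> ('a \<Rightarrow> 'a \<Rightarrow> real) set set" where
  "L2Z X h = L2Z_fun X h // L2Z_rel X h"

definition L2Z_norm ::
  "('a::metric_space, 'i, 'z) rfrf_scheme \<Rightarrow> (nat \<Rightarrow> 'a \<Rightarrow> real) \<Rightarrow> ('a \<Rightarrow> 'a \<Rightarrow> real) set \<Rightarrow> real" where
  "L2Z_norm X h U = the_elem (L2Z_seminorm X h ` U)"

definition L2Z_add ::
  "('a::metric_space, 'i, 'z) rfrf_scheme \<Rightarrow> (nat \<Rightarrow> 'a \<Rightarrow> real) \<Rightarrow>
   ('a \<Rightarrow> 'a \<Rightarrow> real) set \<Rightarrow> ('a \<Rightarrow> 'a \<Rightarrow> real) set \<Rightarrow> ('a \<Rightarrow> 'a \<Rightarrow> real) set" where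
  "L2Z_add X h U W = (\<Union>u\<in>U. \<Union>w\<in>W. L2Z_rel X h `` {\<lambda>x p. u x p + w x p})"

definition L2Z_scale ::
  "('a::metric_space, 'i, 'z) rfrf_scheme \<Rightarrow> (nat \<Rightarrow> 'a \<Rightarrow> real) \<Rightarrow>
   real \<Rightarrow> ('a \<Rightarrow> 'a \<Rightarrow> real) set \<Rightarrow> ('a \<Rightarrow> 'a \<Rightarrow> real) set" where
  "L2Z_scale X h c U = (\<Union>u\<in>U. L2Z_rel X h `` {\<lambda>x p. c * u x p})"

section \<open>Piecewise harmonic functions and their gradient\<close>

definition coincide_on_cell ::
  "('a, 'i, 'z) frf_scheme \<Rightarrow> 'i \<Rightarrow> ('a \<Rightarrow> real) \<Rightarrow> ('a \<Rightarrow> real) \<Rightarrow> bool" where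
  "coincide_on_cell X a f g \<longleftrightarrow> (\<forall>x\<in>Vstar X \<inter> cell X a. f x = g x)"

definition n_piecewise_harmonic ::
  "('a, 'i, 'z) rfrf_scheme \<Rightarrow> nat \<Rightarrow> ('a \<Rightarrow> real) \<Rightarrow> bool" where
  "n_piecewise_harmonic X n f \<longleftrightarrow>
     f \<in> edom X \<and> (\<forall>a\<in>lev X n. \<exists>g. harmonic X g \<and> coincide_on_cell X a g f)"

definition piecewise_harmonic :: "('a, 'i, 'z) rfrf_scheme \<Rightarrow> ('a \<Rightarrow> real) \<Rightarrow> bool" where
  "piecewise_harmonic X f \<longleftrightarrow> (\<exists>n. n_piecewise_harmonic X n f)"

definition Tan :: "('a, 'i, 'z) rfrf_scheme \<Rightarrow> 'i \<Rightarrow> ('a \<Rightarrow> real) \<Rightarrow> 'a \<Rightarrow> real" where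
  "Tan X a f = (THE t. t \<in> ell (Vlev X 0) \<and> coincide_on_cell X a (harm_ext X t) f \<and>
     (\<forall>g. harmonic X g \<and> coincide_on_cell X a g f \<longrightarrow>
        energy X (harm_ext X t) (harm_ext X t) \<le> energy X g g))"

text \<open>Equality of the class \<open>Grad X h f\<close> with \<open>Tan X a f\<close> almost everywhere on cells means that it
  holds for some representative. A function that is \<open>n\<close>-piecewise harmonic is so for all larger
  \<open>n\<close> as well; all of these levels describe the same class.\<close>

definition Grad ::
  "('a::metric_space, 'i, 'z) rfrf_scheme \<Rightarrow> (nat \<Rightarrow> 'a \<Rightarrow> real) \<Rightarrow> ('a \<Rightarrow> real) \<Rightarrow>
   ('a \<Rightarrow> 'a \<Rightarrow> real) set" where
  "Grad X h f = (THE U. U \<in> L2Z X h \<and>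
     (\<forall>n. n_piecewise_harmonic X n f \<longrightarrow>
        (\<exists>u\<in>U. \<forall>a\<in>lev X n. AE x in kusuoka X h. x \<in> cell X a \<longrightarrow> u x = Tan X a f)))"

definition weakly_nondegenerate :: "('a, 'i, 'z) rfrf_scheme \<Rightarrow> bool" where
  "weakly_nondegenerate X \<longleftrightarrow>
     (\<forall>f\<in>edom X. \<forall>e>0. \<exists>g. piecewise_harmonic X g \<and>
        energy X (\<lambda>x. f x - g x) (\<lambda>x. f x - g x) < e)"

end

theory Submission
  imports Defs
begin

text \<open>The weak gradient is the closure of the map that sends a piecewise harmonic function to its field
of boundary values, and everything rests on one identity: if \<open>t\<close> is a function on \<open>V\<^sub>0\<close> and \<open>u\<close> the
harmonic function with these boundary values, then the energy of \<open>u\<close> on a cell is the integral of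
\<open>\<langle>t, Z t\<rangle>\<close> over that cell (\<open>integral_quad_Zlim\<close>). So if \<open>f\<close> coincides on each cell \<open>a\<close> of some level with
the harmonic function that has boundary values \<open>t a\<close>, and \<open>u = t a\<close> on the cell \<open>a\<close>, then summing over
the cells gives that the energy of \<open>f\<close> is the squared norm of \<open>u\<close> (\<open>tangent_isometric\<close>). The relation
between such \<open>f\<close> and \<open>u\<close> is linear. Its closure is therefore the graph of a linear isometry, up to
null vectors; it is defined on all of the domain because piecewise harmonic functions are dense and
\<open>L\<^sup>2\<^sub>Z\<close> is complete (\<open>weak_gradient_exists\<close>). Boundary values that are admissible for the same function
at different levels, or that are not the minimal ones, differ by null vectors, hence the class is
the one that defines \<open>Grad\<close> (\<open>weak_gradient_class_Grad\<close>).

Three constructions make the identity meaningful.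

\<^item> The energy measures exist. A harmonic function minimizes the energy on each cell separately
  (\<open>harmonic_on_cell\<close>), so its cell energies are additive under subdivision. They do not accumulate at
  a point: by continuity the function is nearly constant there, and cutting it off at small height
  leaves little energy, by the Markov property and harmonicity (\<open>energy_cutoff_le\<close>,
  \<open>energy_at_point\<close>). Such a weight of cells is realized by a unique atomless measure, the image of
  Lebesgue measure under a coding of cells by intervals (\<open>ex_measure\<close>, \<open>measure_eq_on_cells\<close>).

\<^item> The matrices \<open>Z\<^sub>n\<close> converge almost everywhere. Their entries are quotients of an additive cell
  function by the measure that dominates it, that is, a bounded martingale; convergence follows from
  a maximal inequality that is proved by induction over the tree of cells
  (\<open>maximal_inequality_cell\<close>), and the limit is the density by dominated convergence
  (\<open>integral_density\<close>).

\<^item> \<open>L\<^sup>2\<^sub>Z\<close> is complete although \<open>Z(x)\<close> may be degenerate, where the limit of a Cauchy sequence of vectors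
  is not unique. Lagrange's reduction of a quadratic form to a sum of squares selects a limit that is
  measurable in \<open>x\<close> (\<open>ex_measurable_limit\<close>), and then the argument of Riesz and Fischer applies
  (\<open>L2_complete\<close>).\<close>

section \<open>Semi-inner products\<close>

text \<open>The operations are parameters so that the same facts serve real functions and fields of real
functions, both with pointwise operations.\<close>

locale semi_inner_space =
  fixes S :: "'v set"
    and ad :: "'v \<Rightarrow> 'v \<Rightarrow> 'v"
    and sc :: "real \<Rightarrow> 'v \<Rightarrow> 'v"
    and B :: "'v \<Rightarrow> 'v \<Rightarrow> real"
  assumes ad_in: "x \<in> S \<Longrightarrow> y \<in> S \<Longrightarrow> ad x y \<in> S"
    and sc_in: "x \<in> S \<Longrightarrow> sc c x \<in> S"
    and B_sym: "x \<in> S \<Longrightarrow> y \<in> S \<Longrightarrow> B x y = B y x"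
    and B_ad_left: "x \<in> S \<Longrightarrow> y \<in> S \<Longrightarrow> z \<in> S \<Longrightarrow> B (ad x y) z = B x z + B y z"
    and B_sc_left: "x \<in> S \<Longrightarrow> y \<in> S \<Longrightarrow> B (sc c x) y = c * B x y"
    and B_nonneg: "x \<in> S \<Longrightarrow> 0 \<le> B x x"
begin

lemma B_ad_right: "x \<in> S \<Longrightarrow> y \<in> S \<Longrightarrow> z \<in> S \<Longrightarrow> B z (ad x y) = B z x + B z y"
  by (metis B_sym B_ad_left ad_in)

lemma B_sc_right: "x \<in> S \<Longrightarrow> y \<in> S \<Longrightarrow> B y (sc c x) = c * B y x"
  by (metis B_sym B_sc_left sc_in)

lemmas B_bilinear = B_ad_left B_ad_right B_sc_left B_sc_right ad_in sc_in

lemma B_expand: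
  assumes "x \<in> S" "y \<in> S"
  shows "B (ad x (sc s y)) (ad x (sc s y)) = B x x + 2 * s * B x y + s\<^sup>2 * B y y"
  using assms by (simp add: B_bilinear B_sym[of y x] power2_eq_square algebra_simps)

lemma Cauchy_Schwarz:
  assumes "x \<in> S" "y \<in> S"
  shows "(B x y)\<^sup>2 \<le> B x x * B y y"
proof (cases "B y y = 0")
  case True
  have "0 \<le> B x x + 2 * s * B x y" for s
    using B_nonneg[OF ad_in[OF assms(1) sc_in[OF assms(2), of s]]] B_expand[OF assms, of s] True
    by simp
  from this[of "- (B x x + 1) / (2 * B x y)"] have "B x y = 0"
    by (cases "B x y = 0") (simp_all add: field_simps)
  then show ?thesis using True by simp
next
  case False
  then have pos: "B y y > 0" using B_nonneg[OF assms(2)] by simp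
  have "0 \<le> B x x + 2 * (- B x y / B y y) * B x y + (- B x y / B y y)\<^sup>2 * B y y"
    using B_nonneg[OF ad_in[OF assms(1) sc_in[OF assms(2), of "- B x y / B y y"]]]
      B_expand[OF assms, of "- B x y / B y y"] by simp
  also have "\<dots> = B x x - (B x y)\<^sup>2 / B y y"
    using pos by (simp add: field_simps power2_eq_square)
  finally show ?thesis using pos by (simp add: field_simps)
qed

lemma abs_B_le: "x \<in> S \<Longrightarrow> y \<in> S \<Longrightarrow> \<bar>B x y\<bar> \<le> sqrt (B x x) * sqrt (B y y)"
  using Cauchy_Schwarz[of x y] real_le_rsqrt real_sqrt_mult
  by (metis abs_le_square_iff real_sqrt_abs real_sqrt_le_iff)

lemma abs_B_le_half: assumes "x \<in> S" "y \<in> S" shows "\<bar>B x y\<bar> \<le> (B x x + B y y) / 2"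
  using B_nonneg[OF ad_in[OF assms(1) sc_in[OF assms(2), of 1]]] B_expand[OF assms, of 1]
    B_nonneg[OF ad_in[OF assms(1) sc_in[OF assms(2), of "-1"]]] B_expand[OF assms, of "-1"]
  by (simp add: abs_le_iff)

lemma sqrt_B_triangle:
  assumes "x \<in> S" "y \<in> S"
  shows "sqrt (B (ad x y) (ad x y)) \<le> sqrt (B x x) + sqrt (B y y)"
proof (rule real_le_lsqrt)
  show "0 \<le> sqrt (B x x) + sqrt (B y y)" using B_nonneg assms by simp
  have "B (ad x y) (ad x y) = B x x + 2 * B x y + B y y"
    using assms by (simp add: B_bilinear B_sym[of y x])
  also have "\<dots> \<le> (sqrt (B x x) + sqrt (B y y))\<^sup>2"
    using abs_B_le[OF assms] B_nonneg assms by (simp add: power2_sum)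
  finally show "B (ad x y) (ad x y) \<le> (sqrt (B x x) + sqrt (B y y))\<^sup>2" .
qed

lemma B_ad_le:
  assumes "x \<in> S" "y \<in> S"
  shows "B (ad x y) (ad x y) \<le> 2 * B x x + 2 * B y y"
  using abs_B_le_half[OF assms] assms by (simp add: B_bilinear B_sym[of y x])

lemma B_ad_sc_le:
  assumes "x \<in> S" "y \<in> S"
  shows "B (ad x (sc c y)) (ad x (sc c y)) \<le> 2 * B x x + 2 * c\<^sup>2 * B y y"
  using B_ad_le[OF assms(1) sc_in[OF assms(2), of c]] assms
  by (simp add: B_sc_left B_sc_right sc_in power2_eq_square)

end

text \<open>The first order condition at a one-sided minimum.\<close>

lemma linear_coeff_nonneg:
  fixes a b :: real
  assumes "\<And>s. s > 0 \<Longrightarrow> 0 \<le> 2 * s * a + s\<^sup>2 * b" "b \<ge> 0"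
  shows "0 \<le> a"
proof (rule ccontr)
  assume "\<not> 0 \<le> a"
  then have a: "a < 0" by simp
  define s where "s = - a / (b + 1)"
  have s: "s > 0" unfolding s_def using a assms(2) by (intro divide_pos_pos) auto
  have "s * b \<le> - a" unfolding s_def using a assms(2) by (simp add: field_simps)
  then have "s * (2 * a + s * b) < 0" using s a by (intro mult_pos_neg) auto
  then show False using assms(1)[OF s] by (simp add: power2_eq_square algebra_simps)
qed

section \<open>Quadratic forms in finitely many variables\<close>

lemma quad_indicators:
  assumes U: "finite U" "y \<in> U" "z \<in> U"
  shows "quad U N (\<lambda>x. a * indicator {y} x + b * indicator {z} x) =
        a\<^sup>2 * N y y + b\<^sup>2 * N z z + a * b * (N y z + N z y)"
proof -
  have 1: "(\<Sum>p\<in>U. indicator {w} p * c p) = c w" if "w \<in> U" for w and c :: "'a \<Rightarrow> real"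
    using U that by (subst sum.cong[of U U _ "\<lambda>p. if p = w then c p else 0"]) (auto simp: indicator_def)
  have "quad U N (\<lambda>x. a * indicator {y} x + b * indicator {z} x) =
    (\<Sum>p\<in>U. indicator {y} p * (a * (\<Sum>q\<in>U. indicator {y} q * (a * N p q) + indicator {z} q * (b * N p q)))
       + indicator {z} p * (b * (\<Sum>q\<in>U. indicator {y} q * (a * N p q) + indicator {z} q * (b * N p q))))"
    unfolding quad_def by (rule sum.cong) (auto simp: sum_distrib_left sum.distrib algebra_simps)
  also have "\<dots> = a\<^sup>2 * N y y + b\<^sup>2 * N z z + a * b * (N y z + N z y)"
    unfolding sum.distrib 1[OF assms(2)] 1[OF assms(3)] by (simp add: power2_eq_square algebra_simps)
  finally show ?thesis .
qed

definition bil :: "'a set \<Rightarrow> ('a \<Rightarrow> 'a \<Rightarrow> real) \<Rightarrow> ('a \<Rightarrow> real) \<Rightarrow> ('a \<Rightarrow> real) \<Rightarrow> real" where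
  "bil V K s t = (\<Sum>p\<in>V. \<Sum>q\<in>V. s p * K p q * t q)"

lemma quad_bil: "quad V K t = bil V K t t"
  by (simp add: quad_def bil_def)

lemma quad_cong: "(\<And>p. p \<in> V \<Longrightarrow> s p = t p) \<Longrightarrow> quad V K s = quad V K t"
  unfolding quad_def by (intro sum.cong refl) simp

definition psd_matrix :: "'a set \<Rightarrow> ('a \<Rightarrow> 'a \<Rightarrow> real) \<Rightarrow> bool" where
  "psd_matrix V K \<longleftrightarrow> (\<forall>p q. K p q = K q p) \<and> (\<forall>t. 0 \<le> quad V K t)"

lemma bil_semi_inner:
  assumes "psd_matrix V K"
  shows "semi_inner_space UNIV (\<lambda>s t p. s p + t p) (\<lambda>c t p. c * t p) (bil V K)"
proof
  fix s t u :: "'a \<Rightarrow> real" and c :: real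
  have "bil V K t s = (\<Sum>q\<in>V. \<Sum>p\<in>V. t p * K p q * s q)" unfolding bil_def by (rule sum.swap)
  also have "\<dots> = bil V K s t"
    unfolding bil_def using assms by (intro sum.cong refl) (simp add: psd_matrix_def mult_ac)
  finally show "bil V K s t = bil V K t s" by simp
  show "bil V K (\<lambda>p. s p + t p) u = bil V K s u + bil V K t u"
    by (simp add: bil_def algebra_simps sum.distrib)
  show "bil V K (\<lambda>p. c * s p) t = c * bil V K s t"
    by (simp add: bil_def sum_distrib_left mult_ac)
  show "0 \<le> bil V K s s" using assms by (simp add: psd_matrix_def quad_bil)
qed auto

abbreviation qdist :: "'a set \<Rightarrow> ('a \<Rightarrow> 'a \<Rightarrow> real) \<Rightarrow> ('a \<Rightarrow> real) \<Rightarrow> ('a \<Rightarrow> real) \<Rightarrow> real" where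
  "qdist V K s t \<equiv> quad V K (\<lambda>p. s p - t p)"

lemma qdist_triangle:
  assumes "psd_matrix V N"
  shows "sqrt (qdist V N s r) \<le> sqrt (qdist V N s t) + sqrt (qdist V N t r)"
  using semi_inner_space.sqrt_B_triangle[OF bil_semi_inner[OF assms], of "\<lambda>p. s p - t p" "\<lambda>p. t p - r p"]
  by (simp add: quad_bil)

lemma qdist_commute: "qdist V N s t = qdist V N t s"
  unfolding quad_def by (intro sum.cong refl) (simp add: algebra_simps)

section \<open>Resistance forms\<close>

context resistance_form
begin

sublocale semi_inner_space Dm "\<lambda>u v x. u x + v x" "\<lambda>c u x. c * u x" En
  by unfold_locales (auto intro: dom_add dom_scale En_sym add_left scale_left nonneg)

lemma dom_outside: "u \<in> Dm \<Longrightarrow> x \<notin> V \<Longrightarrow> u x = 0"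
  using dom_ell by (auto simp: ell_def)

lemma dom_diff: "u \<in> Dm \<Longrightarrow> v \<in> Dm \<Longrightarrow> (\<lambda>x. u x - v x) \<in> Dm"
  using dom_add[OF _ dom_scale[of v "-1"]] by simp

lemma En_diff_left:
  "u \<in> Dm \<Longrightarrow> v \<in> Dm \<Longrightarrow> w \<in> Dm \<Longrightarrow> En (\<lambda>x. u x - v x) w = En u w - En v w"
  using B_ad_left[OF _ sc_in[of v "-1"], of u w] B_sc_left[of v w "-1"] by simp

lemma En_diff_right:
  "u \<in> Dm \<Longrightarrow> v \<in> Dm \<Longrightarrow> w \<in> Dm \<Longrightarrow> En w (\<lambda>x. u x - v x) = En w u - En w v"
  by (simp add: En_sym[of w] En_diff_left dom_diff)

abbreviation sqdist :: "('a \<Rightarrow> real) \<Rightarrow> ('a \<Rightarrow> real) \<Rightarrow> real" where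
  "sqdist u v \<equiv> En (\<lambda>x. u x - v x) (\<lambda>x. u x - v x)"

lemma En_diff:
  "u \<in> Dm \<Longrightarrow> v \<in> Dm \<Longrightarrow> sqdist u v = En u u - 2 * En u v + En v v"
  by (simp add: En_diff_left En_diff_right dom_diff En_sym[of v u])

lemma dom_sum:
  "finite I \<Longrightarrow> (\<And>i. i \<in> I \<Longrightarrow> u i \<in> Dm) \<Longrightarrow> (\<lambda>x. \<Sum>i\<in>I. u i x) \<in> Dm"
proof (induction I rule: finite_induct)
  case empty
  show ?case using dom_const[of 0] by (simp add: restr_def)
next
  case (insert i I)
  then show ?case using dom_add[of "u i" "\<lambda>x. \<Sum>i\<in>I. u i x"] by simp
qed

lemma En_sum_left:
  "finite I \<Longrightarrow> (\<And>i. i \<in> I \<Longrightarrow> u i \<in> Dm) \<Longrightarrow> w \<in> Dm \<Longrightarrow>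
    En (\<lambda>x. \<Sum>i\<in>I. u i x) w = (\<Sum>i\<in>I. En (u i) w)"
proof (induction I rule: finite_induct)
  case empty
  show ?case using B_sc_left[of w w 0] empty by simp
next
  case (insert i I)
  then show ?case using add_left[of "u i" "\<lambda>x. \<Sum>i\<in>I. u i x" w] dom_sum[of I u] by simp
qed

lemma En_sum_sum:
  assumes I: "finite I" and J: "finite J"
    and u: "\<And>i. i \<in> I \<Longrightarrow> u i \<in> Dm" and v: "\<And>j. j \<in> J \<Longrightarrow> v j \<in> Dm"
  shows "En (\<lambda>x. \<Sum>i\<in>I. c i * u i x) (\<lambda>x. \<Sum>j\<in>J. d j * v j x) =
    (\<Sum>i\<in>I. \<Sum>j\<in>J. c i * d j * En (u i) (v j))"
proof -
  let ?w = "\<lambda>x. \<Sum>j\<in>J. d j * v j x"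
  have w: "?w \<in> Dm" by (intro dom_sum dom_scale J v)
  have "En (u i) ?w = (\<Sum>j\<in>J. d j * En (u i) (v j))" if i: "i \<in> I" for i
  proof -
    have "En (u i) ?w = En ?w (u i)" by (rule En_sym[OF u[OF i] w])
    also have "\<dots> = (\<Sum>j\<in>J. En (\<lambda>x. d j * v j x) (u i))" by (intro En_sum_left dom_scale J v u i)
    also have "\<dots> = (\<Sum>j\<in>J. d j * En (u i) (v j))"
      using u[OF i] v by (intro sum.cong refl) (simp add: scale_left En_sym[of "u i"])
    finally show ?thesis .
  qed
  moreover have "En (\<lambda>x. \<Sum>i\<in>I. c i * u i x) ?w = (\<Sum>i\<in>I. En (\<lambda>x. c i * u i x) ?w)"
    by (intro En_sum_left dom_scale I u w)
  ultimately show ?thesis using u w by (simp add: scale_left sum_distrib_left mult_ac)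
qed

lemma En_const: assumes "w \<in> Dm" shows "En (restr V (\<lambda>_. c)) w = 0" "En w (restr V (\<lambda>_. c)) = 0"
proof -
  have "En (restr V (\<lambda>_. c)) (restr V (\<lambda>_. c)) = 0"
    using definite[OF dom_const[of c]] by (auto simp: restr_def)
  then show "En (restr V (\<lambda>_. c)) w = 0"
    using Cauchy_Schwarz[OF dom_const[of c] assms] by simp
  then show "En w (restr V (\<lambda>_. c)) = 0" using En_sym[OF assms dom_const[of c]] by simp
qed

lemma En_eq_0_imp_equal:
  assumes "u \<in> Dm" "v \<in> Dm" "sqdist u v = 0" "s \<in> V" "u s = v s"
  shows "u = v"
proof
  fix x
  obtain c where c: "\<forall>x\<in>V. u x - v x = c" using definite[OF dom_diff[OF assms(1,2)]] assms(3) by auto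
  then have "c = 0" using assms(4,5) by auto
  then show "u x = v x" using c dom_outside[OF assms(1)] dom_outside[OF assms(2)] by (cases "x \<in> V") auto
qed

text \<open>Finiteness of the resistance turns energy convergence into pointwise convergence, up to
  the additive constant that the energy does not see.\<close>

lemma En_tendsto_pointwise:
  assumes "\<And>n. u n \<in> Dm" "(\<lambda>n. En (u n) (u n)) \<longlonglongrightarrow> 0" "p \<in> V" "q \<in> V"
  shows "(\<lambda>n. u n p - u n q) \<longlonglongrightarrow> 0"
proof -
  obtain R where R: "\<And>v. v \<in> Dm \<Longrightarrow> En v v > 0 \<Longrightarrow> (v p - v q)\<^sup>2 / En v v \<le> R"
    using resistance_finite[OF assms(3,4)] unfolding bdd_above_def by blast
  have bound: "(v p - v q)\<^sup>2 \<le> R * En v v" if v: "v \<in> Dm" for v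
  proof (cases "En v v = 0")
    case True
    then show ?thesis using definite[OF v] assms(3,4) by auto
  next
    case False
    then have "En v v > 0" using nonneg[OF v] by simp
    then show ?thesis using R[OF v] by (simp add: field_simps)
  qed
  have "(\<lambda>n. (u n p - u n q)\<^sup>2) \<longlonglongrightarrow> 0"
  proof (rule tendsto_sandwich[where f = "\<lambda>_. 0"])
    show "(\<lambda>n. R * En (u n) (u n)) \<longlonglongrightarrow> 0" using tendsto_mult_left[OF assms(2), of R] by simp
  qed (use bound assms(1) in \<open>auto\<close>)
  then show ?thesis using tendsto_real_sqrt[of "\<lambda>n. (u n p - u n q)\<^sup>2" 0] 
    by (simp add: tendsto_rabs_zero_iff)
qed

text \<open>A minimizing sequence is Cauchy by the parallelogram law. Its limit is only determined up to
  a constant, and the constant is fixed by the prescribed values on the nonempty set \<open>S\<close>.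
  The linear constraints \<open>W\<close> serve to minimize among functions that are already harmonic.\<close>

lemma minimizer_exists:
  fixes f :: "'a \<Rightarrow> real"
  defines "C W S \<equiv> {g\<in>Dm. (\<forall>w\<in>W. En g w = 0) \<and> (\<forall>x\<in>S. g x = f x)}"
  assumes "S \<subseteq> V" "s \<in> S" "W \<subseteq> Dm" "C W S \<noteq> {}"
  shows "\<exists>g\<in>C W S. \<forall>g'\<in>C W S. En g g \<le> En g' g'"
proof -
  let ?C = "C W S"
  define I where "I = Inf ((\<lambda>g. En g g) ` ?C)"
  have bdd: "bdd_below ((\<lambda>g. En g g) ` ?C)" by (rule bdd_belowI[of _ 0]) (auto simp: C_def nonneg)
  have I_le: "I \<le> En g g" if "g \<in> ?C" for g
    unfolding I_def by (rule cInf_lower) (use that bdd in auto)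
  have "\<exists>g\<in>?C. En g g < I + 1 / real (Suc n)" for n
    using cInf_lessD[of "(\<lambda>g. En g g) ` ?C" "I + 1 / real (Suc n)"] assms(5) by (auto simp: I_def)
  then obtain u where uC: "\<And>n. u n \<in> ?C" and uI: "\<And>n. En (u n) (u n) < I + 1 / real (Suc n)"
    by metis
  have uD: "u n \<in> Dm" for n using uC by (simp add: C_def)
  have diff: "sqdist (u m) (u n) \<le> 2 / real (Suc m) + 2 / real (Suc n)" for m n
  proof -
    let ?a = "\<lambda>x. (1/2) * (u m x + u n x)"
    have "?a \<in> Dm" using dom_scale[OF dom_add[OF uD uD]] by blast
    moreover have "En ?a w = 0" if "w \<in> W" for w
      using that uC assms(4) dom_add[OF uD[of m] uD[of n]] uD
      by (subst scale_left) (auto simp: C_def add_left subset_iff)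
    ultimately have "?a \<in> ?C" using uC[of m] uC[of n] by (auto simp: C_def)
    then have "I \<le> En ?a ?a" by (rule I_le)
    also have "\<dots> = (En (u m) (u m) + 2 * En (u m) (u n) + En (u n) (u n)) / 4"
      using uD by (simp only: B_bilinear) (simp add: En_sym[of "u n" "u m"] field_simps)
    finally have "4 * I \<le> En (u m) (u m) + 2 * En (u m) (u n) + En (u n) (u n)" by simp
    then show ?thesis using En_diff[OF uD uD, of m n] uI[of m] uI[of n] by simp
  qed
  have "\<exists>N. \<forall>m\<ge>N. \<forall>n\<ge>N. sqdist (u m) (u n) < e" if e: "e > 0" for e
  proof -
    obtain N where N: "1 / real (Suc N) < e / 4" by (rule nat_approx_posE[of "e/4"]) (use e in simp)
    have "2 / real (Suc m) < e / 2" if "m \<ge> N" for m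
    proof -
      have "1 / real (Suc m) \<le> 1 / real (Suc N)" using that by (simp add: frac_le)
      then show ?thesis using N by linarith
    qed
    then have "\<forall>m\<ge>N. \<forall>n\<ge>N. sqdist (u m) (u n) < e"
      using diff by (smt (verit) field_sum_of_halves)
    then show ?thesis by blast
  qed
  then obtain v where v: "v \<in> Dm" and lim: "(\<lambda>n. sqdist (u n) v) \<longlonglongrightarrow> 0"
    using complete[of u] uD by blast
  define g where "g = (\<lambda>x. v x + restr V (\<lambda>_. f s - v s) x)"
  have gD: "g \<in> Dm" unfolding g_def by (intro dom_add v dom_const)
  have Eg: "En g w = En v w" if "w \<in> Dm" for w
    unfolding g_def using that v by (simp add: add_left dom_const En_const)
  have "g x = f x" if x: "x \<in> S" for x
  proof -
    have "(\<lambda>n. (u n x - v x) - (u n s - v s)) \<longlonglongrightarrow> 0"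
      using En_tendsto_pointwise[of "\<lambda>n x. u n x - v x" x s] lim dom_diff uD v x assms(2,3) by auto
    moreover have "u n x = f x" "u n s = f s" for n using uC[of n] x assms(3) by (auto simp: C_def)
    ultimately have "(f x - v x) - (f s - v s) = 0" by (simp add: LIMSEQ_const_iff)
    then show ?thesis using x assms(2) by (auto simp: g_def restr_def)
  qed
  moreover have "En g w = 0" if w: "w \<in> W" for w
  proof -
    have wD: "w \<in> Dm" using w assms(4) by auto
    have "(\<lambda>n. \<bar>En (\<lambda>x. u n x - v x) w\<bar>) \<longlonglongrightarrow> 0"
    proof (rule tendsto_sandwich[where f = "\<lambda>_. 0"])
      show "(\<lambda>n. sqrt (sqdist (u n) v) * sqrt (En w w)) \<longlonglongrightarrow> 0"
        using tendsto_mult_left[OF tendsto_real_sqrt[OF lim]] by (auto simp: mult.commute intro: tendsto_eq_intros)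
    qed (use abs_B_le dom_diff uD v wD in auto)
    moreover have "En (\<lambda>x. u n x - v x) w = - En v w" for n
      using En_diff_left[OF uD v wD, of n] uC[of n] w by (auto simp: C_def)
    ultimately show ?thesis using Eg[OF wD] by (simp add: LIMSEQ_const_iff)
  qed
  ultimately have gC: "g \<in> ?C" using gD by (auto simp: C_def)
  have "sqrt (En g g) \<le> sqrt I"
  proof (rule LIMSEQ_le_const)
    have "(\<lambda>n. I + 1 / real (Suc n)) \<longlonglongrightarrow> I + 0"
      by (intro tendsto_intros LIMSEQ_Suc[OF lim_1_over_n])
    then show "(\<lambda>n. sqrt (sqdist (u n) v) + sqrt (I + 1 / real (Suc n))) \<longlonglongrightarrow> sqrt I"
      using tendsto_add[OF tendsto_real_sqrt[OF lim] tendsto_real_sqrt] by fastforce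
    have "sqrt (En g g) \<le> sqrt (sqdist (u n) v) + sqrt (I + 1 / real (Suc n))" for n
    proof -
      have "En g g = En v v" using Eg[OF gD] Eg[OF v] En_sym[OF gD v] by simp
      have eq: "sqdist v (u n) = sqdist (u n) v"
        using En_diff[OF v uD] En_diff[OF uD v] En_sym[OF v uD] by simp
      have "sqrt (En v v) \<le> sqrt (sqdist (u n) v) + sqrt (En (u n) (u n))"
        using sqrt_B_triangle[OF dom_diff[OF v uD] uD, of n n] eq by simp
      moreover have "sqrt (En (u n) (u n)) \<le> sqrt (I + 1 / real (Suc n))"
        using uI[of n] by (intro real_sqrt_le_mono) simp
      ultimately have "sqrt (En v v) \<le> sqrt (sqdist (u n) v) + sqrt (I + 1 / real (Suc n))"
        by linarith
      then show ?thesis using \<open>En g g = En v v\<close> by (simp only:)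
    qed
    then show "\<exists>N. \<forall>n\<ge>N. sqrt (En g g) \<le> sqrt (sqdist (u n) v) + sqrt (I + 1 / real (Suc n))"
      by blast
  qed
  then have "En g g \<le> I" by simp
  then show ?thesis using gC I_le by force
qed

text \<open>Strict convexity: the midpoint of two minimizers would have less energy, unless they differ by a
constant.\<close>

lemma minimizer_unique:
  fixes f :: "'a \<Rightarrow> real"
  defines "C W S \<equiv> {g\<in>Dm. (\<forall>w\<in>W. En g w = 0) \<and> (\<forall>x\<in>S. g x = f x)}"
  assumes "S \<subseteq> V" "s \<in> S" "W \<subseteq> Dm"
    and "g \<in> C W S" "\<And>g'. g' \<in> C W S \<Longrightarrow> En g g \<le> En g' g'"
    and "k \<in> C W S" "\<And>g'. g' \<in> C W S \<Longrightarrow> En k k \<le> En g' g'"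
  shows "g = k"
proof -
  let ?a = "\<lambda>x. (1/2) * (g x + k x)"
  have gD: "g \<in> Dm" and kD: "k \<in> Dm" using assms by (auto simp: C_def)
  have "?a \<in> Dm" using dom_scale[OF dom_add[OF gD kD]] by blast
  moreover have "En ?a w = 0" if "w \<in> W" for w
    using that assms dom_add[OF gD kD] gD kD
    by (subst scale_left) (auto simp: C_def add_left subset_iff)
  ultimately have "?a \<in> C W S" using assms(5,7) by (auto simp: C_def)
  then have "En g g \<le> En ?a ?a" "En k k \<le> En ?a ?a" using assms(6,8) by auto
  moreover have "En ?a ?a = (En g g + 2 * En g k + En k k) / 4"
    using gD kD by (simp only: B_bilinear) (simp add: En_sym[of k g] field_simps)
  ultimately have "sqdist g k \<le> 0"
    using En_diff[OF gD kD] by (simp add: field_simps)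
  then have "sqdist g k = 0" using nonneg[OF dom_diff[OF gD kD]] by simp
  then show ?thesis
    using En_eq_0_imp_equal[OF gD kD] assms(2,3,5,7) by (auto simp: C_def)
qed

text \<open>The Euler-Lagrange equation for minimal energy with prescribed values on \<open>U\<close>; unlike minimality
it is visibly linear in \<open>g\<close>.\<close>

definition harm_on :: "'a set \<Rightarrow> ('a \<Rightarrow> real) \<Rightarrow> bool" where
  "harm_on U g \<longleftrightarrow> g \<in> Dm \<and> (\<forall>w\<in>Dm. (\<forall>x\<in>U. w x = 0) \<longrightarrow> En g w = 0)"

lemma harm_on_le:
  assumes "harm_on U g" "k \<in> Dm" "\<forall>x\<in>U. k x = g x"
  shows "En g g \<le> En k k"
proof -
  have g: "g \<in> Dm" using assms by (simp add: harm_on_def)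
  have "En g (\<lambda>x. k x - g x) = 0" using assms dom_diff[OF assms(2) g] by (auto simp: harm_on_def)
  then have "En g k = En g g" using En_diff_right[OF assms(2) g g] by simp
  then show ?thesis
    using nonneg[OF dom_diff[OF assms(2) g]] En_diff[OF assms(2) g] En_sym[OF assms(2) g] by simp
qed

lemma harm_on_iff_minimal:
  "harm_on U g \<longleftrightarrow> g \<in> Dm \<and> (\<forall>k\<in>Dm. (\<forall>x\<in>U. k x = g x) \<longrightarrow> En g g \<le> En k k)"
proof (intro iffI conjI)
  assume *: "g \<in> Dm \<and> (\<forall>k\<in>Dm. (\<forall>x\<in>U. k x = g x) \<longrightarrow> En g g \<le> En k k)"
  have "En g w = 0" if w: "w \<in> Dm" "\<forall>x\<in>U. w x = 0" for w
  proof -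
    have le: "0 \<le> 2 * s * En g w + s\<^sup>2 * En w w" for s
      using *[THEN conjunct2, rule_format, of "\<lambda>x. g x + s * w x"] w * B_expand[of g w s]
      by (simp add: dom_add dom_scale)
    have "0 \<le> En g w" by (rule linear_coeff_nonneg[of _ "En w w"]) (use le nonneg[OF w(1)] in auto)
    moreover have "0 \<le> - En g w"
      by (rule linear_coeff_nonneg[of _ "En w w"]) (use le[of "- s" for s] nonneg[OF w(1)] in auto)
    ultimately show ?thesis by simp
  qed
  then show "harm_on U g" using * by (simp add: harm_on_def)
qed (use harm_on_le in \<open>auto simp: harm_on_def\<close>)

lemma harm_on_unique:
  assumes "harm_on U g" "harm_on U k" "\<forall>x\<in>U. g x = k x" "U \<subseteq> V" "U \<noteq> {}"
  shows "g = k"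
proof -
  have D: "g \<in> Dm" "k \<in> Dm" using assms by (auto simp: harm_on_def)
  obtain s where s: "s \<in> U" using assms(5) by auto
  have "En g (\<lambda>x. g x - k x) = 0" "En k (\<lambda>x. g x - k x) = 0"
    using assms dom_diff[OF D] by (auto simp: harm_on_def)
  then have "sqdist g k = 0"
    using En_diff_left[OF D dom_diff[OF D]] by simp
  then show ?thesis using En_eq_0_imp_equal[OF D] s assms(3,4) by blast
qed

lemma harm_on_exists:
  assumes "finite U" "U \<subseteq> V" "U \<noteq> {}"
  shows "\<exists>g. harm_on U g \<and> (\<forall>x\<in>U. g x = f x)"
proof -
  obtain s where "s \<in> U" using assms(3) by auto
  moreover obtain u where "u \<in> Dm" "\<forall>x\<in>U. u x = f x" using interpolate[OF assms(1,2), of f] by auto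
  ultimately have "\<exists>g\<in>{g\<in>Dm. (\<forall>w\<in>{}. En g w = 0) \<and> (\<forall>x\<in>U. g x = f x)}.
      \<forall>k\<in>{g\<in>Dm. (\<forall>w\<in>{}. En g w = 0) \<and> (\<forall>x\<in>U. g x = f x)}. En g g \<le> En k k"
    using assms(2) by (intro minimizer_exists[of U s]) auto
  then obtain g where g: "g \<in> Dm" "\<forall>x\<in>U. g x = f x"
     "\<And>k. k \<in> Dm \<Longrightarrow> \<forall>x\<in>U. k x = f x \<Longrightarrow> En g g \<le> En k k"
    by auto
  then have "harm_on U g" by (simp add: harm_on_iff_minimal)
  then show ?thesis using g by blast
qed

lemma harm_on_add: "harm_on U g \<Longrightarrow> harm_on U k \<Longrightarrow> harm_on U (\<lambda>x. g x + k x)"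
  by (auto simp: harm_on_def dom_add add_left)

lemma harm_on_scale: "harm_on U g \<Longrightarrow> harm_on U (\<lambda>x. c * g x)"
  by (auto simp: harm_on_def dom_scale scale_left)

lemma harm_on_sum:
  "finite I \<Longrightarrow> (\<And>i. i \<in> I \<Longrightarrow> harm_on U (g i)) \<Longrightarrow> harm_on U (\<lambda>x. \<Sum>i\<in>I. g i x)"
  by (auto simp: harm_on_def dom_sum En_sum_left)

lemma form_trace_eq:
  assumes "harm_on U g" "\<forall>x\<in>U. g x = f x"
  shows "form_trace Dm En U f = En g g"
  unfolding form_trace_def
proof (rule Least_equality)
  show "\<exists>k\<in>Dm. (\<forall>x\<in>U. k x = f x) \<and> En g g = En k k"
    using assms by (auto simp: harm_on_def)
qed (use assms harm_on_le[OF assms(1)] in auto)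

text \<open>The trace on a finite set is a quadratic form in the boundary values, because the harmonic
  extension is linear in them.\<close>

lemma ex1_trace_matrix:
  assumes U: "finite U" "U \<subseteq> V" "U \<noteq> {}"
  shows "\<exists>!K. (\<forall>y z. K y z = K z y) \<and> (\<forall>y z. y \<notin> U \<or> z \<notin> U \<longrightarrow> K y z = 0) \<and>
     (\<forall>f. form_trace Dm En U f = quad U K f)"
proof -
  have "\<exists>g. harm_on U g \<and> (\<forall>x\<in>U. g x = indicator {y} x)" for y
    by (rule harm_on_exists[OF U])
  then obtain e where e: "\<And>y. harm_on U (e y)" "\<And>y x. x \<in> U \<Longrightarrow> e y x = indicator {y} x"
    by metis
  have eD: "e y \<in> Dm" for y using e(1)[of y] by (simp add: harm_on_def)
  define K where "K y z = (if y \<in> U \<and> z \<in> U then En (e y) (e z) else 0)" for y z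
  have tr: "form_trace Dm En U f = quad U K f" for f
  proof -
    define g where "g x = (\<Sum>y\<in>U. f y * e y x)" for x
    have "harm_on U g" unfolding g_def using U e by (intro harm_on_sum harm_on_scale) auto
    moreover have "g x = f x" if "x \<in> U" for x
    proof -
      have "g x = (\<Sum>y\<in>U. if y = x then f y else 0)"
        unfolding g_def by (rule sum.cong) (auto simp: e that)
      then show ?thesis using that U by simp
    qed
    ultimately have "form_trace Dm En U f = En g g" by (intro form_trace_eq) auto
    also have "\<dots> = (\<Sum>y\<in>U. \<Sum>z\<in>U. f y * f z * En (e y) (e z))"
      unfolding g_def by (intro En_sum_sum U eD)
    also have "\<dots> = quad U K f"
      unfolding quad_def K_def by (intro sum.cong refl) simp
    finally show ?thesis .
  qed
  show ?thesis
  proof (rule ex1I[of _ K], safe)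
    show "K y z = K z y" for y z using En_sym[OF eD eD] by (simp add: K_def)
    show "y \<notin> U \<Longrightarrow> K y z = 0" "z \<notin> U \<Longrightarrow> K y z = 0" for y z by (simp_all add: K_def)
    show "form_trace Dm En U f = quad U K f" for f by (rule tr)
  next
    fix L assume L: "\<forall>y z. L y z = L z y" "\<forall>y z. y \<notin> U \<or> z \<notin> U \<longrightarrow> L y z = 0"
       "\<forall>f. form_trace Dm En U f = quad U L f"
    show "L = K"
    proof (intro ext)
      fix y z
      show "L y z = K y z"
      proof (cases "y \<in> U \<and> z \<in> U")
        case True
        have *: "quad U L f = quad U K f" for f using L(3) tr by simp
        have Ks: "K z y = K y z" using En_sym[OF eD eD] by (simp add: K_def)
        have **: "a\<^sup>2 * L y y + b\<^sup>2 * L z z + a * b * (2 * L y z) =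
            a\<^sup>2 * K y y + b\<^sup>2 * K z z + a * b * (2 * K y z)" for a b
          using *[of "\<lambda>x. a * indicator {y} x + b * indicator {z} x"] True quad_indicators[OF U(1), of y z _ a b] L(1)[rule_format, of z y] Ks
          by simp
        show ?thesis using **[of 1 0] **[of 0 1] **[of 1 1] by simp
      qed (use L in \<open>auto simp: K_def\<close>)
    qed
  qed
qed

text \<open>Cutting \<open>u\<close> off at a small height leaves little energy if \<open>u\<close> is harmonic: by the Markov
  property the cut-off and the remainder have nonnegative mutual energy, so the energy of the
  cut-off is at most its mutual energy with \<open>u\<close>, and the latter is a linear function of the
  (small) boundary values of the cut-off.\<close>

lemma energy_cutoff_le:
  fixes c :: real
  assumes u: "u \<in> Dm" and e: "e > 0"
  defines "k \<equiv> restr V (\<lambda>x. max (- e) (min (u x - c) e))"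
  shows "k \<in> Dm" "En k k \<le> En k u"
proof -
  \<comment> \<open>the window of height \<open>e\<close> about \<open>c\<close> is rescaled to the unit interval\<close>
  define w where "w = (\<lambda>x. 1 / (2 * e) * (u x + restr V (\<lambda>_. e - c) x))"
  define v where "v = (\<lambda>x. max 0 (min (w x) 1))"
  have wD: "w \<in> Dm" unfolding w_def by (intro dom_scale dom_add dom_const u)
  have vD: "v \<in> Dm" unfolding v_def by (rule markov_dom[OF wD])
  have keq: "k = (\<lambda>x. 2 * e * v x + restr V (\<lambda>_. - e) x)"
  proof
    fix x
    have "u x = 0" if "x \<notin> V" using that u dom_outside by simp
    moreover have "max (- e) (min t e) = 2 * e * max 0 (min (1 / (2 * e) * (t + e)) 1) - e" for t
      using e by (auto simp: max_def min_def field_simps)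
    from this[of "u x - c"]
    have "max (- e) (min (u x - c) e) = 2 * e * max 0 (min (1 / (2 * e) * (u x + (e - c))) 1) - e"
      by (simp add: algebra_simps)
    ultimately show "k x = 2 * e * v x + restr V (\<lambda>_. - e) x"
      by (auto simp: k_def v_def w_def restr_def)
  qed
  show kD: "k \<in> Dm" unfolding keq by (intro dom_add dom_scale vD dom_const)
  have Ek: "En k z = 2 * e * En v z" if "z \<in> Dm" for z
    unfolding keq using vD that by (simp add: add_left scale_left dom_scale dom_const En_const)
  \<comment> \<open>what is cut off lies beyond the bounds \<open>0\<close> and \<open>1\<close>, so truncating \<open>v + t (w - v)\<close> gives \<open>v\<close> again\<close>
  have "0 \<le> 2 * t * En v (\<lambda>x. w x - v x) + t\<^sup>2 * sqdist w v" if "t > 0" for t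
  proof -
    let ?z = "\<lambda>x. v x + t * (w x - v x)"
    have zD: "?z \<in> Dm" by (intro dom_add dom_scale dom_diff vD wD)
    have "max 0 (min (?z x) 1) = v x" for x
    proof (cases "w x < 0")
      case True
      then have "t * w x < 0" using that by (simp add: mult_pos_neg)
      then show ?thesis using True by (simp add: v_def)
    next
      case False
      show ?thesis
      proof (cases "w x > 1")
        case True
        then have "t * (w x - 1) > 0" using that by simp
        then show ?thesis using True by (simp add: v_def)
      qed (use False in \<open>simp add: v_def\<close>)
    qed
    then have "En v v \<le> En ?z ?z" using markov[OF zD] by simp
    then show ?thesis using B_expand[OF vD dom_diff[OF wD vD], of t] by simp
  qed note le = this
  have "0 \<le> En v (\<lambda>x. w x - v x)"
    by (rule linear_coeff_nonneg[OF le nonneg[OF dom_diff[OF wD vD]]])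
  then have "En v v \<le> En v w" using En_diff_right[OF wD vD vD] by simp
  moreover have "En v w = 1 / (2 * e) * En v u"
    unfolding w_def B_sc_right[OF dom_add[OF u dom_const] vD] B_ad_right[OF u dom_const vD]
    by (simp add: En_const[OF vD])
  moreover have "En k k = (2 * e) * (2 * e) * En v v"
    using Ek[OF kD] Ek[OF vD] En_sym[OF kD vD] by simp
  moreover have "En k u = 2 * e * En v u" by (rule Ek[OF u])
  ultimately show "En k k \<le> En k u" using e by (simp add: field_simps)
qed

lemma harm_on_cutoff_small:
  assumes "harm_on U u" "finite U" "U \<subseteq> V"
  shows "\<exists>C. \<forall>e>0. \<forall>c. En (restr V (\<lambda>x. max (- e) (min (u x - c) e)))
           (restr V (\<lambda>x. max (- e) (min (u x - c) e))) \<le> C * e"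
proof -
  have uD: "u \<in> Dm" using assms by (simp add: harm_on_def)
  have "\<exists>f\<in>Dm. \<forall>x\<in>U. f x = indicator {p} x" for p
    using interpolate[OF assms(2,3), of "indicator {p}"] .
  then obtain psi where psi: "\<And>p. psi p \<in> Dm" "\<And>p x. x \<in> U \<Longrightarrow> psi p x = indicator {p} x" by metis
  have "En k k \<le> (\<Sum>p\<in>U. \<bar>En (psi p) u\<bar>) * e"
    if e: "e > 0" and k: "k = restr V (\<lambda>x. max (- e) (min (u x - c) e))" for e c k
  proof -
    have kD: "k \<in> Dm" and kk: "En k k \<le> En k u" using energy_cutoff_le[OF uD e] k by auto
    define g where "g = (\<lambda>x. \<Sum>p\<in>U. k p * psi p x)"
    have gD: "g \<in> Dm" unfolding g_def using assms psi by (intro dom_sum dom_scale) auto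
    have "g x = k x" if "x \<in> U" for x
    proof -
      have "g x = (\<Sum>p\<in>U. if p = x then k p else 0)"
        unfolding g_def by (rule sum.cong) (auto simp: psi that)
      then show ?thesis using that assms by simp
    qed
    then have "En u (\<lambda>x. k x - g x) = 0" using assms(1) dom_diff[OF kD gD] by (auto simp: harm_on_def)
    then have "En k u = En g u" using En_diff_right[OF kD gD uD] En_sym uD kD gD by simp
    also have "\<dots> = (\<Sum>p\<in>U. k p * En (psi p) u)"
      unfolding g_def using assms psi uD by (subst En_sum_left) (auto simp: dom_scale scale_left)
    also have "\<dots> \<le> (\<Sum>p\<in>U. e * \<bar>En (psi p) u\<bar>)"
    proof (rule sum_mono)
      fix p assume "p \<in> U"
      have "\<bar>k p\<bar> \<le> e" using e by (auto simp: k restr_def)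
      then have "\<bar>k p * En (psi p) u\<bar> \<le> e * \<bar>En (psi p) u\<bar>"
        unfolding abs_mult by (rule mult_right_mono) simp
      then show "k p * En (psi p) u \<le> e * \<bar>En (psi p) u\<bar>" by simp
    qed
    finally show ?thesis using kk by (simp add: sum_distrib_left mult.commute)
  qed
  then show ?thesis by blast
qed

end

section \<open>Cells of a finitely ramified fractal\<close>

locale fr_fractal =
  fixes X :: "('a::metric_space, 'i, 'z) frf_scheme"
  assumes frf: "finitely_ramified_fractal X"
begin

definition sub :: "nat \<Rightarrow> 'i \<Rightarrow> 'i set" where
  "sub m a = {b \<in> lev X m. cell X b \<subseteq> cell X a}"

lemmas frf_unfolded = frf[unfolded finitely_ramified_fractal_def inj_on_def]

lemmas frf_tail4 = frf_unfolded[THEN conjunct2, THEN conjunct2, THEN conjunct2, THEN conjunct2]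

lemmas frf_tail9 = frf_tail4[THEN conjunct2, THEN conjunct2, THEN conjunct2, THEN conjunct2, THEN conjunct2]

lemma compact_carr: "compact (carr X)"
  using frf_unfolded[THEN conjunct1] by blast

lemma cell_inj: "a \<in> idx X \<Longrightarrow> b \<in> idx X \<Longrightarrow> cell X a = cell X b \<Longrightarrow> a = b"
  using frf_unfolded[THEN conjunct2, THEN conjunct2, THEN conjunct1] by blast

lemma compact_cell: "a \<in> idx X \<Longrightarrow> compact (cell X a)"
  using frf_unfolded[THEN conjunct2, THEN conjunct2, THEN conjunct2, THEN conjunct1] by blast

lemma connected_cell: "a \<in> idx X \<Longrightarrow> connected (cell X a)"
  using frf_unfolded[THEN conjunct2, THEN conjunct2, THEN conjunct2, THEN conjunct1] by blast

lemma cell_subset_carr: "a \<in> idx X \<Longrightarrow> cell X a \<subseteq> carr X"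
  using frf_unfolded[THEN conjunct2, THEN conjunct2, THEN conjunct2, THEN conjunct1] by blast

lemma finite_vert: "a \<in> idx X \<Longrightarrow> finite (vert X a)"
  using frf_tail4[THEN conjunct1] by blast

lemma vert_subset_cell: "a \<in> idx X \<Longrightarrow> vert X a \<subseteq> cell X a"
  using frf_tail4[THEN conjunct1] by blast

lemma card_vert: "a \<in> idx X \<Longrightarrow> 2 \<le> card (vert X a)"
  using frf_tail4[THEN conjunct1] by blast

lemma vert_subset_UN: "a \<in> idx X \<Longrightarrow> finite B \<Longrightarrow> B \<subseteq> idx X \<Longrightarrow> cell X a = (\<Union>b\<in>B. cell X b) \<Longrightarrow>
        vert X a \<subseteq> (\<Union>b\<in>B. vert X b)"
  using frf_tail4[THEN conjunct2, THEN conjunct1] by blast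

lemma idx_eq: "idx X = (\<Union>n. lev X n)"
  using frf_tail4[THEN conjunct2, THEN conjunct2, THEN conjunct1] by blast

lemma finite_lev: "finite (lev X n)"
  using frf_tail4[THEN conjunct2, THEN conjunct2, THEN conjunct2, THEN conjunct1] by blast

lemma lev_disjoint: "m \<noteq> n \<Longrightarrow> lev X m \<inter> lev X n = {}"
  using frf_tail4[THEN conjunct2, THEN conjunct2, THEN conjunct2, THEN conjunct2, THEN conjunct1] by blast

lemma lev_0: "lev X 0 = {base X}"
  using frf_tail9[THEN conjunct1] by blast

lemma cell_base: "cell X (base X) = carr X"
  using frf_tail9[THEN conjunct2, THEN conjunct1] by blast

lemma cell_splits: "a \<in> lev X n \<Longrightarrow> \<exists>B\<subseteq>lev X (Suc n). cell X a = (\<Union>b\<in>B. cell X b)"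
  using frf_tail9[THEN conjunct2, THEN conjunct2, THEN conjunct1] by blast

lemma cell_Int: "a \<in> lev X n \<Longrightarrow> b \<in> lev X n \<Longrightarrow> a \<noteq> b \<Longrightarrow> cell X a \<inter> cell X b = vert X a \<inter> vert X b"
  using frf_tail9[THEN conjunct2, THEN conjunct2, THEN conjunct2, THEN conjunct1] by blast

lemma cells_shrink: "(\<And>n. s n \<in> idx X \<and> cell X (s (Suc n)) \<subset> cell X (s n)) \<Longrightarrow>
        \<exists>x\<in>carr X. (\<Inter>n. cell X (s n)) = {x}"
  using frf_tail9[THEN conjunct2, THEN conjunct2, THEN conjunct2, THEN conjunct2] by blast

lemma lev_idx: "a \<in> lev X n \<Longrightarrow> a \<in> idx X"
  by (auto simp: idx_eq)

lemma countable_idx: "countable (idx X)"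
  unfolding idx_eq by (intro countable_UN) (auto intro: countable_finite finite_lev)

lemma base_lev: "base X \<in> lev X 0"
  by (simp add: lev_0)

lemma finite_sub: "finite (sub m a)"
  unfolding sub_def using finite_lev by simp

lemma sub_lev: "b \<in> sub m a \<Longrightarrow> b \<in> lev X m"
  and sub_cell: "b \<in> sub m a \<Longrightarrow> cell X b \<subseteq> cell X a"
  by (auto simp: sub_def)

lemma closed_cell: "a \<in> idx X \<Longrightarrow> closed (cell X a)"
  by (simp add: compact_cell compact_imp_closed)

lemma vert_nonempty: "a \<in> idx X \<Longrightarrow> vert X a \<noteq> {}"
  by (metis card.empty card_vert not_numeral_le_zero)

lemma cell_infinite: assumes "a \<in> idx X" shows "infinite (cell X a)"
proof
  assume "finite (cell X a)"
  then have "cell X a = {} \<or> (\<exists>x. cell X a = {x})"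
    using connected_finite_iff_sing connected_cell[OF assms] by blast
  then have "card (cell X a) \<le> 1" by auto
  moreover have "card (vert X a) \<le> card (cell X a)"
    using \<open>finite (cell X a)\<close> vert_subset_cell[OF assms] card_mono by blast
  ultimately show False using card_vert[OF assms] by simp
qed

lemma finite_cell_Int: "a \<in> lev X n \<Longrightarrow> b \<in> lev X n \<Longrightarrow> a \<noteq> b \<Longrightarrow> finite (cell X a \<inter> cell X b)"
  using cell_Int[of a n b] finite_vert[OF lev_idx] by auto

text \<open>A cell is infinite, being connected with two points, and distinct cells of one level meet in
  finite sets. So no cell is covered by other cells of its level.\<close>

lemma cell_subset_UN_imp_mem:
  assumes "b \<in> lev X n" "B \<subseteq> lev X n" "cell X b \<subseteq> (\<Union>c\<in>B. cell X c)"
  shows "b \<in> B"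
proof (rule ccontr)
  assume "b \<notin> B"
  then have "finite (\<Union>c\<in>B. cell X c \<inter> cell X b)"
    using finite_subset[OF assms(2) finite_lev] finite_cell_Int[OF _ assms(1)] assms(2)
    by (intro finite_UN_I) blast+
  moreover have "cell X b \<subseteq> (\<Union>c\<in>B. cell X c \<inter> cell X b)" using assms(3) by auto
  ultimately show False using cell_infinite[OF lev_idx[OF assms(1)]] finite_subset by blast
qed

lemma sub_unique:
  assumes "a \<in> lev X n" "a' \<in> lev X n" "b \<in> idx X" "cell X b \<subseteq> cell X a" "cell X b \<subseteq> cell X a'"
  shows "a = a'"
proof (rule ccontr)
  assume "a \<noteq> a'"
  then have "finite (cell X a \<inter> cell X a')" using assms finite_cell_Int by blast
  then show False using assms cell_infinite[OF assms(3)] finite_subset[of "cell X b"] by blast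
qed

lemma carr_eq_UN_lev: "carr X = (\<Union>a\<in>lev X n. cell X a)"
proof (induction n)
  case 0
  show ?case by (simp add: lev_0 cell_base)
next
  case (Suc n)
  have "cell X a \<subseteq> (\<Union>b\<in>lev X (Suc n). cell X b)" if "a \<in> lev X n" for a
    using cell_splits[OF that] by blast
  moreover have "cell X b \<subseteq> carr X" if "b \<in> lev X (Suc n)" for b
    using cell_subset_carr[OF lev_idx[OF that]] .
  moreover have "carr X \<subseteq> (\<Union>b\<in>lev X (Suc n). cell X b)" using calculation(1) unfolding Suc.IH by (rule UN_least)
  ultimately show ?case by (intro equalityI UN_least)
qed

lemma cell_eq_UN_sub_Suc:
  assumes "a \<in> lev X n"
  shows "cell X a = (\<Union>b\<in>sub (Suc n) a. cell X b)"
proof -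
  obtain B where B: "B \<subseteq> lev X (Suc n)" "cell X a = (\<Union>b\<in>B. cell X b)" using cell_splits[OF assms] by blast
  then have "B \<subseteq> sub (Suc n) a" by (auto simp: sub_def)
  then have "cell X a \<subseteq> (\<Union>b\<in>sub (Suc n) a. cell X b)" unfolding B(2) by (rule UN_mono) simp
  then show ?thesis using sub_cell by (intro equalityI UN_least)
qed

text \<open>The cells that arise by subdividing the cells of level \<open>n\<close> cover everything, which leaves no room
for another cell of level \<open>n + 1\<close>.\<close>

lemma ex_parent_Suc:
  assumes "b \<in> lev X (Suc n)"
  shows "\<exists>a\<in>lev X n. cell X b \<subseteq> cell X a"
proof -
  have "cell X b \<subseteq> (\<Union>a\<in>lev X n. cell X a)"
    using carr_eq_UN_lev[of n] cell_subset_carr[OF lev_idx[OF assms]] by simp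
  also have "\<dots> = (\<Union>c\<in>(\<Union>a\<in>lev X n. sub (Suc n) a). cell X c)"
    using cell_eq_UN_sub_Suc by blast
  finally have "b \<in> (\<Union>a\<in>lev X n. sub (Suc n) a)"
    by (rule cell_subset_UN_imp_mem[OF assms, rotated]) (auto simp: sub_def)
  then show ?thesis by (auto simp: sub_def)
qed

lemma ex_ancestor:
  assumes "b \<in> lev X m" "n \<le> m"
  shows "\<exists>a\<in>lev X n. cell X b \<subseteq> cell X a"
  using assms(2,1)
proof (induction m arbitrary: b rule: dec_induct)
  case (step m)
  obtain c where "c \<in> lev X m" "cell X b \<subseteq> cell X c" using ex_parent_Suc step.prems by blast
  then show ?case using step.IH by blast
qed auto

lemma sub_self: assumes "a \<in> lev X n" shows "sub n a = {a}"
  using sub_unique[OF assms _ lev_idx] assms by (auto simp: sub_def)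

lemma sub_disjoint:
  assumes "a \<in> lev X n" "b \<in> lev X n" "a \<noteq> b" shows "sub m a \<inter> sub m b = {}"
  using sub_unique[OF assms(1,2) lev_idx] assms(3) by (auto simp: sub_def)

lemma sub_eq_UN:
  assumes "a \<in> lev X n" "n \<le> k" "k \<le> m"
  shows "sub m a = (\<Union>c\<in>sub k a. sub m c)"
proof
  show "sub m a \<subseteq> (\<Union>c\<in>sub k a. sub m c)"
  proof
    fix b assume b: "b \<in> sub m a"
    then obtain c where c: "c \<in> lev X k" "cell X b \<subseteq> cell X c"
      using ex_ancestor[OF sub_lev assms(3)] by blast
    then obtain a' where a': "a' \<in> lev X n" "cell X c \<subseteq> cell X a'" using ex_ancestor[OF _ assms(2)] by blast
    have "a' = a" using sub_unique[OF a'(1) assms(1) lev_idx[OF sub_lev[OF b]]] c a' sub_cell[OF b] by blast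
    then show "b \<in> (\<Union>c\<in>sub k a. sub m c)" using a' c b by (auto simp: sub_def)
  qed
qed (auto simp: sub_def)

lemma sub_base: "sub m (base X) = lev X m"
  using cell_subset_carr[OF lev_idx] by (auto simp: sub_def cell_base)

lemma sum_sub_split:
  assumes "a \<in> lev X n" "n \<le> k" "k \<le> m"
  shows "(\<Sum>b\<in>sub m a. f b) = (\<Sum>c\<in>sub k a. \<Sum>b\<in>sub m c. f b)"
  unfolding sub_eq_UN[OF assms]
  by (rule sum.UNION_disjoint) (auto simp: finite_sub dest: sub_lev sub_disjoint)

lemma sum_lev_split:
  assumes "n \<le> m"
  shows "(\<Sum>b\<in>lev X m. f b) = (\<Sum>a\<in>lev X n. \<Sum>b\<in>sub m a. f b)"
  using sum_sub_split[OF base_lev _ assms, of f] by (simp add: sub_base)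

lemma cell_eq_UN_sub:
  assumes "a \<in> lev X n" "n \<le> m"
  shows "cell X a = (\<Union>b\<in>sub m a. cell X b)"
  using assms(2)
proof (induction m rule: dec_induct)
  case base
  then show ?case using sub_self[OF assms(1)] by simp
next
  case (step m)
  have "(\<Union>b\<in>sub (Suc m) a. cell X b) = (\<Union>c\<in>sub m a. \<Union>b\<in>sub (Suc m) c. cell X b)"
    using sub_eq_UN[OF assms(1), of m "Suc m"] step by auto
  also have "\<dots> = (\<Union>c\<in>sub m a. cell X c)"
    using cell_eq_UN_sub_Suc[OF sub_lev] by simp
  finally show ?case using step by simp
qed

lemma cell_psubset:
  assumes "a \<in> lev X n" "b \<in> sub (Suc n) a"
  shows "cell X b \<subset> cell X a"
proof -
  have "a \<noteq> b" using assms sub_lev[OF assms(2)] lev_disjoint[of n "Suc n"] by auto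
  then show ?thesis using cell_inj[OF lev_idx[OF assms(1)] lev_idx[OF sub_lev[OF assms(2)]]] sub_cell[OF assms(2)]
    by auto
qed

subsection \<open>Nested chains of cells\<close>

lemma chain_Inter:
  assumes "\<And>n. s n \<in> lev X n" "\<And>n. cell X (s (Suc n)) \<subseteq> cell X (s n)"
  shows "\<exists>x\<in>carr X. (\<Inter>n. cell X (s n)) = {x}"
proof (rule cells_shrink)
  fix n
  have "s (Suc n) \<in> sub (Suc n) (s n)" using assms by (simp add: sub_def)
  then show "s n \<in> idx X \<and> cell X (s (Suc n)) \<subset> cell X (s n)"
    using cell_psubset[OF assms(1)] lev_idx[OF assms(1)] by simp
qed

lemma chain_Inter_closed:
  assumes s: "\<And>n. s n \<in> lev X n" "\<And>n. cell X (s (Suc n)) \<subseteq> cell X (s n)"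
    and T: "closed T" "\<And>n. cell X (s n) \<inter> T \<noteq> {}"
  shows "(\<Inter>n. cell X (s n)) \<inter> T \<noteq> {}"
proof -
  have "carr X \<inter> (\<Inter>n\<in>UNIV. cell X (s n) \<inter> T) \<noteq> {}"
  proof (rule compact_imp_fip_image[OF compact_carr])
    show "closed (cell X (s n) \<inter> T)" for n using closed_cell[OF lev_idx[OF s(1)]] T(1) by auto
    fix I :: "nat set" assume I: "finite I"
    obtain N where N: "\<And>n. n \<in> I \<Longrightarrow> n \<le> N" using I unfolding finite_nat_set_iff_bounded_le by auto
    obtain x where x: "x \<in> cell X (s N)" "x \<in> T" using T(2)[of N] by auto
    have "x \<in> cell X (s n)" if "n \<in> I" for n
      using lift_Suc_antimono_le[of "\<lambda>n. cell X (s n)", OF s(2) N[OF that]] x by auto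
    then show "carr X \<inter> (\<Inter>n\<in>I. cell X (s n) \<inter> T) \<noteq> {}"
      using x cell_subset_carr[OF lev_idx[OF s(1)], of N] by blast
  qed
  then show ?thesis by auto
qed

text \<open>Koenig's lemma: the tree of cells is finitely branching.\<close>

lemma chain_exists:
  assumes inf: "\<And>n. \<exists>a\<in>lev X n. P a"
    and up: "\<And>m n a b. a \<in> lev X n \<Longrightarrow> b \<in> sub m a \<Longrightarrow> n \<le> m \<Longrightarrow> P b \<Longrightarrow> P a"
  shows "\<exists>s. (\<forall>n. s n \<in> lev X n \<and> P (s n)) \<and> (\<forall>n. cell X (s (Suc n)) \<subseteq> cell X (s n))"
proof -
  define Q where "Q n a \<longleftrightarrow> a \<in> lev X n \<and> (\<forall>m\<ge>n. \<exists>b\<in>sub m a. P b)" for n a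
  have Q0: "Q 0 (base X)" using inf by (simp add: Q_def base_lev sub_base)
  have step: "\<exists>b. Q (Suc n) b \<and> cell X b \<subseteq> cell X a" if Qa: "Q n a" for n a
  proof (rule ccontr)
    assume "\<nexists>b. Q (Suc n) b \<and> cell X b \<subseteq> cell X a"
    then have no: "\<not> Q (Suc n) b" if "b \<in> sub (Suc n) a" for b
      using sub_cell[OF that] by blast
    have "\<exists>m\<ge>Suc n. \<forall>c\<in>sub m b. \<not> P c" if "b \<in> sub (Suc n) a" for b
      using no[OF that] sub_lev[OF that] unfolding Q_def by simp
    then have "\<forall>b\<in>sub (Suc n) a. \<exists>m. Suc n \<le> m \<and> (\<forall>c\<in>sub m b. \<not> P c)" by simp
    then obtain M where M: "\<And>b. b \<in> sub (Suc n) a \<Longrightarrow> M b \<ge> Suc n \<and> (\<forall>c\<in>sub (M b) b. \<not> P c)"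
      unfolding bchoice_iff by auto
    define m where "m = Max (insert (Suc n) (M ` sub (Suc n) a))"
    have m: "Suc n \<le> m" "\<And>b. b \<in> sub (Suc n) a \<Longrightarrow> M b \<le> m"
      unfolding m_def using finite_sub by (auto intro!: Max_ge)
    obtain c where c: "c \<in> sub m a" "P c" using Qa Suc_leD[OF m(1)] unfolding Q_def by blast
    then obtain b where b: "b \<in> sub (Suc n) a" "c \<in> sub m b"
      using sub_eq_UN[of a n "Suc n" m] Qa m(1) by (auto simp: Q_def)
    then obtain d where d: "d \<in> sub (M b) b" "c \<in> sub m d"
      using sub_eq_UN[OF sub_lev[OF b(1)], of "M b" m] M m(2) by auto
    then have "P d" using up[OF sub_lev[OF d(1)] d(2)] m(2)[OF b(1)] c(2) by blast
    then show False using M[OF b(1)] d(1) by blast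
  qed
  obtain s where s: "\<And>n. Q n (s n)" "\<And>n. cell X (s (Suc n)) \<subseteq> cell X (s n)"
    using dependent_nat_choice[of Q "\<lambda>n a b. cell X b \<subseteq> cell X a"] Q0 step by metis
  have "P (s n)" for n
    using s(1)[of n] sub_self[of "s n" n] unfolding Q_def by auto
  then show ?thesis using s unfolding Q_def by blast
qed

text \<open>Otherwise there is a chain of cells of diameter at least \<open>e\<close>, and such a chain cannot shrink to a
point.\<close>

lemma cells_small:
  assumes "e > 0"
  shows "\<exists>N. \<forall>n\<ge>N. \<forall>a\<in>lev X n. \<forall>x\<in>cell X a. \<forall>y\<in>cell X a. dist x y < e"
proof -
  define P where "P a \<longleftrightarrow> (\<exists>x\<in>cell X a. \<exists>y\<in>cell X a. dist x y \<ge> e)" for a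
  have up: "P a" if "b \<in> sub m a" "P b" for a b m
    using that sub_cell by (fastforce simp: P_def)
  have "\<exists>n. \<forall>a\<in>lev X n. \<not> P a"
  proof (rule ccontr)
    assume "\<nexists>n. \<forall>a\<in>lev X n. \<not> P a"
    then have "\<And>n. \<exists>a\<in>lev X n. P a" by blast
    then have "\<exists>s. (\<forall>n. s n \<in> lev X n \<and> P (s n)) \<and> (\<forall>n. cell X (s (Suc n)) \<subseteq> cell X (s n))"
      by (rule chain_exists) (use up in blast)
    then obtain s where s: "\<And>n. s n \<in> lev X n" "\<And>n. P (s n)" "\<And>n. cell X (s (Suc n)) \<subseteq> cell X (s n)"
      by blast
    obtain z where z: "(\<Inter>n. cell X (s n)) = {z}" using chain_Inter[of s] s by blast
    have "cell X (s n) \<inter> - ball z (e/2) \<noteq> {}" for n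
    proof
      assume "cell X (s n) \<inter> - ball z (e/2) = {}"
      then have *: "\<And>x. x \<in> cell X (s n) \<Longrightarrow> dist z x < e/2" by auto
      obtain x y where "x \<in> cell X (s n)" "y \<in> cell X (s n)" "dist x y \<ge> e" using s(2)[of n] unfolding P_def by blast
      then show False using *[of x] *[of y] dist_triangle3[of x y z] by auto
    qed
    then have "(\<Inter>n. cell X (s n)) \<inter> - ball z (e/2) \<noteq> {}"
      by (intro chain_Inter_closed s) auto
    then show False using assms z by auto
  qed
  then obtain N where N: "\<forall>a\<in>lev X N. \<not> P a" by blast
  have "\<not> P a" if na: "n \<ge> N" "a \<in> lev X n" for n a
  proof
    assume "P a"
    obtain c where "c \<in> lev X N" "cell X a \<subseteq> cell X c" using ex_ancestor[OF na(2,1)] by blast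
    then show False using N up[of a n c] na \<open>P a\<close> by (auto simp: sub_def)
  qed
  then show ?thesis unfolding P_def by (meson not_le)
qed

subsection \<open>Vertices\<close>

lemma Vlev_Suc: "Vlev X n \<subseteq> Vlev X (Suc n)"
proof -
  have "vert X a \<subseteq> Vlev X (Suc n)" if a: "a \<in> lev X n" for a
  proof -
    have "vert X a \<subseteq> (\<Union>b\<in>sub (Suc n) a. vert X b)"
      by (rule vert_subset_UN) (use a lev_idx finite_sub cell_eq_UN_sub_Suc sub_lev in blast)+
    then show ?thesis by (auto simp: Vlev_def sub_def)
  qed
  then show ?thesis by (auto simp: Vlev_def)
qed

lemma Vlev_mono: "m \<le> n \<Longrightarrow> Vlev X m \<subseteq> Vlev X n"
  using lift_Suc_mono_le[of "Vlev X", OF Vlev_Suc] .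

lemma Vlev_Vstar: "Vlev X n \<subseteq> Vstar X"
  by (auto simp: Vstar_def)

lemma vert_Vstar: "a \<in> idx X \<Longrightarrow> vert X a \<subseteq> Vstar X"
  by (auto simp: Vstar_def Vlev_def idx_eq)

lemma finite_Vlev: "finite (Vlev X n)"
  unfolding Vlev_def using finite_lev finite_vert lev_idx by blast

lemma countable_Vstar: "countable (Vstar X)"
  unfolding Vstar_def by (intro countable_UN) (auto intro: countable_finite finite_Vlev)

lemma Vlev_0: "Vlev X 0 = vert X (base X)"
  by (simp add: Vlev_def lev_0)

lemma Vlev_0_nonempty: "Vlev X 0 \<noteq> {}"
  using vert_nonempty[OF lev_idx[OF base_lev]] by (simp add: Vlev_0)

lemma Vstar_carr: "Vstar X \<subseteq> carr X"
  unfolding Vstar_def Vlev_def using vert_subset_cell cell_subset_carr lev_idx by blast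

lemma cell_Int_Vlev: assumes "a \<in> lev X n" shows "cell X a \<inter> Vlev X n \<subseteq> vert X a"
proof
  fix x assume x: "x \<in> cell X a \<inter> Vlev X n"
  then obtain b where b: "b \<in> lev X n" "x \<in> vert X b" by (auto simp: Vlev_def)
  show "x \<in> vert X a"
    using x b assms cell_Int[of a n b] vert_subset_cell[OF lev_idx[OF b(1)]] by (cases "a = b") auto
qed

lemma ex_cell: "x \<in> carr X \<Longrightarrow> \<exists>a\<in>lev X n. x \<in> cell X a"
  using carr_eq_UN_lev by blast

lemma cell_unique:
  assumes "a \<in> lev X n" "b \<in> lev X n" "x \<in> cell X a" "x \<in> cell X b" "x \<notin> Vlev X n"
  shows "a = b"
  using cell_Int[OF assms(1,2)] assms by (auto simp: Vlev_def)

lemma vert_cell_Int: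
  assumes "a \<in> lev X n" "b \<in> lev X n" "a \<noteq> b" "x \<in> cell X a" "x \<in> cell X b"
  shows "x \<in> vert X a" "x \<in> vert X b"
  using cell_Int[OF assms(1-3)] assms by auto

end

section \<open>Measures determined by their values on cells\<close>

context fr_fractal
begin

lemma ex_parent_sub: "b \<in> lev X (Suc n) \<Longrightarrow> \<exists>a\<in>lev X n. b \<in> sub (Suc n) a"
  using ex_parent_Suc by (simp add: sub_def)

abbreviation "borel_carr \<equiv> restrict_space borel (carr X)"

lemma closed_carr: "closed (carr X)"
  using compact_carr compact_imp_closed by blast

lemma sets_borel_carr: "A \<in> sets borel_carr \<longleftrightarrow> A \<subseteq> carr X \<and> A \<in> sets borel"
  using closed_carr by (simp add: sets_restrict_space_iff)

lemma closed_borel_carr: "closed A \<Longrightarrow> A \<subseteq> carr X \<Longrightarrow> A \<in> sets borel_carr"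
  by (simp add: sets_borel_carr)

lemma cell_sets: "a \<in> idx X \<Longrightarrow> cell X a \<in> sets borel_carr"
  by (simp add: closed_borel_carr closed_cell cell_subset_carr)

lemma countable_sets: "countable A \<Longrightarrow> A \<subseteq> carr X \<Longrightarrow> A \<in> sets borel_carr"
  by (auto simp: sets_borel_carr intro: sets.countable)

lemma open_Int_carr:
  assumes "open U"
  shows "carr X \<inter> U = (\<Union>a\<in>{a\<in>idx X. cell X a \<subseteq> U}. cell X a)"
proof
  show "carr X \<inter> U \<subseteq> (\<Union>a\<in>{a\<in>idx X. cell X a \<subseteq> U}. cell X a)"
  proof
    fix x assume x: "x \<in> carr X \<inter> U"
    then obtain e where e: "e > 0" "ball x e \<subseteq> U" using assms openE by blast
    obtain N where N: "\<forall>n\<ge>N. \<forall>a\<in>lev X n. \<forall>x\<in>cell X a. \<forall>y\<in>cell X a. dist x y < e"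
      using cells_small[OF e(1)] by auto
    obtain a where a: "a \<in> lev X N" "x \<in> cell X a" using x ex_cell by blast
    then have "cell X a \<subseteq> ball x e" using N by auto
    then show "x \<in> (\<Union>a\<in>{a\<in>idx X. cell X a \<subseteq> U}. cell X a)" using a lev_idx e(2) by blast
  qed
qed (use cell_subset_carr in blast)

text \<open>Two cells are nested or meet in a finite set, so adding the finite sets makes the cells stable
under intersection.\<close>

definition cell_gen :: "'a set set" where
  "cell_gen = cell X ` idx X \<union> {S. finite S \<and> S \<subseteq> carr X}"

lemma cell_gen_sets: "cell_gen \<subseteq> sets borel_carr"
  unfolding cell_gen_def using cell_sets countable_sets[OF countable_finite] by blast

lemma sets_borel_carr_eq_sigma: "sets borel_carr = sigma_sets (carr X) cell_gen"
proof
  have sub: "cell_gen \<subseteq> Pow (carr X)" using cell_subset_carr by (auto simp: cell_gen_def)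
  have "(\<lambda>x. x) \<in> borel_measurable (sigma (carr X) cell_gen)"
  proof (rule borel_measurableI)
    fix U :: "'a set" assume U: "open U"
    have "(\<Union>a\<in>{a\<in>idx X. cell X a \<subseteq> U}. cell X a) \<in> sets (sigma (carr X) cell_gen)"
    proof (rule sets.countable_UN'')
      show "countable {a\<in>idx X. cell X a \<subseteq> U}" using countable_idx by (rule countable_subset[rotated]) auto
      show "cell X a \<in> sets (sigma (carr X) cell_gen)" if "a \<in> {a\<in>idx X. cell X a \<subseteq> U}" for a
        using that sub by (auto simp: cell_gen_def intro!: sigma_sets.Basic)
    qed
    then show "(\<lambda>x. x) -` U \<inter> space (sigma (carr X) cell_gen) \<in> sets (sigma (carr X) cell_gen)"
      using open_Int_carr[OF U] sub by (simp add: space_measure_of_conv Int_commute)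
  qed
  then have "A \<inter> carr X \<in> sigma_sets (carr X) cell_gen" if "A \<in> sets borel" for A
    using measurable_sets[OF _ that, of "\<lambda>x. x" "sigma (carr X) cell_gen"] sub by (simp add: space_measure_of_conv)
  then show "sets borel_carr \<subseteq> sigma_sets (carr X) cell_gen"
    by (metis sets_borel_carr inf.absorb_iff1 subsetI)
  show "sigma_sets (carr X) cell_gen \<subseteq> sets borel_carr"
    using sets.sigma_sets_subset[OF cell_gen_sets] by (simp add: space_restrict_space)
qed

lemma cell_Int_cell:
  assumes "a \<in> lev X m" "b \<in> lev X n" "m \<le> n"
  shows "cell X a \<inter> cell X b = cell X b \<or> finite (cell X a \<inter> cell X b)"
proof -
  obtain c where c: "c \<in> lev X m" "cell X b \<subseteq> cell X c" using ex_ancestor[OF assms(2,3)] by blast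
  show ?thesis
  proof (cases "a = c")
    case False
    then have "finite (cell X a \<inter> cell X c)" using finite_cell_Int assms c by blast
    then show ?thesis using c(2) by (meson Int_mono finite_subset order_refl)
  qed (use c in auto)
qed

lemma Int_stable_cell_gen: "Int_stable cell_gen"
  unfolding Int_stable_def
proof (intro ballI)
  fix A B assume A: "A \<in> cell_gen" and B: "B \<in> cell_gen"
  have AB: "A \<subseteq> carr X" using A cell_subset_carr by (auto simp: cell_gen_def)
  show "A \<inter> B \<in> cell_gen"
  proof (cases "finite A \<or> finite B")
    case True
    then show ?thesis using AB by (auto simp: cell_gen_def)
  next
    case False
    then obtain a b where ab: "a \<in> idx X" "b \<in> idx X" "A = cell X a" "B = cell X b"
      using A B by (auto simp: cell_gen_def)
    then obtain m n where "a \<in> lev X m" "b \<in> lev X n" by (auto simp: idx_eq)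
    then have "A \<inter> B = B \<or> A \<inter> B = A \<or> finite (A \<inter> B)"
      using cell_Int_cell[of a m b n] cell_Int_cell[of b n a m] ab by (metis Int_commute nle_le)
    then show ?thesis using A B AB by (auto simp: cell_gen_def)
  qed
qed

lemma measure_eq_on_cells:
  assumes "sets M = sets borel_carr" "sets N = sets borel_carr"
    and "\<And>x. x \<in> carr X \<Longrightarrow> emeasure M {x} = 0" "\<And>x. x \<in> carr X \<Longrightarrow> emeasure N {x} = 0"
    and "\<And>a. a \<in> idx X \<Longrightarrow> emeasure M (cell X a) = emeasure N (cell X a)"
    and "emeasure M (carr X) \<noteq> \<infinity>"
  shows "M = N"
proof (rule measure_eqI_generator_eq[where E = cell_gen and \<Omega> = "carr X" and A = "\<lambda>_. carr X"])
  have fin: "emeasure L S = 0" if "finite S" "S \<subseteq> carr X" "sets L = sets borel_carr"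
      "\<And>x. x \<in> carr X \<Longrightarrow> emeasure L {x} = 0" for L S
  proof -
    have "emeasure L S = (\<Sum>x\<in>S. emeasure L {x})"
      using that countable_sets by (intro emeasure_eq_sum_singleton) auto
    also have "\<dots> = 0" using that(2,4) by (intro sum.neutral) auto
    finally show ?thesis .
  qed
  show "emeasure M S = emeasure N S" if "S \<in> cell_gen" for S
    using that assms(5) fin[OF _ _ assms(1,3)] fin[OF _ _ assms(2,4)] unfolding cell_gen_def by auto
  show "cell_gen \<subseteq> Pow (carr X)" using cell_subset_carr by (auto simp: cell_gen_def)
  show "range (\<lambda>_. carr X) \<subseteq> cell_gen"
    using lev_idx[OF base_lev] cell_base unfolding cell_gen_def by blast
qed (use assms Int_stable_cell_gen sets_borel_carr_eq_sigma in auto)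

text \<open>An atom would concentrate on one cell of each level, hence on the point where these cells
  shrink.\<close>

lemma atomless_iff_singletons_null:
  assumes M: "sets M = sets borel_carr"
  shows "atomless M \<longleftrightarrow> (\<forall>x\<in>carr X. emeasure M {x} = 0)"
proof
  assume *: "atomless M"
  show "\<forall>x\<in>carr X. emeasure M {x} = 0"
  proof (rule ballI, rule ccontr)
    fix x assume x: "x \<in> carr X" "emeasure M {x} \<noteq> 0"
    have "{x} \<in> sets M" using x countable_sets[of "{x}"] M by simp
    moreover have "emeasure M B = 0 \<or> emeasure M ({x} - B) = 0" if "B \<subseteq> {x}" for B
      using that by (auto simp: subset_singleton_iff)
    ultimately show False using * x(2) unfolding atomless_def by (metis gr_zeroI)
  qed
next
  assume null: "\<forall>x\<in>carr X. emeasure M {x} = 0"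
  show "atomless M"
    unfolding atomless_def
  proof
    assume "\<exists>A\<in>sets M. emeasure M A > 0 \<and>
          (\<forall>B\<in>sets M. B \<subseteq> A \<longrightarrow> emeasure M B = 0 \<or> emeasure M (A - B) = 0)"
    then obtain A where A: "A \<in> sets M" "emeasure M A > 0"
      and at: "\<And>B. B \<in> sets M \<Longrightarrow> B \<subseteq> A \<Longrightarrow> emeasure M B = 0 \<or> emeasure M (A - B) = 0" by blast
    have cm: "A \<inter> cell X a \<in> sets M" if "a \<in> idx X" for a using that A cell_sets M by blast
    define P where "P a \<longleftrightarrow> emeasure M (A \<inter> cell X a) > 0" for a
    have ex: "\<exists>a\<in>lev X n. P a" for n
    proof (rule ccontr)
      assume no: "\<not> (\<exists>a\<in>lev X n. P a)"
      have "A \<subseteq> carr X" using A(1) M sets_borel_carr by blast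
      then have "A = (\<Union>a\<in>lev X n. A \<inter> cell X a)" using carr_eq_UN_lev[of n] by auto
      moreover have "emeasure M (\<Union>a\<in>lev X n. A \<inter> cell X a) \<le> (\<Sum>a\<in>lev X n. emeasure M (A \<inter> cell X a))"
        using cm lev_idx finite_lev by (intro emeasure_subadditive_finite) auto
      moreover have "(\<Sum>a\<in>lev X n. emeasure M (A \<inter> cell X a)) = 0"
        using no by (intro sum.neutral) (auto simp: P_def)
      ultimately show False using A(2) by simp
    qed
    have up: "P a" if "a \<in> lev X n" "b \<in> sub m a" "n \<le> m" "P b" for a b m n
    proof -
      have "emeasure M (A \<inter> cell X b) \<le> emeasure M (A \<inter> cell X a)"
        using that sub_cell[OF that(2)] by (intro emeasure_mono cm lev_idx) auto
      then show ?thesis using that(4) by (auto simp: P_def)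
    qed
    have "\<exists>s. (\<forall>n. s n \<in> lev X n \<and> P (s n)) \<and> (\<forall>n. cell X (s (Suc n)) \<subseteq> cell X (s n))"
      by (rule chain_exists[OF ex]) (rule up)
    then obtain s where s: "\<And>n. s n \<in> lev X n" "\<And>n. P (s n)"
      "\<And>n. cell X (s (Suc n)) \<subseteq> cell X (s n)" by auto
    obtain x where x: "x \<in> carr X" "(\<Inter>n. cell X (s n)) = {x}" using chain_Inter[of s, OF s(1,3)] by blast
    have "emeasure M (A - cell X (s n)) = 0" for n
    proof -
      have "emeasure M (A \<inter> cell X (s n)) \<noteq> 0" using s(2)[of n] by (simp add: P_def)
      moreover have "A - A \<inter> cell X (s n) = A - cell X (s n)" by auto
      ultimately show ?thesis using at[OF cm[OF lev_idx[OF s(1)]], of n] by auto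
    qed
    then have "(\<Union>n. A - cell X (s n)) \<in> null_sets M"
      using A cell_sets[OF lev_idx[OF s(1)]] M by (intro null_sets_UN) (auto simp: null_sets_def)
    moreover have "{x} \<in> null_sets M"
      using null x(1) countable_sets[of "{x}"] M by (auto simp: null_sets_def)
    ultimately have "(\<Union>n. A - cell X (s n)) \<union> {x} \<in> null_sets M" by (rule null_sets.Un)
    moreover have "A \<subseteq> (\<Union>n. A - cell X (s n)) \<union> {x}" using x(2) by auto
    ultimately have "A \<in> null_sets M" using A(1) null_sets_subset by blast
    then show False using A(2) by auto
  qed
qed

end

locale cell_weight = fr_fractal X for X :: "('a::metric_space, 'i, 'z) frf_scheme" +
  fixes w :: "'i \<Rightarrow> real"
  assumes w_nonneg: "a \<in> idx X \<Longrightarrow> 0 \<le> w a"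
    and w_additive: "a \<in> lev X n \<Longrightarrow> w a = (\<Sum>b\<in>sub (Suc n) a. w b)"
    and w_point: "x \<in> carr X \<Longrightarrow> (\<lambda>n. \<Sum>a\<in>{a\<in>lev X n. x \<in> cell X a}. w a) \<longlonglongrightarrow> 0"

lemma interval_split:
  fixes w :: "'i \<Rightarrow> real"
  assumes "finite S" "\<And>b. b \<in> S \<Longrightarrow> 0 \<le> w b"
  shows "\<exists>I. (\<forall>b\<in>S. \<exists>l. I b = {l..<l + w b}) \<and> disjoint_family_on I S \<and>
    (\<Union>b\<in>S. I b) = {L..<L + (\<Sum>b\<in>S. w b)}"
  using assms
proof (induction S rule: finite_induct)
  case empty
  then show ?case by (auto simp: disjoint_family_on_def)
next
  case (insert x S)
  then obtain I where I: "\<forall>b\<in>S. \<exists>l. I b = {l..<l + w b}" "disjoint_family_on I S"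
     "(\<Union>b\<in>S. I b) = {L..<L + (\<Sum>b\<in>S. w b)}" by auto
  define R where "R = L + (\<Sum>b\<in>S. w b)"
  define I' where "I' = I(x := {R..<R + w x})"
  have R: "L \<le> R" using insert.prems by (auto simp: R_def intro!: sum_nonneg)
  have eq: "I' b = I b" if "b \<in> S" for b using that insert.hyps by (auto simp: I'_def)
  have "(\<Union>b\<in>insert x S. I' b) = {R..<R + w x} \<union> {L..<R}"
    using I(3) eq by (simp add: I'_def[THEN fun_cong, of x] R_def)
  also have "\<dots> = {L..<R + w x}" using R insert.prems[of x] by auto
  finally have U: "(\<Union>b\<in>insert x S. I' b) = {L..<L + (\<Sum>b\<in>insert x S. w b)}"
    using insert.hyps by (simp add: R_def ac_simps)
  have "I' b \<inter> I' x = {}" if "b \<in> S" for b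
  proof -
    have "I b \<subseteq> {L..<R}" using I(3) that by (auto simp: R_def)
    then show ?thesis using eq[OF that] by (auto simp: I'_def)
  qed
  then have D: "disjoint_family_on I' (insert x S)"
    using I(2) eq unfolding disjoint_family_on_def by (metis Int_commute insertE)
  have "\<forall>b\<in>insert x S. \<exists>l. I' b = {l..<l + w b}"
    using I(1) eq by (auto simp: I'_def)
  then show ?case using U D by blast
qed

context cell_weight
begin

text \<open>Coding by intervals: the cells are assigned half-open intervals of length equal to their
  weight, nested and disjoint as the cells are. The measure is the image of Lebesgue measure under
  the map that sends \<open>t\<close> to the point where the cells shrink whose intervals contain \<open>t\<close>.\<close>

lemma ex_interval_coding:
  "\<exists>J. J 0 (base X) = {0..<w (base X)} \<and>
     (\<forall>n. \<forall>a\<in>lev X n. (\<exists>l. J n a = {l..<l + w a}) \<and>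
       disjoint_family_on (J (Suc n)) (sub (Suc n) a) \<and> (\<Union>b\<in>sub (Suc n) a. J (Suc n) b) = J n a)"
proof -
  define P where "P n J \<longleftrightarrow> (\<forall>a\<in>lev X n. \<exists>l. J a = {l..<l + w a}) \<and>
      (n = 0 \<longrightarrow> J (base X) = {0..<w (base X)})" for n :: nat and J :: "'i \<Rightarrow> real set"
  define Q where "Q n J J' \<longleftrightarrow> (\<forall>a\<in>lev X n. disjoint_family_on J' (sub (Suc n) a) \<and>
      (\<Union>b\<in>sub (Suc n) a. J' b) = J a)" for n and J J' :: "'i \<Rightarrow> real set"
  have "P 0 (\<lambda>_. {0..<w (base X)})"
    by (auto simp: P_def lev_0 intro: exI[of _ 0])
  moreover have "\<exists>J'. P (Suc n) J' \<and> Q n J J'" if "P n J" for n J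
  proof -
    have Pn: "\<exists>l. J a = {l..<l + w a}" if "a \<in> lev X n" for a
      using \<open>P n J\<close> that unfolding P_def by blast
    have "\<forall>a\<in>lev X n. \<exists>I. (\<forall>b\<in>sub (Suc n) a. \<exists>l. I b = {l..<l + w b}) \<and>
        disjoint_family_on I (sub (Suc n) a) \<and> (\<Union>b\<in>sub (Suc n) a. I b) = J a"
    proof
      fix a assume a: "a \<in> lev X n"
      then obtain l where l: "J a = {l..<l + w a}" using Pn by blast
      show "\<exists>I. (\<forall>b\<in>sub (Suc n) a. \<exists>l. I b = {l..<l + w b}) \<and>
        disjoint_family_on I (sub (Suc n) a) \<and> (\<Union>b\<in>sub (Suc n) a. I b) = J a"
        unfolding l w_additive[OF a]
        using finite_sub w_nonneg[OF lev_idx[OF sub_lev]] by (intro interval_split) blast+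
    qed
    then obtain I where I: "\<And>a. a \<in> lev X n \<Longrightarrow> (\<forall>b\<in>sub (Suc n) a. \<exists>l. I a b = {l..<l + w b}) \<and>
        disjoint_family_on (I a) (sub (Suc n) a) \<and> (\<Union>b\<in>sub (Suc n) a. I a b) = J a"
      unfolding bchoice_iff by auto
    define J' where "J' b = I (THE a. a \<in> lev X n \<and> b \<in> sub (Suc n) a) b" for b
    have eq: "J' b = I a b" if "a \<in> lev X n" "b \<in> sub (Suc n) a" for a b
    proof -
      have "(THE a. a \<in> lev X n \<and> b \<in> sub (Suc n) a) = a"
        using that sub_disjoint[OF _ that(1)] by (intro the_equality) auto
      then show ?thesis by (simp add: J'_def)
    qed
    have "\<exists>l. J' b = {l..<l + w b}" if b: "b \<in> lev X (Suc n)" for b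
    proof -
      obtain a where "a \<in> lev X n" "b \<in> sub (Suc n) a"
        using ex_parent_sub[OF b] by blast
      then show ?thesis using I eq by auto
    qed
    then have "P (Suc n) J'" by (simp add: P_def)
    moreover have "Q n J J'"
      unfolding Q_def
    proof (intro ballI conjI)
      fix a assume a: "a \<in> lev X n"
      show "disjoint_family_on J' (sub (Suc n) a)"
        using I[OF a] eq[OF a] unfolding disjoint_family_on_def by simp
      show "(\<Union>b\<in>sub (Suc n) a. J' b) = J a" using I[OF a] eq[OF a] by simp
    qed
    ultimately show ?thesis by blast
  qed
  ultimately obtain J where J: "\<And>n. P n (J n)" "\<And>n. Q n (J n) (J (Suc n))"
    using dependent_nat_choice[of P Q] by blast
  have "J 0 (base X) = {0..<w (base X)}" using J(1)[of 0] by (simp add: P_def)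
  moreover have "\<forall>a\<in>lev X n. (\<exists>l. J n a = {l..<l + w a}) \<and>
       disjoint_family_on (J (Suc n)) (sub (Suc n) a) \<and> (\<Union>b\<in>sub (Suc n) a. J (Suc n) b) = J n a" for n
    using J(1)[of n] J(2)[of n] unfolding P_def Q_def by simp
  ultimately show ?thesis by (intro exI[of _ J]) simp
qed

text \<open>The preimage of a cell under the coding map is its interval, up to parameters that are sent to
one of its finitely many vertices. These are negligible because the intervals of the cells around a
given point have small total length.\<close>

lemma ex_measure:
  "\<exists>M. sets M = sets borel_carr \<and> (\<forall>x\<in>carr X. emeasure M {x} = 0) \<and>
     (\<forall>a\<in>idx X. emeasure M (cell X a) = ennreal (w a))"
proof -
  from ex_interval_coding obtain J where J0: "J 0 (base X) = {0..<w (base X)}"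
    and J: "\<forall>n. \<forall>a\<in>lev X n. (\<exists>l. J n a = {l..<l + w a}) \<and>
       disjoint_family_on (J (Suc n)) (sub (Suc n) a) \<and> (\<Union>b\<in>sub (Suc n) a. J (Suc n) b) = J n a"
    by (elim exE conjE)
  have Jint: "\<exists>l. J n a = {l..<l + w a}" if "a \<in> lev X n" for n a
    using J[rule_format, OF that] by (elim conjE)
  have Jdis: "disjoint_family_on (J (Suc n)) (sub (Suc n) a)" if "a \<in> lev X n" for n a
    using J[rule_format, OF that] by (elim conjE)
  have Jun: "(\<Union>b\<in>sub (Suc n) a. J (Suc n) b) = J n a" if "a \<in> lev X n" for n a
    using J[rule_format, OF that] by (elim conjE)
  define T where "T = {0..<w (base X)}"
  define L where "L = restrict_space lborel T"
  have code: "\<exists>!a. a \<in> lev X n \<and> t \<in> J n a" if t: "t \<in> T" for n t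
  proof (induction n)
    case 0
    then show ?case using t J0 by (auto simp: lev_0 T_def)
  next
    case (Suc n)
    then obtain a where a: "a \<in> lev X n" "t \<in> J n a" "\<And>c. c \<in> lev X n \<Longrightarrow> t \<in> J n c \<Longrightarrow> c = a" by blast
    then obtain b where b: "b \<in> sub (Suc n) a" "t \<in> J (Suc n) b" using Jun by blast
    show ?case
    proof (rule ex1I[of _ b])
      show "b \<in> lev X (Suc n) \<and> t \<in> J (Suc n) b" using b sub_lev by simp
      fix c assume c: "c \<in> lev X (Suc n) \<and> t \<in> J (Suc n) c"
      then obtain d where d: "d \<in> lev X n" "c \<in> sub (Suc n) d"
        using ex_parent_sub[of c n] by blast
      then have "d = a" using a(3)[OF d(1)] Jun[OF d(1)] c by blast
      then show "c = b" using Jdis[OF a(1)] b d c unfolding disjoint_family_on_def by blast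
    qed
  qed
  have J_sub_T: "J n a \<subseteq> T" if "a \<in> lev X n" for n a
    using that
  proof (induction n arbitrary: a)
    case 0
    then show ?case by (simp add: lev_0 J0 T_def)
  next
    case (Suc n)
    then obtain d where d: "d \<in> lev X n" "a \<in> sub (Suc n) d"
      using ex_parent_sub[OF Suc.prems] by blast
    then show ?case using Suc.IH[OF d(1)] Jun[OF d(1)] by blast
  qed
  define A where "A n t = (THE a. a \<in> lev X n \<and> t \<in> J n a)" for n t
  have A: "A n t \<in> lev X n" "t \<in> J n (A n t)" if "t \<in> T" for n t
    using theI'[OF code[OF that, of n]] by (auto simp: A_def)
  have A_eq: "A n t = a" if "a \<in> lev X n" "t \<in> J n a" for n t a
    using code[OF subsetD[OF J_sub_T[OF that(1)] that(2)], of n] A[OF subsetD[OF J_sub_T[OF that(1)] that(2)], of n] that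
    by blast
  have A_nested: "cell X (A (Suc n) t) \<subseteq> cell X (A n t)" if t: "t \<in> T" for n t
  proof -
    obtain b where b: "b \<in> sub (Suc n) (A n t)" "t \<in> J (Suc n) b" using A[OF t, of n] Jun by blast
    then show ?thesis using A_eq[OF sub_lev[OF b(1)] b(2)] sub_cell[OF b(1)] by simp
  qed
  define p where "p t = (THE x. (\<Inter>n. cell X (A n t)) = {x})" for t
  have p: "(\<Inter>n. cell X (A n t)) = {p t}" "p t \<in> carr X" if t: "t \<in> T" for t
  proof -
    obtain x where "x \<in> carr X" "(\<Inter>n. cell X (A n t)) = {x}"
      using chain_Inter[of "\<lambda>n. A n t", OF A(1)[OF t] A_nested[OF t]] by blast
    then show "(\<Inter>n. cell X (A n t)) = {p t}" "p t \<in> carr X" by (auto simp: p_def)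
  qed
  have p_cell: "p t \<in> cell X a" if "a \<in> lev X n" "t \<in> J n a" for a n t
    using p(1)[OF subsetD[OF J_sub_T[OF that(1)] that(2)]] A_eq[OF that] by auto
  have J_borel: "J n a \<in> sets borel" if "a \<in> lev X n" for n a using Jint[OF that] by auto
  have T_borel: "T \<in> sets borel" by (simp add: T_def)
  have J_L: "J n a \<in> sets L" if "a \<in> lev X n" for n a
    using J_borel[OF that] J_sub_T[OF that] T_borel by (simp add: L_def sets_restrict_space_iff)
  have emJ: "emeasure L (J n a) = ennreal (w a)" if aX: "a \<in> lev X n" for n a
  proof -
    obtain l where l: "J n a = {l..<l + w a}" using Jint[OF aX] by blast
    have "emeasure L (J n a) = emeasure lborel (J n a)"
      using J_sub_T[OF aX] T_borel by (simp add: L_def emeasure_restrict_space)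
    then show ?thesis using w_nonneg[OF lev_idx[OF aX]] by (simp add: l)
  qed
  have spL: "space L = T" by (simp add: L_def space_restrict_space)
  have p_meas: "p \<in> measurable L borel_carr"
  proof (rule measurable_restrict_space2)
    show "p \<in> space L \<rightarrow> carr X" using p spL by auto
    show "p \<in> borel_measurable L"
    proof (rule borel_measurableI)
      fix U :: "'a set" assume U: "open U"
      have "p -` U \<inter> space L = (\<Union>n. \<Union>a\<in>{a\<in>lev X n. cell X a \<subseteq> U}. J n a)"
      proof (intro equalityI subsetI)
        fix t assume "t \<in> p -` U \<inter> space L"
        then have t: "p t \<in> U" "t \<in> space L" by auto
        then have tT: "t \<in> T" by (simp add: spL)
        have "\<exists>n. cell X (A n t) \<subseteq> U"
        proof (rule ccontr)
          assume "\<nexists>n. cell X (A n t) \<subseteq> U"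
          then have "cell X (A n t) \<inter> - U \<noteq> {}" for n by auto
          then have "(\<Inter>n. cell X (A n t)) \<inter> - U \<noteq> {}"
            using U by (intro chain_Inter_closed A(1)[OF tT] A_nested[OF tT]) auto
          then show False using p(1)[OF tT] t(1) by auto
        qed
        then show "t \<in> (\<Union>n. \<Union>a\<in>{a\<in>lev X n. cell X a \<subseteq> U}. J n a)" using A[OF tT] by blast
      next
        fix t assume "t \<in> (\<Union>n. \<Union>a\<in>{a\<in>lev X n. cell X a \<subseteq> U}. J n a)"
        then obtain n a where "a \<in> lev X n" "cell X a \<subseteq> U" "t \<in> J n a" by blast
        then show "t \<in> p -` U \<inter> space L" using p_cell J_sub_T spL by blast
      qed
      also have "\<dots> \<in> sets L"
        using J_L finite_lev by (intro sets.countable_UN image_subsetI sets.finite_UN) auto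
      finally show "p -` U \<inter> space L \<in> sets L" .
    qed
  qed
  define M where "M = distr L borel_carr p"
  have setsM: "sets M = sets borel_carr" by (simp add: M_def)
  have emM: "emeasure M S = emeasure L (p -` S \<inter> T)" if "S \<in> sets borel_carr" for S
    using emeasure_distr[OF p_meas that] by (simp add: M_def spL)
  have point: "emeasure M {x} = 0" if x: "x \<in> carr X" for x
  proof -
    have "emeasure M {x} \<le> ennreal (\<Sum>a\<in>{a\<in>lev X n. x \<in> cell X a}. w a)" for n
    proof -
      have "p -` {x} \<inter> T \<subseteq> (\<Union>a\<in>{a\<in>lev X n. x \<in> cell X a}. J n a)"
        using p(1) A[of _ n] by blast
      then have "emeasure L (p -` {x} \<inter> T) \<le> emeasure L (\<Union>a\<in>{a\<in>lev X n. x \<in> cell X a}. J n a)"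
        using J_L finite_lev by (intro emeasure_mono sets.finite_UN) auto
      also have "\<dots> \<le> (\<Sum>a\<in>{a\<in>lev X n. x \<in> cell X a}. emeasure L (J n a))"
        using J_L finite_lev by (intro emeasure_subadditive_finite) auto
      also have "\<dots> = ennreal (\<Sum>a\<in>{a\<in>lev X n. x \<in> cell X a}. w a)"
        using emJ w_nonneg lev_idx by (subst sum_ennreal[symmetric]) auto
      finally show ?thesis using emM countable_sets[of "{x}"] x by simp
    qed
    moreover have "(\<lambda>n. ennreal (\<Sum>a\<in>{a\<in>lev X n. x \<in> cell X a}. w a)) \<longlonglongrightarrow> ennreal 0"
      by (intro tendsto_ennrealI w_point x)
    ultimately have "emeasure M {x} \<le> ennreal 0" by (intro LIMSEQ_le_const) auto
    then show ?thesis by simp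
  qed
  have "emeasure M (cell X a) = ennreal (w a)" if "a \<in> idx X" for a
  proof -
    obtain n where n: "a \<in> lev X n" using \<open>a \<in> idx X\<close> by (auto simp: idx_eq)
    have null: "vert X a \<in> null_sets M"
    proof -
      have "(\<Union>x\<in>vert X a. {x}) \<in> null_sets M"
      proof (rule null_sets_UN')
        show "{x} \<in> null_sets M" if "x \<in> vert X a" for x
          using that point countable_sets[of "{x}"] vert_subset_cell[OF \<open>a \<in> idx X\<close>] cell_subset_carr[OF \<open>a \<in> idx X\<close>] setsM
          by (auto simp: null_sets_def)
      qed (simp add: countable_finite finite_vert[OF \<open>a \<in> idx X\<close>])
      then show ?thesis by simp
    qed
    have pv: "p -` vert X a \<inter> T \<in> sets L"
      using measurable_sets[OF p_meas] null setsM spL by (metis null_setsD2)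
    have "p -` cell X a \<inter> T \<subseteq> J n a \<union> (p -` vert X a \<inter> T)"
    proof
      fix t assume t: "t \<in> p -` cell X a \<inter> T"
      show "t \<in> J n a \<union> (p -` vert X a \<inter> T)"
      proof (cases "A n t = a")
        case True
        then show ?thesis using A[of t n] t by auto
      next
        case False
        have "p t \<in> cell X (A n t)" using p(1)[of t] t by auto
        then have "p t \<in> vert X a" using vert_cell_Int(1)[OF n A(1)[of t n]] False t by auto
        then show ?thesis using t by auto
      qed
    qed
    then have "emeasure L (p -` cell X a \<inter> T) \<le> emeasure L (J n a) + emeasure L (p -` vert X a \<inter> T)"
      using J_L[OF n] pv emeasure_subadditive[OF J_L[OF n] pv] 
      by (meson emeasure_mono order_trans sets.Un)
    moreover have "emeasure L (p -` vert X a \<inter> T) = 0"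
      using emM[OF null_setsD2[OF null, unfolded setsM]] null_setsD1[OF null] by (simp only:)
    moreover have "J n a \<subseteq> p -` cell X a \<inter> T" using p_cell[OF n] J_sub_T[OF n] by auto
    moreover have "p -` cell X a \<inter> T \<in> sets L"
      using measurable_sets[OF p_meas cell_sets[OF \<open>a \<in> idx X\<close>]] spL by simp
    ultimately have "emeasure L (p -` cell X a \<inter> T) = emeasure L (J n a)"
      using emeasure_mono[of "J n a" "p -` cell X a \<inter> T" L] by (intro antisym) simp_all
    then show ?thesis using emJ[OF n] emM[OF cell_sets[OF \<open>a \<in> idx X\<close>]] by simp
  qed
  then show ?thesis using setsM point by blast
qed

lemma ex1_atomless_measure:
  "\<exists>!M. sets M = sets borel_carr \<and> atomless M \<and> (\<forall>a\<in>idx X. emeasure M (cell X a) = ennreal (w a))"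
proof -
  obtain M where M: "sets M = sets borel_carr" "\<forall>x\<in>carr X. emeasure M {x} = 0"
     "\<forall>a\<in>idx X. emeasure M (cell X a) = ennreal (w a)" using ex_measure by blast
  show ?thesis
  proof (rule ex1I[of _ M])
    show "sets M = sets borel_carr \<and> atomless M \<and> (\<forall>a\<in>idx X. emeasure M (cell X a) = ennreal (w a))"
      using M atomless_iff_singletons_null by blast
    fix N assume N: "sets N = sets borel_carr \<and> atomless N \<and> (\<forall>a\<in>idx X. emeasure N (cell X a) = ennreal (w a))"
    show "N = M"
    proof (rule measure_eq_on_cells)
      show "emeasure N (carr X) \<noteq> \<infinity>" using N lev_idx[OF base_lev] cell_base by (metis ennreal_neq_top infinity_ennreal_def)
    qed (use M N atomless_iff_singletons_null in auto)
  qed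
qed

end

section \<open>Differentiation of cell functions\<close>

locale cell_measure = fr_fractal X for X :: "('a::metric_space, 'i, 'z) frf_scheme" +
  fixes N :: "'a measure"
  assumes sets_N: "sets N = sets borel_carr"
    and points_null: "x \<in> carr X \<Longrightarrow> emeasure N {x} = 0"
    and carr_finite: "emeasure N (carr X) \<noteq> \<infinity>"
begin

lemma space_N: "space N = carr X"
  using sets_eq_imp_space_eq[OF sets_N] by (simp add: space_restrict_space)

sublocale finite_measure N
  by standard (use space_N carr_finite in simp)

definition open_cell :: "'i \<Rightarrow> 'a set" where "open_cell a = cell X a - vert X a"

definition nu :: "'i \<Rightarrow> real" where "nu a = measure N (cell X a)"

lemma nu_nonneg: "0 \<le> nu a"
  by (simp add: nu_def)

lemma cell_in_sets: "a \<in> idx X \<Longrightarrow> cell X a \<in> sets N"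
  by (simp add: sets_N cell_sets)

lemma countable_null: assumes "countable A" "A \<subseteq> carr X" shows "A \<in> null_sets N"
proof -
  have "(\<Union>x\<in>A. {x}) \<in> null_sets N"
    using assms points_null countable_sets[of "{x}" for x] sets_N
    by (intro null_sets_UN') (auto simp: null_sets_def)
  then show ?thesis by simp
qed

lemma AE_not_Vstar: "AE x in N. x \<notin> Vstar X"
  by (rule AE_not_in) (rule countable_null[OF countable_Vstar Vstar_carr])

lemma open_cell_in_sets: "a \<in> idx X \<Longrightarrow> open_cell a \<in> sets N"
  unfolding open_cell_def using cell_in_sets countable_null[OF countable_finite[OF finite_vert]]
    vert_subset_cell cell_subset_carr by (meson null_setsD2 order_trans sets.Diff)

lemma measure_open_cell: "a \<in> idx X \<Longrightarrow> measure N (open_cell a) = nu a"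
  unfolding open_cell_def nu_def using cell_in_sets countable_null[OF countable_finite[OF finite_vert]]
    vert_subset_cell cell_subset_carr by (metis measure_Diff_null_set order_trans)

lemma open_cell_disjoint:
  assumes "a \<in> lev X n" "b \<in> lev X n" "a \<noteq> b" shows "open_cell a \<inter> open_cell b = {}"
  using vert_cell_Int[OF assms] by (auto simp: open_cell_def)

lemma open_cell_iff:
  assumes "a \<in> lev X n" "x \<notin> Vstar X" shows "x \<in> open_cell a \<longleftrightarrow> x \<in> cell X a"
  using assms vert_Vstar[OF lev_idx[OF assms(1)]] by (auto simp: open_cell_def)

lemma nu_additive: assumes "a \<in> lev X n" "n \<le> m" shows "nu a = (\<Sum>b\<in>sub m a. nu b)"
proof -
  have I: "open_cell b \<in> sets N" if "b \<in> sub m a" for b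
    by (rule open_cell_in_sets[OF lev_idx[OF sub_lev[OF that]]])
  have "nu a = measure N (\<Union>b\<in>sub m a. open_cell b)"
    unfolding nu_def
  proof (rule measure_eq_AE)
    show "AE x in N. x \<in> cell X a \<longleftrightarrow> x \<in> (\<Union>b\<in>sub m a. open_cell b)"
      using AE_not_Vstar
    proof eventually_elim
      case (elim x)
      then show ?case using cell_eq_UN_sub[OF assms] open_cell_iff[OF sub_lev elim] by auto
    qed
  qed (use I finite_sub cell_in_sets lev_idx assms in auto)
  also have "\<dots> = (\<Sum>b\<in>sub m a. measure N (open_cell b))"
    using I finite_sub open_cell_disjoint[OF sub_lev sub_lev]
    by (intro finite_measure_finite_Union) (auto simp: disjoint_family_on_def)
  also have "\<dots> = (\<Sum>b\<in>sub m a. nu b)"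
    by (intro sum.cong refl measure_open_cell lev_idx[OF sub_lev])
  finally show ?thesis .
qed

end

lemma (in fr_fractal) additive_sub:
  fixes w :: "'i \<Rightarrow> real"
  assumes add: "\<And>n a. a \<in> lev X n \<Longrightarrow> w a = (\<Sum>b\<in>sub (Suc n) a. w b)"
    and "a \<in> lev X n" "n \<le> m"
  shows "w a = (\<Sum>b\<in>sub m a. w b)"
  using assms(3)
proof (induction m rule: dec_induct)
  case base
  then show ?case by (simp add: sub_self[OF assms(2)])
next
  case (step m)
  then show ?case
    using sum_sub_split[OF assms(2), of m "Suc m" w] add[OF sub_lev] by simp
qed

text \<open>A signed additive cell function that is dominated by the measure has a density, the almost
  everywhere limit of its quotients along the cells that shrink to a point.
  The quotients form a bounded martingale.\<close>

locale dominated_cell_function = cell_measure X N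
  for X :: "('a::metric_space, 'i, 'z) frf_scheme" and N +
  fixes mu :: "'i \<Rightarrow> real" and C :: real
  assumes mu_additive_Suc: "a \<in> lev X n \<Longrightarrow> mu a = (\<Sum>b\<in>sub (Suc n) a. mu b)"
    and mu_bound: "a \<in> idx X \<Longrightarrow> \<bar>mu a\<bar> \<le> C * nu a"
begin

lemmas mu_additive = additive_sub[of mu, OF mu_additive_Suc]

definition quot :: "'i \<Rightarrow> real" where "quot a = mu a / nu a"

definition sq :: "'i \<Rightarrow> real" where "sq a = (quot a)\<^sup>2 * nu a"

text \<open>The integral over \<open>a\<close> of the squared deviation from \<open>c\<close> of the quotients of level \<open>m\<close>.\<close>

definition dev :: "nat \<Rightarrow> 'i \<Rightarrow> real \<Rightarrow> real" where
  "dev m a c = (\<Sum>b\<in>sub m a. (quot b - c)\<^sup>2 * nu b)"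

definition quot_lev :: "nat \<Rightarrow> 'a \<Rightarrow> real" where
  "quot_lev n x = (\<Sum>a\<in>lev X n. indicator (open_cell a) x * quot a)"

lemma quot_nu: "a \<in> idx X \<Longrightarrow> quot a * nu a = mu a"
  using mu_bound[of a] by (cases "nu a = 0") (auto simp: quot_def)

lemma abs_quot_le: assumes "a \<in> idx X" shows "\<bar>quot a\<bar> \<le> \<bar>C\<bar>"
proof (cases "nu a = 0")
  case False
  then have p: "nu a > 0" using nu_nonneg[of a] by simp
  have "\<bar>mu a\<bar> \<le> \<bar>C\<bar> * nu a" using mu_bound[OF assms] p
    by (meson abs_ge_self mult_right_mono nu_nonneg order_trans)
  then show ?thesis using p by (simp add: quot_def abs_div field_simps)
qed (simp add: quot_def)

lemma dev_expand:
  assumes "a \<in> lev X n" "n \<le> m"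
  shows "dev m a c = (\<Sum>b\<in>sub m a. sq b) - 2 * c * mu a + c\<^sup>2 * nu a"
proof -
  have "dev m a c = (\<Sum>b\<in>sub m a. sq b - 2 * c * mu b + c\<^sup>2 * nu b)"
    unfolding dev_def
  proof (rule sum.cong[OF refl])
    fix b assume "b \<in> sub m a"
    then have "quot b * nu b = mu b" using quot_nu lev_idx sub_lev by blast
    then have "2 * c * mu b = 2 * c * quot b * nu b" by simp
    then show "(quot b - c)\<^sup>2 * nu b = sq b - 2 * c * mu b + c\<^sup>2 * nu b"
      by (simp add: sq_def power2_diff algebra_simps)
  qed
  also have "\<dots> = (\<Sum>b\<in>sub m a. sq b) - 2 * c * (\<Sum>b\<in>sub m a. mu b) + c\<^sup>2 * (\<Sum>b\<in>sub m a. nu b)"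
    by (simp add: sum.distrib sum_subtractf sum_distrib_left)
  finally show ?thesis using mu_additive[OF _ assms] nu_additive[OF assms] by simp
qed

text \<open>Variance plus squared bias.\<close>

lemma dev_quot:
  assumes "a \<in> lev X n" "n \<le> m"
  shows "dev m a c = (\<Sum>b\<in>sub m a. sq b) - sq a + (quot a - c)\<^sup>2 * nu a"
proof -
  have "mu a = quot a * nu a" using quot_nu[OF lev_idx[OF assms(1)]] by simp
  then show ?thesis unfolding dev_expand[OF assms] by (simp add: sq_def power2_diff algebra_simps)
qed

lemma dev_nonneg: "0 \<le> dev m a c"
  unfolding dev_def by (intro sum_nonneg mult_nonneg_nonneg nu_nonneg) simp

lemma dev_ge:
  assumes "a \<in> lev X n" "n \<le> m"
  shows "(quot a - c)\<^sup>2 * nu a \<le> dev m a c"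
  using dev_quot[OF assms, of c] dev_quot[OF assms, of "quot a"] dev_nonneg[of m a "quot a"] by simp

text \<open>The exceptional set in the maximal inequality.\<close>

definition bad :: "real \<Rightarrow> nat \<Rightarrow> nat \<Rightarrow> 'i \<Rightarrow> real \<Rightarrow> 'a set" where
  "bad e n d a c = (\<Union>j\<in>{n..n + d}. \<Union>b\<in>{b\<in>sub j a. e \<le> \<bar>quot b - c\<bar>}. cell X b)"

lemma bad_sets: "bad e n d a c \<in> sets N"
  unfolding bad_def using finite_sub cell_in_sets[OF lev_idx[OF sub_lev]]
  by (intro sets.finite_UN) auto

text \<open>Kolmogorov's maximal inequality, by induction on the number of levels: a cell whose own
quotient deviates is disposed of by Jensen's inequality, the others are subdivided.\<close>

lemma maximal_inequality_cell:
  assumes "a \<in> lev X n" "e > 0"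
  shows "e\<^sup>2 * measure N (bad e n d a c) \<le> dev (n + d) a c"
  using assms(1)
proof (induction d arbitrary: n a)
  case (0 n a)
  show ?case
  proof (cases "e \<le> \<bar>quot a - c\<bar>")
    case True
    then have "e\<^sup>2 \<le> (quot a - c)\<^sup>2" using assms(2) by (simp add: abs_le_square_iff[symmetric])
    moreover have "bad e n 0 a c = cell X a" using True by (auto simp: bad_def sub_self[OF 0])
    ultimately show ?thesis
      using dev_ge[OF 0, of n c] mult_right_mono[OF _ nu_nonneg[of a]] by (fastforce simp: nu_def)
  next
    case False
    then have "bad e n 0 a c = {}" by (auto simp: bad_def sub_self[OF 0])
    then show ?thesis using dev_nonneg by simp
  qed
next
  case (Suc d n a)
  show ?case
  proof (cases "e \<le> \<bar>quot a - c\<bar>")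
    case True
    then have "e\<^sup>2 \<le> (quot a - c)\<^sup>2" using assms(2) by (simp add: abs_le_square_iff[symmetric])
    then have "e\<^sup>2 * nu a \<le> (quot a - c)\<^sup>2 * nu a" by (rule mult_right_mono) (rule nu_nonneg)
    also have "\<dots> \<le> dev (n + Suc d) a c" by (rule dev_ge[OF Suc.prems]) simp
    finally have "e\<^sup>2 * nu a \<le> dev (n + Suc d) a c" .
    moreover have "measure N (bad e n (Suc d) a c) \<le> nu a"
      unfolding nu_def
      by (rule finite_measure_mono) (use sub_cell cell_in_sets[OF lev_idx[OF Suc.prems]] in \<open>auto simp: bad_def\<close>)
    ultimately show ?thesis using mult_left_mono[of _ _ "e\<^sup>2"] by (meson order_trans zero_le_power2)
  next
    case False
    have "bad e n (Suc d) a c \<subseteq> (\<Union>b\<in>sub (Suc n) a. bad e (Suc n) d b c)"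
    proof
      fix x assume "x \<in> bad e n (Suc d) a c"
      then obtain j b where j: "n \<le> j" "j \<le> n + Suc d" and b: "b \<in> sub j a" "e \<le> \<bar>quot b - c\<bar>" "x \<in> cell X b"
        by (auto simp: bad_def)
      have "j \<noteq> n" using b False sub_self[OF Suc.prems] by auto
      then have j': "Suc n \<le> j" using j by simp
      then obtain k where k: "k \<in> sub (Suc n) a" "b \<in> sub j k"
        using sub_eq_UN[OF Suc.prems, of "Suc n" j] b(1) by auto
      then show "x \<in> (\<Union>b\<in>sub (Suc n) a. bad e (Suc n) d b c)"
        using b j j' by (force simp: bad_def)
    qed
    then have "measure N (bad e n (Suc d) a c) \<le> measure N (\<Union>b\<in>sub (Suc n) a. bad e (Suc n) d b c)"
      using bad_sets finite_sub by (intro finite_measure_mono sets.finite_UN) auto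
    also have "\<dots> \<le> (\<Sum>b\<in>sub (Suc n) a. measure N (bad e (Suc n) d b c))"
      using bad_sets finite_sub by (intro finite_measure_subadditive_finite) auto
    finally have "e\<^sup>2 * measure N (bad e n (Suc d) a c)
        \<le> (\<Sum>b\<in>sub (Suc n) a. e\<^sup>2 * measure N (bad e (Suc n) d b c))"
      unfolding sum_distrib_left[symmetric] by (rule mult_left_mono) simp
    also have "\<dots> \<le> (\<Sum>b\<in>sub (Suc n) a. dev (Suc n + d) b c)"
      by (intro sum_mono Suc.IH sub_lev)
    also have "\<dots> = dev (n + Suc d) a c"
      unfolding dev_def by (subst sum_sub_split[OF Suc.prems, of "Suc n" "n + Suc d"]) simp_all
    finally show ?thesis .
  qed
qed

definition total_sq :: "nat \<Rightarrow> real" where "total_sq n = (\<Sum>a\<in>lev X n. sq a)"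

lemma maximal_inequality:
  assumes "e > 0"
  shows "e\<^sup>2 * measure N (\<Union>a\<in>lev X n. bad e n d a (quot a)) \<le> total_sq (n + d) - total_sq n"
proof -
  have "measure N (\<Union>a\<in>lev X n. bad e n d a (quot a)) \<le> (\<Sum>a\<in>lev X n. measure N (bad e n d a (quot a)))"
    using bad_sets finite_lev by (intro finite_measure_subadditive_finite) auto
  then have "e\<^sup>2 * measure N (\<Union>a\<in>lev X n. bad e n d a (quot a))
      \<le> (\<Sum>a\<in>lev X n. e\<^sup>2 * measure N (bad e n d a (quot a)))"
    unfolding sum_distrib_left[symmetric] by (rule mult_left_mono) simp
  also have "\<dots> \<le> (\<Sum>a\<in>lev X n. dev (n + d) a (quot a))"
    by (intro sum_mono maximal_inequality_cell assms)
  also have "\<dots> = (\<Sum>a\<in>lev X n. (\<Sum>b\<in>sub (n + d) a. sq b) - sq a)"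
    by (intro sum.cong refl) (simp add: dev_quot)
  also have "\<dots> = total_sq (n + d) - total_sq n"
    using sum_lev_split[of n "n + d" sq] by (simp add: total_sq_def sum_subtractf)
  finally show ?thesis .
qed

lemma total_sq_mono: "n \<le> m \<Longrightarrow> total_sq n \<le> total_sq m"
  using maximal_inequality[of 1 n "m - n"] measure_nonneg[of N] 
  by (smt (verit) le_add_diff_inverse mult_nonneg_nonneg zero_le_power2)

lemma total_sq_le: "total_sq n \<le> C\<^sup>2 * nu (base X)"
proof -
  have "sq a \<le> C\<^sup>2 * nu a" if "a \<in> lev X n" for a
  proof -
    have "(quot a)\<^sup>2 \<le> C\<^sup>2" using abs_quot_le[OF lev_idx[OF that]] by (simp add: abs_le_square_iff)
    then show ?thesis unfolding sq_def by (rule mult_right_mono) (rule nu_nonneg)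
  qed
  then have "total_sq n \<le> (\<Sum>a\<in>lev X n. C\<^sup>2 * nu a)" unfolding total_sq_def by (rule sum_mono)
  also have "\<dots> = C\<^sup>2 * nu (base X)"
    using nu_additive[OF base_lev, of n] by (simp add: sub_base sum_distrib_left)
  finally show ?thesis .
qed

definition bad_ever :: "real \<Rightarrow> nat \<Rightarrow> 'a set" where
  "bad_ever e n = (\<Union>d. \<Union>a\<in>lev X n. bad e n d a (quot a))"

lemma bad_ever_sets: "bad_ever e n \<in> sets N"
  unfolding bad_ever_def using bad_sets finite_lev by (intro sets.countable_UN image_subsetI sets.finite_UN) auto

text \<open>The sums of squares increase to a finite limit, so the maximal inequality bounds the measure of the
set of deviations after level \<open>n\<close> by a null sequence.\<close>

lemma bad_ever_null:
  assumes "e > 0"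
  shows "(\<Inter>n. bad_ever e n) \<in> null_sets N"
proof -
  have "incseq total_sq" using total_sq_mono by (simp add: incseq_def)
  then obtain s where s: "total_sq \<longlonglongrightarrow> s" "\<And>n. total_sq n \<le> s"
    using incseq_convergent[of total_sq "C\<^sup>2 * nu (base X)"] total_sq_le by auto
  have le: "measure N (bad_ever e n) \<le> (s - total_sq n) / e\<^sup>2" for n
  proof (rule LIMSEQ_le_const2)
    have "incseq (\<lambda>d. \<Union>a\<in>lev X n. bad e n d a (quot a))"
      unfolding incseq_def bad_def by (intro allI impI UN_mono) auto
    then show "(\<lambda>d. measure N (\<Union>a\<in>lev X n. bad e n d a (quot a))) \<longlonglongrightarrow> measure N (bad_ever e n)"
      unfolding bad_ever_def using bad_sets finite_lev
      by (intro finite_Lim_measure_incseq) (auto intro!: sets.finite_UN)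
    have "measure N (\<Union>a\<in>lev X n. bad e n d a (quot a)) \<le> (s - total_sq n) / e\<^sup>2" for d
      using maximal_inequality[OF assms, of n d] s(2)[of "n + d"] assms
      by (simp add: field_simps)
    then show "\<exists>M. \<forall>d\<ge>M. measure N (\<Union>a\<in>lev X n. bad e n d a (quot a)) \<le> (s - total_sq n) / e\<^sup>2" by blast
  qed
  have "measure N (\<Inter>n. bad_ever e n) \<le> 0"
  proof (rule LIMSEQ_le_const)
    have "(\<lambda>n. (s - total_sq n) / e\<^sup>2) \<longlonglongrightarrow> (s - s) / e\<^sup>2"
      by (intro tendsto_intros s) (use assms in auto)
    then show "(\<lambda>n. (s - total_sq n) / e\<^sup>2) \<longlonglongrightarrow> 0" by simp
    have "measure N (\<Inter>n. bad_ever e n) \<le> measure N (bad_ever e n)" for n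
      using bad_ever_sets by (intro finite_measure_mono) auto
    then show "\<exists>M. \<forall>n\<ge>M. measure N (\<Inter>n. bad_ever e n) \<le> (s - total_sq n) / e\<^sup>2"
      using le order_trans by blast
  qed
  then have "measure N (\<Inter>n. bad_ever e n) = 0" using measure_nonneg[of N] by (metis order_antisym)
  moreover have "(\<Inter>n. bad_ever e n) \<in> sets N" using bad_ever_sets by (intro sets.countable_INT) auto
  ultimately show ?thesis by (simp add: null_sets_def emeasure_eq_measure)
qed

lemma quot_lev_eq:
  assumes "a \<in> lev X n" "x \<in> cell X a" "x \<notin> Vstar X"
  shows "quot_lev n x = quot a"
proof -
  have "quot_lev n x = (\<Sum>b\<in>lev X n. if b = a then quot b else 0)"
    unfolding quot_lev_def
  proof (rule sum.cong[OF refl])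
    fix b assume b: "b \<in> lev X n"
    have "x \<in> open_cell b \<longleftrightarrow> b = a"
      using open_cell_iff[OF b assms(3)] cell_unique[OF b assms(1)] assms Vlev_Vstar[of n] by auto
    then show "indicator (open_cell b) x * quot b = (if b = a then quot b else 0)" by auto
  qed
  then show ?thesis using assms(1) finite_lev by simp
qed

lemma quot_lev_AE_convergent: "AE x in N. convergent (\<lambda>n. quot_lev n x)"
proof -
  have "AE x in N. \<forall>k. x \<notin> (\<Inter>n. bad_ever (1 / real (Suc k)) n)"
    unfolding AE_all_countable by (intro allI AE_not_in bad_ever_null) simp
  then show ?thesis
    using AE_not_Vstar AE_space
  proof eventually_elim
    case (elim x)
    have xV: "x \<notin> Vstar X" and xc: "x \<in> carr X" using elim space_N by auto
    have "Cauchy (\<lambda>n. quot_lev n x)"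
    proof (rule metric_CauchyI)
      fix e :: real assume "e > 0"
      then obtain k where k: "1 / real (Suc k) < e / 2" using nat_approx_posE[of "e/2"] by (metis half_gt_zero)
      obtain n where n: "x \<notin> bad_ever (1 / real (Suc k)) n" using elim(1) by auto
      obtain a where a: "a \<in> lev X n" "x \<in> cell X a" using ex_cell[OF xc] by blast
      have near: "\<bar>quot_lev j x - quot a\<bar> < 1 / real (Suc k)" if j: "j \<ge> n" for j
      proof -
        obtain b where b: "b \<in> lev X j" "x \<in> cell X b" using ex_cell[OF xc] by blast
        obtain c where c: "c \<in> lev X n" "cell X b \<subseteq> cell X c" using ex_ancestor[OF b(1) j] by blast
        have "c = a" using cell_unique[OF c(1) a(1) _ a(2)] c(2) b(2) xV Vlev_Vstar[of n] by blast
        then have "b \<in> sub j a" using b c by (simp add: sub_def)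
        have "\<not> 1 / real (Suc k) \<le> \<bar>quot b - quot a\<bar>"
        proof
          assume "1 / real (Suc k) \<le> \<bar>quot b - quot a\<bar>"
          then have "x \<in> bad (1 / real (Suc k)) n (j - n) a (quot a)"
            unfolding bad_def using \<open>b \<in> sub j a\<close> b(2) j by auto
          then show False using n a(1) by (auto simp: bad_ever_def)
        qed
        then show ?thesis using quot_lev_eq[OF b xV] by simp
      qed
      have "dist (quot_lev i x) (quot_lev j x) < e" if "i \<ge> n" "j \<ge> n" for i j
        using near[OF that(1)] near[OF that(2)] k by (simp add: dist_real_def)
      then show "\<exists>M. \<forall>i\<ge>M. \<forall>j\<ge>M. dist (quot_lev i x) (quot_lev j x) < e" by blast
    qed
    then show ?case by (rule Cauchy_convergent)
  qed
qed

definition density :: "'a \<Rightarrow> real" where "density x = lim (\<lambda>n. quot_lev n x)"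

lemma quot_lev_tendsto: "AE x in N. (\<lambda>n. quot_lev n x) \<longlonglongrightarrow> density x"
  using quot_lev_AE_convergent unfolding density_def by (simp add: convergent_LIMSEQ_iff)

lemma quot_lev_measurable: "quot_lev n \<in> borel_measurable N"
  unfolding quot_lev_def[abs_def] using open_cell_in_sets[OF lev_idx]
  by (intro borel_measurable_sum borel_measurable_times borel_measurable_indicator) auto

lemma density_measurable: "density \<in> borel_measurable N"
  unfolding density_def[abs_def] by (intro borel_measurable_lim_metric quot_lev_measurable)

lemma abs_quot_lev_le: assumes "x \<notin> Vstar X" "x \<in> carr X" shows "\<bar>quot_lev n x\<bar> \<le> \<bar>C\<bar>"
proof -
  obtain b where b: "b \<in> lev X n" "x \<in> cell X b" using ex_cell[OF assms(2)] by blast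
  then show ?thesis using quot_lev_eq[OF b assms(1)] abs_quot_le[OF lev_idx[OF b(1)]] by simp
qed

lemma integral_quot_lev:
  assumes "a \<in> lev X n" "n \<le> m"
  shows "(LINT x|N. indicator (cell X a) x * quot_lev m x) = mu a"
proof -
  have "(LINT x|N. indicator (cell X a) x * quot_lev m x)
      = (LINT x|N. (\<Sum>b\<in>sub m a. indicator (open_cell b) x * quot b))"
  proof (rule integral_cong_AE)
    show "AE x in N. indicator (cell X a) x * quot_lev m x = (\<Sum>b\<in>sub m a. indicator (open_cell b) x * quot b)"
      using AE_not_Vstar
    proof eventually_elim
      case (elim x)
      have "indicator (cell X a) x * quot_lev m x =
          (\<Sum>b\<in>lev X m. if b \<in> sub m a then indicator (open_cell b) x * quot b else 0)"
        unfolding quot_lev_def sum_distrib_left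
      proof (rule sum.cong[OF refl])
        fix b assume b: "b \<in> lev X m"
        obtain c where c: "c \<in> lev X n" "cell X b \<subseteq> cell X c" using ex_ancestor[OF b assms(2)] by blast
        have "b \<in> sub m a" if "x \<in> open_cell b" "x \<in> cell X a"
        proof -
          have "x \<in> cell X c" using that(1) c(2) by (auto simp: open_cell_def)
          then have "c = a" using cell_unique[OF c(1) assms(1) _ that(2)] elim Vlev_Vstar[of n] by blast
          then show ?thesis using b c by (simp add: sub_def)
        qed
        moreover have "x \<in> cell X a" if "x \<in> open_cell b" "b \<in> sub m a"
          using that sub_cell by (auto simp: open_cell_def)
        ultimately show "indicator (cell X a) x * (indicator (open_cell b) x * quot b) =
            (if b \<in> sub m a then indicator (open_cell b) x * quot b else 0)"
          by (auto simp: indicator_def)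
      qed
      also have "\<dots> = (\<Sum>b\<in>sub m a. indicator (open_cell b) x * quot b)"
        using finite_lev by (subst sum.inter_restrict[symmetric]) (auto simp: sub_def intro!: sum.cong)
      finally show ?case .
    qed
    show "(\<lambda>x. indicator (cell X a) x * quot_lev m x) \<in> borel_measurable N"
      using cell_in_sets[OF lev_idx[OF assms(1)]] quot_lev_measurable by measurable
    show "(\<lambda>x. \<Sum>b\<in>sub m a. indicator (open_cell b) x * quot b) \<in> borel_measurable N"
      using open_cell_in_sets[OF lev_idx[OF sub_lev]]
      by (intro borel_measurable_sum borel_measurable_times borel_measurable_indicator) auto
  qed
  also have "\<dots> = (\<Sum>b\<in>sub m a. LINT x|N. indicator (open_cell b) x * quot b)"
    using open_cell_in_sets[OF lev_idx[OF sub_lev]]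
    by (intro Bochner_Integration.integral_sum integrable_mult_left integrable_real_indicator)
       (auto simp: emeasure_eq_measure)
  also have "\<dots> = (\<Sum>b\<in>sub m a. mu b)"
  proof (rule sum.cong[OF refl])
    fix b assume "b \<in> sub m a"
    then have b: "b \<in> idx X" using lev_idx sub_lev by blast
    have "open_cell b \<inter> space N = open_cell b" using open_cell_in_sets[OF b] sets.sets_into_space by blast
    then show "(LINT x|N. indicator (open_cell b) x * quot b) = mu b"
      using quot_nu[OF b] measure_open_cell[OF b] by (simp add: mult.commute)
  qed
  finally show ?thesis using mu_additive[OF _ assms] by simp
qed

lemma AE_abs_density_le: "AE x in N. \<bar>density x\<bar> \<le> \<bar>C\<bar>"
  using quot_lev_tendsto AE_not_Vstar AE_space
proof eventually_elim
  case (elim x)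
  have "(\<lambda>n. \<bar>quot_lev n x\<bar>) \<longlonglongrightarrow> \<bar>density x\<bar>" by (rule tendsto_rabs[OF elim(1)])
  then show ?case by (rule LIMSEQ_le_const2) (use abs_quot_lev_le elim space_N in auto)
qed

lemma density_integrable: "integrable N density"
  by (rule integrable_const_bound[of _ "\<bar>C\<bar>"]) (use AE_abs_density_le density_measurable in auto)

text \<open>At each finite level the identity is additivity; dominated convergence does the rest.\<close>

lemma integral_density:
  assumes "a \<in> lev X n"
  shows "(LINT x|N. indicator (cell X a) x * density x) = mu a"
proof -
  have "(\<lambda>m. LINT x|N. indicator (cell X a) x * quot_lev m x) \<longlonglongrightarrow> (LINT x|N. indicator (cell X a) x * density x)"
  proof (rule integral_dominated_convergence[where w = "\<lambda>_. \<bar>C\<bar>"])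
    show "(\<lambda>x. indicator (cell X a) x * density x) \<in> borel_measurable N"
      using cell_in_sets[OF lev_idx[OF assms]] density_measurable by measurable
    show "(\<lambda>x. indicator (cell X a) x * quot_lev m x) \<in> borel_measurable N" for m
      using cell_in_sets[OF lev_idx[OF assms]] quot_lev_measurable by measurable
    show "AE x in N. (\<lambda>m. indicator (cell X a) x * quot_lev m x) \<longlonglongrightarrow> indicator (cell X a) x * density x"
      using quot_lev_tendsto by eventually_elim (rule tendsto_mult_left)
    show "AE x in N. norm (indicator (cell X a) x * quot_lev m x) \<le> \<bar>C\<bar>" for m
      using AE_not_Vstar AE_space
      by eventually_elim (use abs_quot_lev_le space_N in \<open>auto simp: indicator_def\<close>)
  qed simp
  moreover have "(\<lambda>m. LINT x|N. indicator (cell X a) x * quot_lev m x) \<longlonglongrightarrow> mu a"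
    by (rule tendsto_eventually) (use integral_quot_lev[OF assms] in \<open>auto simp: eventually_sequentially\<close>)
  ultimately show ?thesis by (rule LIMSEQ_unique)
qed

end

section \<open>Energies on cells\<close>

locale split_form = fr_fractal X for X :: "('a::metric_space, 'i, 'z) rfrf_scheme" +
  assumes split: "split_resistance_form X"
begin

lemma rf_total: "resistance_form (Vstar X) (edom X) (energy X)"
  using split unfolding split_resistance_form_def by (elim conjE)

lemma rf_cell: "a \<in> idx X \<Longrightarrow> resistance_form (Vstar X \<inter> cell X a) (cdom X a) (cenergy X a)"
  using split unfolding split_resistance_form_def by (elim conjE) (drule (1) bspec)

sublocale form: resistance_form "Vstar X" "edom X" "energy X"
  by (rule rf_total)

lemma splits_total: "splits_over X (Vstar X) (edom X) (energy X) (lev X n)"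
  using split unfolding split_resistance_form_def by (elim conjE) (drule spec)

lemma splits_cell: "a \<in> lev X n \<Longrightarrow> n \<le> m \<Longrightarrow>
    splits_over X (Vstar X \<inter> cell X a) (cdom X a) (cenergy X a) (sub m a)"
  using split unfolding split_resistance_form_def sub_def by simp

definition cE :: "'i \<Rightarrow> ('a \<Rightarrow> real) \<Rightarrow> ('a \<Rightarrow> real) \<Rightarrow> real" where
  "cE a f g = cenergy X a (cell_restr X a f) (cell_restr X a g)"

lemma edom_iff: "f \<in> ell (Vstar X) \<Longrightarrow> f \<in> edom X \<longleftrightarrow> (\<forall>b\<in>lev X n. cell_restr X b f \<in> cdom X b)"
  using splits_total[of n] unfolding splits_over_def by blast

lemma edom_ell: "f \<in> edom X \<Longrightarrow> f \<in> ell (Vstar X)"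
  using form.dom_ell by blast

lemma cell_restr_cdom: assumes "f \<in> edom X" "a \<in> idx X" shows "cell_restr X a f \<in> cdom X a"
proof -
  obtain n where "a \<in> lev X n" using assms(2) by (auto simp: idx_eq)
  then show ?thesis using edom_iff[OF edom_ell[OF assms(1)], of n] assms(1) by blast
qed

lemma energy_eq_sum: "f \<in> edom X \<Longrightarrow> energy X f f = (\<Sum>a\<in>lev X n. cE a f f)"
  using splits_total[of n] unfolding splits_over_def cE_def by blast

lemma cell_restr_cell_restr: "cell X b \<subseteq> cell X a \<Longrightarrow> cell_restr X b (cell_restr X a f) = cell_restr X b f"
  by (rule ext) (auto simp: cell_restr_def restr_def)

lemma cell_restr_add: "cell_restr X a (\<lambda>x. f x + g x) = (\<lambda>x. cell_restr X a f x + cell_restr X a g x)"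
  and cell_restr_scale: "cell_restr X a (\<lambda>x. c * f x) = (\<lambda>x. c * cell_restr X a f x)"
  by (rule ext, simp add: cell_restr_def restr_def)+

lemma cell_restr_sum: "cell_restr X a (\<lambda>x. \<Sum>i\<in>I. u i x) = (\<lambda>x. \<Sum>i\<in>I. cell_restr X a (u i) x)"
proof
  fix x
  show "cell_restr X a (\<lambda>x. \<Sum>i\<in>I. u i x) x = (\<Sum>i\<in>I. cell_restr X a (u i) x)"
    by (cases "x \<in> Vstar X \<inter> cell X a") (auto simp: cell_restr_def restr_def intro!: sum.neutral)
qed

lemma cell_restr_cong: "(\<And>x. x \<in> Vstar X \<Longrightarrow> x \<in> cell X a \<Longrightarrow> f x = g x) \<Longrightarrow> cell_restr X a f = cell_restr X a g"
  by (rule ext) (auto simp: cell_restr_def restr_def)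

lemma cE_cong: "coincide_on_cell X a f g \<Longrightarrow> cE a f f = cE a g g"
  unfolding cE_def coincide_on_cell_def using cell_restr_cong[of a f g] by simp

lemma cE_semi_inner:
  assumes "a \<in> idx X"
  shows "semi_inner_space (edom X) (\<lambda>u v x. u x + v x) (\<lambda>c u x. c * u x) (cE a)"
proof -
  interpret R: resistance_form "Vstar X \<inter> cell X a" "cdom X a" "cenergy X a" by (rule rf_cell[OF assms])
  show ?thesis
    by unfold_locales (use cell_restr_cdom[OF _ assms] in
      \<open>auto simp: cE_def cell_restr_add cell_restr_scale form.dom_add form.dom_scale
        R.add_left R.scale_left R.nonneg intro: R.En_sym\<close>)
qed

lemma cE_nonneg: "a \<in> idx X \<Longrightarrow> f \<in> edom X \<Longrightarrow> 0 \<le> cE a f f"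
  using semi_inner_space.B_nonneg[OF cE_semi_inner] .

lemma cE_additive_diag:
  assumes "a \<in> lev X n" "n \<le> m" "f \<in> edom X"
  shows "cE a f f = (\<Sum>b\<in>sub m a. cE b f f)"
proof -
  have "cE a f f = (\<Sum>b\<in>sub m a. cenergy X b (cell_restr X b (cell_restr X a f)) (cell_restr X b (cell_restr X a f)))"
    unfolding cE_def using splits_cell[OF assms(1,2)] cell_restr_cdom[OF assms(3) lev_idx[OF assms(1)]]
    unfolding splits_over_def by blast
  then show ?thesis by (simp add: cE_def cell_restr_cell_restr sub_cell)
qed

lemma cE_polar:
  assumes "a \<in> idx X" "f \<in> edom X" "g \<in> edom X"
  shows "cE a f g = (cE a (\<lambda>x. f x + g x) (\<lambda>x. f x + g x) - cE a f f - cE a g g) / 2"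
proof -
  interpret S: semi_inner_space "edom X" "\<lambda>u v x. u x + v x" "\<lambda>c u x. c * u x" "cE a"
    by (rule cE_semi_inner[OF assms(1)])
  show ?thesis using assms(2,3) by (simp add: S.B_ad_left S.B_ad_right S.ad_in S.B_sym[of g f])
qed

lemma cE_additive:
  assumes "a \<in> lev X n" "n \<le> m" "f \<in> edom X" "g \<in> edom X"
  shows "cE a f g = (\<Sum>b\<in>sub m a. cE b f g)"
proof -
  have "(\<Sum>b\<in>sub m a. cE b f g) =
     (\<Sum>b\<in>sub m a. (cE b (\<lambda>x. f x + g x) (\<lambda>x. f x + g x) - cE b f f - cE b g g) / 2)"
    by (intro sum.cong refl cE_polar lev_idx[OF sub_lev] assms)
  also have "\<dots> = (cE a (\<lambda>x. f x + g x) (\<lambda>x. f x + g x) - cE a f f - cE a g g) / 2"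
    using cE_additive_diag[OF assms(1,2)] assms(3,4) form.dom_add[OF assms(3,4)]
    by (simp add: sum_divide_distrib[symmetric] sum_subtractf)
  finally show ?thesis using cE_polar[OF lev_idx[OF assms(1)] assms(3,4)] by simp
qed

section \<open>Harmonic functions on cells\<close>

lemma harmonic_iff: "harmonic X u \<longleftrightarrow> form.harm_on (Vlev X 0) u"
  unfolding harmonic_def form.harm_on_iff_minimal by simp

lemma harmonic_edom: "harmonic X u \<Longrightarrow> u \<in> edom X"
  by (simp add: harmonic_def)

lemma harmonic_add: "harmonic X u \<Longrightarrow> harmonic X v \<Longrightarrow> harmonic X (\<lambda>x. u x + v x)"
  unfolding harmonic_iff by (rule form.harm_on_add)

lemma harmonic_scale: "harmonic X u \<Longrightarrow> harmonic X (\<lambda>x. c * u x)"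
  unfolding harmonic_iff by (rule form.harm_on_scale)

lemma harmonic_sum: "finite I \<Longrightarrow> (\<And>i. i \<in> I \<Longrightarrow> harmonic X (u i)) \<Longrightarrow> harmonic X (\<lambda>x. \<Sum>i\<in>I. u i x)"
  unfolding harmonic_iff by (rule form.harm_on_sum)

lemma harmonic_unique:
  "harmonic X u \<Longrightarrow> harmonic X v \<Longrightarrow> (\<And>x. x \<in> Vlev X 0 \<Longrightarrow> u x = v x) \<Longrightarrow> u = v"
  unfolding harmonic_iff using form.harm_on_unique[of "Vlev X 0" u v] Vlev_Vstar Vlev_0_nonempty by blast

lemma harm_ext: "harmonic X (harm_ext X f)" "x \<in> Vlev X 0 \<Longrightarrow> harm_ext X f x = f x"
proof -
  obtain u where u: "harmonic X u" "\<forall>x\<in>Vlev X 0. u x = f x"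
    using form.harm_on_exists[OF finite_Vlev Vlev_Vstar Vlev_0_nonempty] unfolding harmonic_iff by blast
  have "harm_ext X f = u"
    unfolding harm_ext_def using u harmonic_unique by (intro the_equality) auto
  then show "harmonic X (harm_ext X f)" "x \<in> Vlev X 0 \<Longrightarrow> harm_ext X f x = f x" using u by auto
qed

lemma harm_ext_edom: "harm_ext X f \<in> edom X"
  by (rule harmonic_edom[OF harm_ext(1)])

lemma harm_ext_restrict: "harmonic X u \<Longrightarrow> harm_ext X (restr (Vlev X 0) u) = u"
  by (rule harmonic_unique[OF harm_ext(1)]) (auto simp: harm_ext(2) restr_def)

lemma harm_ext_eq_sum: "harm_ext X t = (\<lambda>x. \<Sum>p\<in>Vlev X 0. t p * harm_ext X (indicator {p}) x)"
proof (rule harmonic_unique)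
  show "harmonic X (\<lambda>x. \<Sum>p\<in>Vlev X 0. t p * harm_ext X (indicator {p}) x)"
    by (intro harmonic_sum harmonic_scale harm_ext finite_Vlev)
  fix x assume x: "x \<in> Vlev X 0"
  have "(\<Sum>p\<in>Vlev X 0. t p * harm_ext X (indicator {p}) x) = (\<Sum>p\<in>Vlev X 0. if p = x then t p else 0)"
    by (rule sum.cong) (auto simp: harm_ext(2)[OF x])
  then show "harm_ext X t x = (\<Sum>p\<in>Vlev X 0. t p * harm_ext X (indicator {p}) x)"
    using x finite_Vlev by (simp add: harm_ext(2))
qed (rule harm_ext)

lemma cell_Int_V0: assumes "a \<in> lev X n" shows "cell X a \<inter> Vlev X 0 \<subseteq> vert X a"
  using cell_Int_Vlev[OF assms] Vlev_mono[of 0 n] by blast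

text \<open>A harmonic function minimizes the energy on each cell as well: a competitor on one cell with
  the same values at its vertices can be glued to the function on the other cells of the level.\<close>

lemma harmonic_on_cell:
  assumes u: "harmonic X u" and a: "a \<in> idx X"
  shows "resistance_form.harm_on (cdom X a) (cenergy X a) (vert X a) (cell_restr X a u)"
proof -
  interpret R: resistance_form "Vstar X \<inter> cell X a" "cdom X a" "cenergy X a" by (rule rf_cell[OF a])
  obtain n where n: "a \<in> lev X n" using a by (auto simp: idx_eq)
  have uE: "u \<in> edom X" by (rule harmonic_edom[OF u])
  have "cenergy X a (cell_restr X a u) (cell_restr X a u) \<le> cenergy X a k k"
    if k: "k \<in> cdom X a" and ku: "\<forall>x\<in>vert X a. k x = cell_restr X a u x" for k
  proof -
    define f where "f x = (if x \<in> cell X a then k x else u x)" for x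
    have ku': "k x = u x" if "x \<in> vert X a" for x
      using ku that vert_subset_cell[OF a] vert_Vstar[OF a] by (auto simp: cell_restr_def restr_def)
    have f_ell: "f \<in> ell (Vstar X)"
      using R.dom_outside[OF k] form.dom_outside[OF uE] by (auto simp: f_def ell_def)
    have fa: "cell_restr X a f = k"
      using R.dom_outside[OF k] by (auto simp: cell_restr_def restr_def f_def)
    have fb: "cell_restr X b f = cell_restr X b u" if "b \<in> lev X n" "b \<noteq> a" for b
      by (rule cell_restr_cong) (use vert_cell_Int(2)[OF that(1) n that(2)] ku' in \<open>auto simp: f_def\<close>)
    have "cell_restr X b f \<in> cdom X b" if "b \<in> lev X n" for b
      using fa fb[OF that] k cell_restr_cdom[OF uE lev_idx[OF that]] by (cases "b = a") auto
    then have fE: "f \<in> edom X" using edom_iff[OF f_ell] by blast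
    have "\<forall>x\<in>Vlev X 0. f x = u x" using cell_Int_V0[OF n] ku' by (auto simp: f_def)
    then have "energy X u u \<le> energy X f f" using u fE by (auto simp: harmonic_def)
    moreover have "energy X f f = cE a f f + (\<Sum>b\<in>lev X n - {a}. cE b f f)"
      using energy_eq_sum[OF fE, of n] finite_lev n by (simp add: sum.remove)
    moreover have "energy X u u = cE a u u + (\<Sum>b\<in>lev X n - {a}. cE b u u)"
      using energy_eq_sum[OF uE, of n] finite_lev n by (simp add: sum.remove)
    moreover have "(\<Sum>b\<in>lev X n - {a}. cE b f f) = (\<Sum>b\<in>lev X n - {a}. cE b u u)"
      by (rule sum.cong) (auto simp: cE_def fb)
    ultimately show ?thesis by (simp add: cE_def fa)
  qed
  then show ?thesis
    unfolding R.harm_on_iff_minimal using cell_restr_cdom[OF uE a] by blast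
qed

lemma cell_trace_harmonic:
  assumes "harmonic X u" "a \<in> idx X" "\<And>x. x \<in> vert X a \<Longrightarrow> f x = u x"
  shows "cell_trace X a f = cE a u u"
proof -
  interpret R: resistance_form "Vstar X \<inter> cell X a" "cdom X a" "cenergy X a" by (rule rf_cell[OF assms(2)])
  have "cell_restr X a u x = f x" if "x \<in> vert X a" for x
    using that assms(3)[OF that] vert_subset_cell[OF assms(2)] vert_Vstar[OF assms(2)]
    by (auto simp: cell_restr_def restr_def)
  then show ?thesis
    unfolding cell_trace_def cE_def
    by (intro R.form_trace_eq harmonic_on_cell assms) auto
qed

lemma Dmat:
  assumes "a \<in> idx X"
  shows "Dmat X a y z = Dmat X a z y" "cell_trace X a f = quad (vert X a) (Dmat X a) f"
proof -
  interpret R: resistance_form "Vstar X \<inter> cell X a" "cdom X a" "cenergy X a" by (rule rf_cell[OF assms])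
  have "\<exists>!K. (\<forall>y z. K y z = K z y) \<and> (\<forall>y z. y \<notin> vert X a \<or> z \<notin> vert X a \<longrightarrow> K y z = 0) \<and>
     (\<forall>f. cell_trace X a f = quad (vert X a) K f)"
    unfolding cell_trace_def
    using vert_subset_cell[OF assms] vert_Vstar[OF assms]
    by (intro R.ex1_trace_matrix finite_vert vert_nonempty assms) auto
  from theI'[OF this] show "Dmat X a y z = Dmat X a z y" "cell_trace X a f = quad (vert X a) (Dmat X a) f"
    unfolding Dmat_def by blast+
qed

text \<open>Both sides are symmetric bilinear forms on harmonic functions that agree on the diagonal, where the
trace is the energy on the cell.\<close>

lemma Mmap_Dmat_Mmap:
  assumes a: "a \<in> idx X"
  shows "(\<Sum>y\<in>vert X a. \<Sum>z\<in>vert X a. Mmap X a s y * Dmat X a y z * Mmap X a t z)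
     = cE a (harm_ext X s) (harm_ext X t)"
proof -
  let ?u = "harm_ext X s" and ?v = "harm_ext X t"
  let ?Q = "\<lambda>f g. \<Sum>y\<in>vert X a. \<Sum>z\<in>vert X a. f y * Dmat X a y z * g z"
  have "?Q ?v ?u = (\<Sum>z\<in>vert X a. \<Sum>y\<in>vert X a. ?v y * Dmat X a y z * ?u z)" by (rule sum.swap)
  also have "\<dots> = ?Q ?u ?v" by (simp add: Dmat(1)[OF a] mult_ac)
  finally have sym: "?Q ?v ?u = ?Q ?u ?v" .
  have tr: "cE a w w = ?Q w w" if "harmonic X w" for w
    using cell_trace_harmonic[OF that a, of w] Dmat(2)[OF a, of w] by (simp add: quad_def)
  have "cE a (\<lambda>x. ?u x + ?v x) (\<lambda>x. ?u x + ?v x) = ?Q ?u ?u + ?Q ?u ?v + ?Q ?v ?u + ?Q ?v ?v"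
    unfolding tr[OF harmonic_add[OF harm_ext(1) harm_ext(1)]] by (simp add: algebra_simps sum.distrib)
  then have "cE a ?u ?v = ?Q ?u ?v"
    using cE_polar[OF a harm_ext_edom harm_ext_edom, of s t] tr[OF harm_ext(1)] sym by simp
  then show ?thesis by (simp add: Mmap_def restr_def)
qed

lemma cE_sum_sum:
  assumes a: "a \<in> idx X" and "finite I" "finite J" and f: "\<And>i. i \<in> I \<Longrightarrow> f i \<in> edom X" and g: "\<And>j. j \<in> J \<Longrightarrow> g j \<in> edom X"
  shows "cE a (\<lambda>x. \<Sum>i\<in>I. c i * f i x) (\<lambda>x. \<Sum>j\<in>J. d j * g j x) = (\<Sum>i\<in>I. \<Sum>j\<in>J. c i * d j * cE a (f i) (g j))"
proof -
  interpret R: resistance_form "Vstar X \<inter> cell X a" "cdom X a" "cenergy X a" by (rule rf_cell[OF a])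
  show ?thesis
    unfolding cE_def cell_restr_sum cell_restr_scale
    by (intro R.En_sum_sum assms cell_restr_cdom)
qed

lemma cE_harm_ext:
  assumes "a \<in> idx X"
  shows "cE a (harm_ext X t) (harm_ext X t) =
    quad (Vlev X 0) (\<lambda>p q. cE a (harm_ext X (indicator {p})) (harm_ext X (indicator {q}))) t"
  unfolding harm_ext_eq_sum[of t] cE_sum_sum[OF assms finite_Vlev finite_Vlev harm_ext_edom harm_ext_edom] quad_def
  by (simp add: mult_ac)

end

section \<open>Energy measures\<close>

locale continuous_split_form = split_form X for X :: "('a::metric_space, 'i, 'z) rfrf_scheme" +
  assumes harmonic_continuous: "harmonic X u \<Longrightarrow> extends_continuously X u"
begin

text \<open>The energy of a harmonic function does not accumulate at a point \<open>x\<close>: on the small cells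
  around \<open>x\<close> the function coincides, up to a constant, with its cut-off at a small height about its
  value at \<open>x\<close>, and this cut-off has little energy.\<close>

lemma energy_at_point:
  assumes u: "harmonic X u" and x: "x \<in> carr X"
  shows "(\<lambda>n. \<Sum>a\<in>{a\<in>lev X n. x \<in> cell X a}. cE a u u) \<longlonglongrightarrow> 0"
proof -
  have uE: "u \<in> edom X" by (rule harmonic_edom[OF u])
  obtain g where g: "continuous_on (carr X) g" "\<forall>y\<in>Vstar X. g y = u y"
    using harmonic_continuous[OF u] by (auto simp: extends_continuously_def)
  define k where "k e = restr (Vstar X) (\<lambda>y. max (- e) (min (u y - g x) e))" for e
  have "\<exists>C. \<forall>e>0. \<forall>c. energy X (restr (Vstar X) (\<lambda>x. max (- e) (min (u x - c) e)))
           (restr (Vstar X) (\<lambda>x. max (- e) (min (u x - c) e))) \<le> C * e"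
    using u unfolding harmonic_iff by (rule form.harm_on_cutoff_small[OF _ finite_Vlev Vlev_Vstar])
  then obtain C where C: "\<And>e. e > 0 \<Longrightarrow> energy X (k e) (k e) \<le> C * e" unfolding k_def by blast
  have ev: "\<forall>\<^sub>F n in sequentially. (\<Sum>a\<in>{a\<in>lev X n. x \<in> cell X a}. cE a u u) \<le> C * e" if e: "e > 0" for e
  proof -
    obtain d where d: "d > 0" "\<And>y. y \<in> carr X \<Longrightarrow> dist y x < d \<Longrightarrow> dist (g y) (g x) < e"
      using g(1) x e unfolding continuous_on_iff by blast
    obtain M where M: "\<forall>n\<ge>M. \<forall>a\<in>lev X n. \<forall>x\<in>cell X a. \<forall>y\<in>cell X a. dist x y < d"
      using cells_small[OF d(1)] by auto
    have kE: "k e \<in> edom X" unfolding k_def by (rule form.energy_cutoff_le[OF uE e])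
    have "(\<Sum>a\<in>{a\<in>lev X n. x \<in> cell X a}. cE a u u) \<le> C * e" if n: "n \<ge> M" for n
    proof -
      have "cE a u u = cE a (k e) (k e)" if a: "a \<in> lev X n" "x \<in> cell X a" for a
      proof -
        interpret R: resistance_form "Vstar X \<inter> cell X a" "cdom X a" "cenergy X a" by (rule rf_cell[OF lev_idx[OF a(1)]])
        have "cell_restr X a (k e) = (\<lambda>y. cell_restr X a u y + restr (Vstar X \<inter> cell X a) (\<lambda>_. - g x) y)"
        proof
          fix y
          show "cell_restr X a (k e) y = cell_restr X a u y + restr (Vstar X \<inter> cell X a) (\<lambda>_. - g x) y"
          proof (cases "y \<in> Vstar X \<inter> cell X a")
            case True
            then have "dist y x < d" using M n a by blast
            then have "dist (g y) (g x) < e" using d(2) True Vstar_carr by blast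
            then have "\<bar>u y - g x\<bar> < e" using g(2) True by (auto simp: dist_real_def)
            then show ?thesis using True by (auto simp: cell_restr_def restr_def k_def)
          qed (auto simp: cell_restr_def restr_def)
        qed
        then show ?thesis
          unfolding cE_def using cell_restr_cdom[OF uE lev_idx[OF a(1)]]
          by (simp add: R.B_ad_left R.B_ad_right R.dom_const R.dom_add R.En_const)
      qed
      then have "(\<Sum>a\<in>{a\<in>lev X n. x \<in> cell X a}. cE a u u) = (\<Sum>a\<in>{a\<in>lev X n. x \<in> cell X a}. cE a (k e) (k e))"
        by (intro sum.cong) auto
      also have "\<dots> \<le> (\<Sum>a\<in>lev X n. cE a (k e) (k e))"
        using finite_lev cE_nonneg[OF lev_idx kE] by (intro sum_mono2) auto
      also have "\<dots> \<le> C * e" using energy_eq_sum[OF kE, of n] C[OF e] by simp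
      finally show ?thesis .
    qed
    then show ?thesis unfolding eventually_sequentially by blast
  qed
  show ?thesis
  proof (rule order_tendstoI)
    fix y :: real assume "y < 0"
    then show "\<forall>\<^sub>F n in sequentially. y < (\<Sum>a\<in>{a\<in>lev X n. x \<in> cell X a}. cE a u u)"
      using cE_nonneg[OF lev_idx uE] by (intro always_eventually allI less_le_trans[OF _ sum_nonneg]) auto
  next
    fix y :: real assume y: "0 < y"
    have "C * (y / (2 * (\<bar>C\<bar> + 1))) < y"
    proof -
      have "C * (y / (2 * (\<bar>C\<bar> + 1))) \<le> \<bar>C\<bar> * (y / (2 * (\<bar>C\<bar> + 1)))" using y by (intro mult_right_mono) auto
      also have "\<dots> < y" using y by (simp add: field_simps) (intro add_nonneg_pos; simp)
      finally show ?thesis .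
    qed
    then show "\<forall>\<^sub>F n in sequentially. (\<Sum>a\<in>{a\<in>lev X n. x \<in> cell X a}. cE a u u) < y"
      using ev[of "y / (2 * (\<bar>C\<bar> + 1))"] y by (auto elim!: eventually_mono)
  qed
qed

lemma cell_weight_harmonic: assumes "harmonic X u" shows "cell_weight X (\<lambda>a. cE a u u)"
proof
  show "0 \<le> cE a u u" if "a \<in> idx X" for a
    using cE_nonneg[OF that harmonic_edom[OF assms]] .
  show "cE a u u = (\<Sum>b\<in>sub (Suc n) a. cE b u u)" if "a \<in> lev X n" for a n
    by (rule cE_additive_diag[OF that _ harmonic_edom[OF assms]]) simp
qed (rule energy_at_point[OF assms])

lemma energy_measure:
  assumes u: "harmonic X u"
  shows "sets (energy_measure X u) = sets borel_carr"
    and "x \<in> carr X \<Longrightarrow> emeasure (energy_measure X u) {x} = 0"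
    and "a \<in> idx X \<Longrightarrow> emeasure (energy_measure X u) (cell X a) = ennreal (cE a u u)"
proof -
  interpret W: cell_weight X "\<lambda>a. cE a u u" by (rule cell_weight_harmonic[OF u])
  have "(\<forall>a\<in>idx X. emeasure M (cell X a) = ennreal (cell_trace X a u)) \<longleftrightarrow>
      (\<forall>a\<in>idx X. emeasure M (cell X a) = ennreal (cE a u u))" for M
    using cell_trace_harmonic[OF u] by simp
  then have "\<exists>!M. sets M = sets borel_carr \<and> atomless M \<and>
      (\<forall>a\<in>idx X. emeasure M (cell X a) = ennreal (cell_trace X a u))"
    using W.ex1_atomless_measure by simp
  from theI'[OF this] have *: "sets (energy_measure X u) = sets borel_carr" "atomless (energy_measure X u)"
    "\<forall>a\<in>idx X. emeasure (energy_measure X u) (cell X a) = ennreal (cell_trace X a u)"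
    unfolding energy_measure_def by blast+
  show "sets (energy_measure X u) = sets borel_carr" by (rule *(1))
  show "x \<in> carr X \<Longrightarrow> emeasure (energy_measure X u) {x} = 0"
    using atomless_iff_singletons_null[OF *(1)] *(2) by blast
  show "a \<in> idx X \<Longrightarrow> emeasure (energy_measure X u) (cell X a) = ennreal (cE a u u)"
    using *(3) cell_trace_harmonic[OF u] by simp
qed

end

locale kusuoka_form = continuous_split_form X for X :: "('a::metric_space, 'i, 'z) rfrf_scheme" +
  fixes h :: "nat \<Rightarrow> 'a \<Rightarrow> real"
  assumes basis: "harmonic_orthonormal_basis X h"
begin

abbreviation "hdim \<equiv> card (Vlev X 0) - 1"

lemma basis_harmonic: "i < hdim \<Longrightarrow> harmonic X (h i)"
  using basis by (simp add: harmonic_orthonormal_basis_def Let_def)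

lemma basis_span: "harmonic X g \<Longrightarrow> \<exists>c0 c. \<forall>x\<in>Vstar X. g x = c0 + (\<Sum>i<hdim. c i * h i x)"
  using basis unfolding harmonic_orthonormal_basis_def Let_def by blast

lemma sets_kusuoka: "sets (kusuoka X h) = sets borel_carr"
  unfolding kusuoka_def using sets.space_closed[of borel_carr] sets.sigma_sets_eq[of borel_carr]
  by (simp add: space_restrict_space)

lemma emeasure_kusuoka:
  assumes "B \<in> sets borel_carr"
  shows "emeasure (kusuoka X h) B = (\<Sum>i<hdim. emeasure (energy_measure X (h i)) B)"
proof (rule emeasure_measure_of[OF kusuoka_def])
  show "sets borel_carr \<subseteq> Pow (carr X)" using sets.space_closed[of borel_carr] by (simp add: space_restrict_space)
  show "B \<in> sets (kusuoka X h)" using assms sets_kusuoka by simp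
  show "positive (sets (kusuoka X h)) (\<lambda>B. \<Sum>i<hdim. emeasure (energy_measure X (h i)) B)"
    by (simp add: positive_def)
  show "countably_additive (sets (kusuoka X h)) (\<lambda>B. \<Sum>i<hdim. emeasure (energy_measure X (h i)) B)"
  proof (rule countably_additiveI)
    fix A :: "nat \<Rightarrow> 'a set"
    assume A: "range A \<subseteq> sets (kusuoka X h)" "disjoint_family A"
    have "(\<Sum>n. \<Sum>i<hdim. emeasure (energy_measure X (h i)) (A n)) = (\<Sum>i<hdim. \<Sum>n. emeasure (energy_measure X (h i)) (A n))"
      by (intro suminf_sum) simp
    also have "\<dots> = (\<Sum>i<hdim. emeasure (energy_measure X (h i)) (\<Union>n. A n))"
      using A energy_measure(1)[OF basis_harmonic] sets_kusuoka by (intro sum.cong refl suminf_emeasure) auto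
    finally show "(\<Sum>n. \<Sum>i<hdim. emeasure (energy_measure X (h i)) (A n)) = (\<Sum>i<hdim. emeasure (energy_measure X (h i)) (\<Union>n. A n))" .
  qed
qed

lemma emeasure_kusuoka_cell:
  assumes "a \<in> idx X"
  shows "emeasure (kusuoka X h) (cell X a) = ennreal (\<Sum>i<hdim. cE a (h i) (h i))"
  unfolding emeasure_kusuoka[OF cell_sets[OF assms]]
  using energy_measure(3)[OF basis_harmonic assms] cE_nonneg[OF assms harmonic_edom[OF basis_harmonic]]
  by (subst sum_ennreal[symmetric]) auto

sublocale cell_measure X "kusuoka X h"
proof
  show "sets (kusuoka X h) = sets borel_carr" by (rule sets_kusuoka)
  show "emeasure (kusuoka X h) {x} = 0" if "x \<in> carr X" for x
    using emeasure_kusuoka[of "{x}"] countable_sets[of "{x}"] that energy_measure(2)[OF basis_harmonic that] by simp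
  show "emeasure (kusuoka X h) (carr X) \<noteq> \<infinity>"
    using emeasure_kusuoka_cell[OF lev_idx[OF base_lev]] cell_base by simp
qed

lemma nu_eq: assumes "a \<in> idx X" shows "nu a = (\<Sum>i<hdim. cE a (h i) (h i))"
proof -
  have "0 \<le> (\<Sum>i<hdim. cE a (h i) (h i))"
    using cE_nonneg[OF assms harmonic_edom[OF basis_harmonic]] by (intro sum_nonneg) auto
  then show ?thesis unfolding nu_def measure_def using emeasure_kusuoka_cell[OF assms] by simp
qed

text \<open>The basis spans the harmonic functions modulo constants, and on a cell the mutual energy of two of
its members is at most the mean of their energies.\<close>

lemma harmonic_energy_dominated:
  assumes u: "harmonic X u"
  shows "\<exists>C. \<forall>a\<in>idx X. cE a u u \<le> C * nu a"
proof -
  obtain c0 c where c: "\<forall>x\<in>Vstar X. u x = c0 + (\<Sum>i<hdim. c i * h i x)" using basis_span[OF u] by blast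
  have "cE a u u \<le> (\<Sum>i<hdim. \<Sum>j<hdim. \<bar>c i * c j\<bar>) * nu a" if a: "a \<in> idx X" for a
  proof -
    interpret R: resistance_form "Vstar X \<inter> cell X a" "cdom X a" "cenergy X a" by (rule rf_cell[OF a])
    interpret S: semi_inner_space "edom X" "\<lambda>u v x. u x + v x" "\<lambda>c u x. c * u x" "cE a"
      by (rule cE_semi_inner[OF a])
    let ?s = "\<lambda>x. \<Sum>i<hdim. c i * h i x"
    have sE: "?s \<in> edom X" using harmonic_edom[OF basis_harmonic] by (intro form.dom_sum form.dom_scale) auto
    have "cell_restr X a u = (\<lambda>x. cell_restr X a ?s x + restr (Vstar X \<inter> cell X a) (\<lambda>_. c0) x)"
      using c by (auto simp: cell_restr_def restr_def)
    then have "cE a u u = cE a ?s ?s"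
      unfolding cE_def using cell_restr_cdom[OF sE a]
      by (simp add: R.B_ad_left R.B_ad_right R.dom_const R.dom_add R.En_const)
    also have "\<dots> = (\<Sum>i<hdim. \<Sum>j<hdim. c i * c j * cE a (h i) (h j))"
      using harmonic_edom[OF basis_harmonic] by (intro cE_sum_sum a) auto
    also have "\<dots> \<le> (\<Sum>i<hdim. \<Sum>j<hdim. \<bar>c i * c j\<bar> * nu a)"
    proof (intro sum_mono)
      fix i j assume ij: "i \<in> {..<hdim}" "j \<in> {..<hdim}"
      have le: "cE a (h i) (h i) \<le> nu a" if "i \<in> {..<hdim}" for i
        unfolding nu_eq[OF a] using that harmonic_edom[OF basis_harmonic] S.B_nonneg
        by (intro member_le_sum[of i "{..<hdim}" "\<lambda>i. cE a (h i) (h i)"]) auto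
      have "\<bar>cE a (h i) (h j)\<bar> \<le> nu a"
        using S.abs_B_le_half[of "h i" "h j"] le[OF ij(1)] le[OF ij(2)] ij harmonic_edom[OF basis_harmonic] by auto
      then have "\<bar>c i * c j * cE a (h i) (h j)\<bar> \<le> \<bar>c i * c j\<bar> * nu a"
        unfolding abs_mult[of "c i * c j"] by (rule mult_left_mono) simp
      then show "c i * c j * cE a (h i) (h j) \<le> \<bar>c i * c j\<bar> * nu a" by simp
    qed
    finally show ?thesis by (simp add: sum_distrib_right)
  qed
  then show ?thesis by blast
qed

lemma ex_dominated_cell_function:
  assumes "harmonic X u" "harmonic X v"
  shows "\<exists>C. dominated_cell_function X (kusuoka X h) (\<lambda>a. cE a u v) C"
proof -
  obtain C D where C: "\<forall>a\<in>idx X. cE a u u \<le> C * nu a" and D: "\<forall>a\<in>idx X. cE a v v \<le> D * nu a"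
    using harmonic_energy_dominated assms by meson
  have "\<bar>cE a u v\<bar> \<le> (C + D) / 2 * nu a" if a: "a \<in> idx X" for a
  proof -
    have "\<bar>cE a u v\<bar> \<le> (cE a u u + cE a v v) / 2"
      using semi_inner_space.abs_B_le_half[OF cE_semi_inner[OF a]] harmonic_edom assms by blast
    also have "\<dots> \<le> (C * nu a + D * nu a) / 2" using C D a by (simp add: add_mono)
    finally show ?thesis by (simp add: algebra_simps)
  qed
  moreover have "cE a u v = (\<Sum>b\<in>sub (Suc n) a. cE b u v)" if "a \<in> lev X n" for a n
    by (rule cE_additive[OF that]) (auto intro: harmonic_edom assms)
  ultimately show ?thesis
    by (intro exI[of _ "(C + D) / 2"] dominated_cell_function.intro dominated_cell_function_axioms.intro cell_measure_axioms)
qed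

end

section \<open>Square integrable vector fields for a field of positive semidefinite matrices\<close>

text \<open>Lagrange's reduction: splitting off the square that contains one of the variables leaves a
  positive semidefinite form in the others, the Schur complement.\<close>

definition schur :: "'a \<Rightarrow> ('a \<Rightarrow> 'a \<Rightarrow> real) \<Rightarrow> 'a \<Rightarrow> 'a \<Rightarrow> real" where
  "schur p K q r = K q r - K q p * K p r / K p p"

definition pivot :: "'a set \<Rightarrow> 'a \<Rightarrow> ('a \<Rightarrow> 'a \<Rightarrow> real) \<Rightarrow> ('a \<Rightarrow> real) \<Rightarrow> real" where
  "pivot V p K t = t p + (\<Sum>q\<in>V. K p q * t q / K p p)"

lemma psd_zero_diagonal:
  assumes "psd_matrix V K" "finite V" "p \<in> V" "q \<in> V" "K p p = 0"
  shows "K p q = 0"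
proof (rule ccontr)
  assume ne: "K p q \<noteq> 0"
  have "0 \<le> s\<^sup>2 * K p p + K q q + s * (K p q + K q p)" for s
  proof -
    have "0 \<le> quad V K (\<lambda>x. s * indicator {p} x + 1 * indicator {q} x)"
      using assms(1) unfolding psd_matrix_def by blast
    then show ?thesis unfolding quad_indicators[OF assms(2-4)] by simp
  qed
  moreover have "K q p = K p q" using assms(1) by (simp add: psd_matrix_def)
  ultimately have "0 \<le> K q q + 2 * s * K p q" for s using assms(5) by (simp add: algebra_simps)
  from this[of "- (K q q + 1) / (2 * K p q)"] show False using ne by (simp add: field_simps)
qed

lemma psd_matrix_sym: "psd_matrix V K \<Longrightarrow> K p q = K q p"
  by (simp add: psd_matrix_def)

lemma quad_insert:
  assumes "psd_matrix (insert p V) K" "finite V" "p \<notin> V"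
  shows "quad (insert p V) K t = K p p * (pivot V p K t)\<^sup>2 + quad V (schur p K) t"
proof -
  let ?S = "\<Sum>q\<in>V. K p q * t q"
  have sym: "K q p = K p q" for q by (rule psd_matrix_sym[OF assms(1)])
  have "quad (insert p V) K t = t p * K p p * t p + (\<Sum>q\<in>V. t p * K p q * t q) + (\<Sum>q\<in>V. t q * K p q * t p) + quad V K t"
  proof -
    have "(\<Sum>q\<in>V. t q * K q p * t p) = (\<Sum>q\<in>V. t q * K p q * t p)"
      by (intro sum.cong refl) (simp only: sym)
    then show ?thesis unfolding quad_def sum.insert[OF assms(2,3)] sum.distrib by linarith
  qed
  also have "\<dots> = K p p * (t p)\<^sup>2 + 2 * t p * ?S + quad V K t"
    by (simp add: power2_eq_square sum_distrib_left mult_ac)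
  finally have 1: "quad (insert p V) K t = K p p * (t p)\<^sup>2 + 2 * t p * ?S + quad V K t" .
  have "quad V (schur p K) t = (\<Sum>q\<in>V. \<Sum>r\<in>V. t q * K q r * t r - (K p q * t q) * (K p r * t r) / K p p)"
    unfolding quad_def
  proof (intro sum.cong refl)
    fix q r
    have "a * (b - c * d / e) * f = a * b * f - (c * a) * (d * f) / e" for a b c d e f :: real
      by (simp add: left_diff_distrib right_diff_distrib)
    then show "t q * schur p K q r * t r = t q * K q r * t r - (K p q * t q) * (K p r * t r) / K p p"
      unfolding schur_def sym[of q] .
  qed
  also have "\<dots> = quad V K t - (\<Sum>q\<in>V. \<Sum>r\<in>V. (K p q * t q) * (K p r * t r)) / K p p"
    by (simp add: quad_def sum_subtractf sum_divide_distrib)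
  also have "(\<Sum>q\<in>V. \<Sum>r\<in>V. (K p q * t q) * (K p r * t r)) = ?S * ?S"
    by (rule sum_product[symmetric])
  finally have 2: "quad V (schur p K) t = quad V K t - ?S\<^sup>2 / K p p" by (simp add: power2_eq_square)
  have 3: "pivot V p K t = t p + ?S / K p p" by (simp add: pivot_def sum_divide_distrib)
  show ?thesis
  proof (cases "K p p = 0")
    case True
    have "K p q = 0" if "q \<in> V" for q
      by (rule psd_zero_diagonal[OF assms(1)]) (use True that assms in auto)
    then have "?S = 0" by simp
    then show ?thesis using 1 2 True by simp
  next
    case False
    then show ?thesis unfolding 1 2 3 by (simp add: field_simps power2_eq_square)
  qed
qed

lemma schur_psd:
  assumes "psd_matrix (insert p V) K" "finite V" "p \<notin> V"
  shows "psd_matrix V (schur p K)"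
  unfolding psd_matrix_def
proof (intro conjI allI)
  show "schur p K q r = schur p K r q" for q r using assms(1) by (simp add: psd_matrix_def schur_def mult.commute)
  fix t
  let ?t = "t(p := - (\<Sum>q\<in>V. K p q * t q / K p p))"
  have "(\<Sum>q\<in>V. K p q * ?t q / K p p) = (\<Sum>q\<in>V. K p q * t q / K p p)"
    using assms(3) by (intro sum.cong) auto
  then have "pivot V p K ?t = 0" by (simp add: pivot_def)
  then have "quad (insert p V) K ?t = quad V (schur p K) ?t" using quad_insert[OF assms] by simp
  also have "\<dots> = quad V (schur p K) t" using assms(3) by (intro quad_cong) auto
  finally have "quad V (schur p K) t = quad (insert p V) K ?t" by (rule sym)
  then show "0 \<le> quad V (schur p K) t" using assms(1) unfolding psd_matrix_def by simp
qed

lemma pivot_diff: "pivot V p K (\<lambda>q. s q - t q) = pivot V p K s - pivot V p K t"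
  by (simp add: pivot_def sum_subtractf algebra_simps diff_divide_distrib)

text \<open>The reduction yields a limit that depends measurably on the matrix, although the limit is not
  unique where the matrix is degenerate.\<close>

lemma ex_measurable_limit:
  fixes K :: "'b \<Rightarrow> 'a \<Rightarrow> 'a \<Rightarrow> real" and u :: "nat \<Rightarrow> 'b \<Rightarrow> 'a \<Rightarrow> real"
  assumes "finite V"
    and "\<And>p q. p \<in> V \<Longrightarrow> q \<in> V \<Longrightarrow> (\<lambda>x. K x p q) \<in> borel_measurable M"
    and "\<And>x. psd_matrix V (K x)"
    and "\<And>n p. p \<in> V \<Longrightarrow> (\<lambda>x. u n x p) \<in> borel_measurable M"
    and "\<And>x e. e > 0 \<Longrightarrow> \<exists>N. \<forall>m\<ge>N. \<forall>n\<ge>N. qdist V (K x) (u m x) (u n x) < e"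
  shows "\<exists>v. (\<forall>p\<in>V. (\<lambda>x. v x p) \<in> borel_measurable M) \<and>
    (\<forall>x. (\<lambda>n. qdist V (K x) (u n x) (v x)) \<longlonglongrightarrow> 0)"
  using assms
proof (induction V arbitrary: K rule: finite_induct)
  case empty
  then show ?case by (simp add: quad_def)
next
  case (insert p V K)
  note Kmeas = insert.prems(1) and psd = insert.prems(2) and umeas = insert.prems(3) and Cau = insert.prems(4)
  note split = quad_insert[OF psd insert.hyps]
  have psd': "psd_matrix V (schur p (K x))" for x by (rule schur_psd[OF psd insert.hyps])
  have Kpp: "0 \<le> K x p p" for x
    using psd[of x] quad_indicators[of "insert p V" p p "K x" 1 0] insert.hyps
    unfolding psd_matrix_def by (simp) (metis)
  have meas_schur: "(\<lambda>x. schur p (K x) q r) \<in> borel_measurable M" if "q \<in> V" "r \<in> V" for q r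
    unfolding schur_def using that
    by (intro borel_measurable_diff borel_measurable_divide borel_measurable_times Kmeas) auto
  have "\<exists>N. \<forall>m\<ge>N. \<forall>n\<ge>N. qdist V (schur p (K x)) (u m x) (u n x) < e" if e: "e > 0" for x e
  proof -
    have "quad V (schur p (K x)) t \<le> quad (insert p V) (K x) t" for t
      unfolding split using Kpp by simp
    then show ?thesis using Cau[OF e, of x] order_le_less_trans by (meson)
  qed
  then have "\<exists>v. (\<forall>q\<in>V. (\<lambda>x. v x q) \<in> borel_measurable M) \<and>
    (\<forall>x. (\<lambda>n. qdist V (schur p (K x)) (u n x) (v x)) \<longlonglongrightarrow> 0)"
    by (intro insert.IH meas_schur psd' umeas) auto
  then obtain v where v: "\<And>q. q \<in> V \<Longrightarrow> (\<lambda>x. v x q) \<in> borel_measurable M"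
    "\<And>x. (\<lambda>n. qdist V (schur p (K x)) (u n x) (v x)) \<longlonglongrightarrow> 0"
    by auto
  \<comment> \<open>where the pivot entry vanishes the sequence need not converge; the value of \<open>L\<close> there is multiplied by \<open>0\<close>\<close>
  define L where "L x = lim (\<lambda>n. pivot V p (K x) (u n x))" for x
  define w where "w x = (v x)(p := L x - (\<Sum>q\<in>V. K x p q * v x q / K x p p))" for x
  have w_eq: "w x q = v x q" if "q \<in> V" for x q using that insert.hyps(2) by (auto simp: w_def)
  have "(\<Sum>q\<in>V. K x p q * w x q / K x p p) = (\<Sum>q\<in>V. K x p q * v x q / K x p p)" for x
    by (intro sum.cong) (auto simp: w_eq)
  then have pw: "pivot V p (K x) (w x) = L x" for x by (simp add: pivot_def w_def)
  have Lmeas: "L \<in> borel_measurable M"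
    unfolding L_def[abs_def] pivot_def
    by (intro borel_measurable_lim_metric borel_measurable_add borel_measurable_sum borel_measurable_divide
        borel_measurable_times Kmeas umeas) auto
  have "(\<lambda>x. w x q) \<in> borel_measurable M" if "q \<in> insert p V" for q
  proof (cases "q = p")
    case True
    then show ?thesis
      unfolding w_def using Lmeas v(1)
      by (auto intro!: borel_measurable_diff borel_measurable_sum borel_measurable_divide
        borel_measurable_times Kmeas)
  next
    case False
    then show ?thesis using that v(1) w_eq by auto
  qed
  moreover have "(\<lambda>n. qdist (insert p V) (K x) (u n x) (w x)) \<longlonglongrightarrow> 0" for x
  proof -
    have piv: "(\<lambda>n. K x p p * (pivot V p (K x) (u n x) - L x)\<^sup>2) \<longlonglongrightarrow> 0"
    proof (cases "K x p p = 0")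
      case False
      then have pos: "K x p p > 0" using Kpp[of x] by simp
      have "Cauchy (\<lambda>n. pivot V p (K x) (u n x))"
      proof (rule metric_CauchyI)
        fix e :: real assume e: "e > 0"
        then obtain N where N: "\<forall>m\<ge>N. \<forall>n\<ge>N. qdist (insert p V) (K x) (u m x) (u n x) < K x p p * e\<^sup>2"
          using Cau[of "K x p p * e\<^sup>2" x] pos by auto
        have "dist (pivot V p (K x) (u m x)) (pivot V p (K x) (u n x)) < e" if mn: "m \<ge> N" "n \<ge> N" for m n
        proof -
          have "K x p p * (pivot V p (K x) (u m x) - pivot V p (K x) (u n x))\<^sup>2 < K x p p * e\<^sup>2"
          proof -
            have "0 \<le> qdist V (schur p (K x)) (u m x) (u n x)" using psd'[of x] unfolding psd_matrix_def by blast
            then show ?thesis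
              using N[rule_format, OF mn] split[of x "\<lambda>p. u m x p - u n x p"] unfolding pivot_diff by linarith
          qed
          then have "(pivot V p (K x) (u m x) - pivot V p (K x) (u n x))\<^sup>2 < e\<^sup>2" using pos by simp
          then have "\<bar>pivot V p (K x) (u m x) - pivot V p (K x) (u n x)\<bar>\<^sup>2 < e\<^sup>2"
            by (simp only: power2_abs)
          then have "\<bar>pivot V p (K x) (u m x) - pivot V p (K x) (u n x)\<bar> < e"
            by (rule power2_less_imp_less) (use e in simp)
          then show ?thesis by (simp only: dist_real_def)
        qed
        then show "\<exists>N. \<forall>m\<ge>N. \<forall>n\<ge>N. dist (pivot V p (K x) (u m x)) (pivot V p (K x) (u n x)) < e" by blast
      qed
      then have "(\<lambda>n. pivot V p (K x) (u n x)) \<longlonglongrightarrow> L x"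
        unfolding L_def by (simp add: Cauchy_convergent convergent_LIMSEQ_iff[symmetric])
      then have "(\<lambda>n. K x p p * (pivot V p (K x) (u n x) - L x)\<^sup>2) \<longlonglongrightarrow> K x p p * (L x - L x)\<^sup>2"
        by (intro tendsto_intros)
      then show ?thesis by simp
    qed simp
    have "qdist V (schur p (K x)) (u n x) (w x) = qdist V (schur p (K x)) (u n x) (v x)" for n
      by (rule quad_cong) (simp add: w_eq)
    then have "qdist (insert p V) (K x) (u n x) (w x) =
       K x p p * (pivot V p (K x) (u n x) - L x)\<^sup>2 + qdist V (schur p (K x)) (u n x) (v x)" for n
      unfolding split pivot_diff pw by simp
    then show ?thesis using tendsto_add[OF piv v(2)[of x]] by simp
  qed
  ultimately show ?case by blast
qed

lemma geometric_chain_le: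
  fixes D :: "nat \<Rightarrow> real"
  assumes "D n = 0" "\<And>m. m \<ge> n \<Longrightarrow> D (Suc m) \<le> D m + c * r ^ m" "0 \<le> c" "0 \<le> r" "r < 1" "n \<le> m"
  shows "D m \<le> c * r ^ n / (1 - r)"
proof -
  have "D m \<le> c * (r ^ n - r ^ m) / (1 - r)"
    using assms(6)
  proof (induction m rule: dec_induct)
    case (step m)
    have "D (Suc m) \<le> c * (r ^ n - r ^ m) / (1 - r) + c * r ^ m" using assms(2)[of m] step by linarith
    also have "\<dots> = c * (r ^ n - r ^ Suc m) / (1 - r)" using assms(5) by (simp add: field_simps)
    finally show ?case .
  qed (simp add: assms(1))
  also have "\<dots> \<le> c * r ^ n / (1 - r)"
    using assms by (intro divide_right_mono mult_left_mono) auto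
  finally show ?thesis .
qed

locale psd_field =
  fixes M :: "'b measure" and V :: "'a set" and K :: "'b \<Rightarrow> 'a \<Rightarrow> 'a \<Rightarrow> real"
  assumes finite_V: "finite V"
    and K_measurable: "p \<in> V \<Longrightarrow> q \<in> V \<Longrightarrow> (\<lambda>x. K x p q) \<in> borel_measurable M"
    and K_psd: "AE x in M. psd_matrix V (K x)"
begin

definition L2 :: "('b \<Rightarrow> 'a \<Rightarrow> real) set" where
  "L2 = {u. (\<forall>p\<in>V. (\<lambda>x. u x p) \<in> borel_measurable M) \<and> integrable M (\<lambda>x. quad V (K x) (u x))}"

definition ip :: "('b \<Rightarrow> 'a \<Rightarrow> real) \<Rightarrow> ('b \<Rightarrow> 'a \<Rightarrow> real) \<Rightarrow> real" where
  "ip u v = (LINT x|M. bil V (K x) (u x) (v x))"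

abbreviation sqdist :: "('b \<Rightarrow> 'a \<Rightarrow> real) \<Rightarrow> ('b \<Rightarrow> 'a \<Rightarrow> real) \<Rightarrow> real" where
  "sqdist u v \<equiv> ip (\<lambda>x p. u x p - v x p) (\<lambda>x p. u x p - v x p)"

lemma bil_measurable:
  assumes "\<And>p. p \<in> V \<Longrightarrow> (\<lambda>x. u x p) \<in> borel_measurable M" "\<And>p. p \<in> V \<Longrightarrow> (\<lambda>x. v x p) \<in> borel_measurable M"
  shows "(\<lambda>x. bil V (K x) (u x) (v x)) \<in> borel_measurable M"
  unfolding bil_def by (intro borel_measurable_sum borel_measurable_times K_measurable assms)

lemma L2_measurable: "u \<in> L2 \<Longrightarrow> p \<in> V \<Longrightarrow> (\<lambda>x. u x p) \<in> borel_measurable M"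
  by (simp add: L2_def)

lemma L2_integrable: "u \<in> L2 \<Longrightarrow> integrable M (\<lambda>x. bil V (K x) (u x) (u x))"
  by (simp add: L2_def quad_bil)

lemma bil_integrable:
  assumes "u \<in> L2" "v \<in> L2"
  shows "integrable M (\<lambda>x. bil V (K x) (u x) (v x))"
proof (rule Bochner_Integration.integrable_bound)
  show "integrable M (\<lambda>x. (bil V (K x) (u x) (u x) + bil V (K x) (v x) (v x)) / 2)"
    using L2_integrable assms by simp
  show "AE x in M. norm (bil V (K x) (u x) (v x)) \<le> norm ((bil V (K x) (u x) (u x) + bil V (K x) (v x) (v x)) / 2)"
    using K_psd
  proof eventually_elim
    case (elim x)
    have "\<bar>bil V (K x) (u x) (v x)\<bar> \<le> (bil V (K x) (u x) (u x) + bil V (K x) (v x) (v x)) / 2"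
      by (rule semi_inner_space.abs_B_le_half[OF bil_semi_inner[OF elim]]) auto
    then show ?case by simp
  qed
qed (intro bil_measurable L2_measurable assms)

sublocale S: semi_inner_space L2 "\<lambda>u v x p. u x p + v x p" "\<lambda>c u x p. c * u x p" ip
proof
  have add: "bil V N (\<lambda>p. s p + t p) r = bil V N s r + bil V N t r"
    and add': "bil V N r (\<lambda>p. s p + t p) = bil V N r s + bil V N r t"
    and scale: "bil V N (\<lambda>p. c * s p) t = c * bil V N s t"
    and scale': "bil V N s (\<lambda>p. c * t p) = c * bil V N s t" for N :: "'a \<Rightarrow> 'a \<Rightarrow> real" and s t r c
    by (simp_all add: bil_def algebra_simps sum.distrib sum_distrib_left)
  fix u v w :: "'b \<Rightarrow> 'a \<Rightarrow> real" and c :: real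
  assume u: "u \<in> L2"
  show "(\<lambda>x p. c * u x p) \<in> L2"
    unfolding L2_def quad_bil scale scale' mem_Collect_eq
    by (intro conjI ballI borel_measurable_times borel_measurable_const L2_measurable
        integrable_mult_right L2_integrable u)
  show "0 \<le> ip u u"
    unfolding ip_def
  proof (rule integral_nonneg_AE)
    show "AE x in M. 0 \<le> bil V (K x) (u x) (u x)"
      using K_psd by eventually_elim (simp add: psd_matrix_def quad_bil)
  qed
  assume v: "v \<in> L2"
  show "(\<lambda>x p. u x p + v x p) \<in> L2"
    unfolding L2_def quad_bil add add' mem_Collect_eq
    by (intro conjI ballI borel_measurable_add L2_measurable Bochner_Integration.integrable_add bil_integrable u v)
  show "ip u v = ip v u"
    unfolding ip_def
  proof (rule integral_cong_AE)
    show "AE x in M. bil V (K x) (u x) (v x) = bil V (K x) (v x) (u x)"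
      using K_psd by eventually_elim (rule semi_inner_space.B_sym[OF bil_semi_inner], auto)
    show "(\<lambda>x. bil V (K x) (u x) (v x)) \<in> borel_measurable M" "(\<lambda>x. bil V (K x) (v x) (u x)) \<in> borel_measurable M"
      by (intro bil_measurable L2_measurable u v; assumption)+
  qed
  show "ip (\<lambda>x p. c * u x p) v = c * ip u v"
    by (simp add: ip_def scale)
  assume w: "w \<in> L2"
  show "ip (\<lambda>x p. u x p + v x p) w = ip u w + ip v w"
    unfolding ip_def add by (intro Bochner_Integration.integral_add bil_integrable u v w)
qed

lemma L2_diff: "u \<in> L2 \<Longrightarrow> v \<in> L2 \<Longrightarrow> (\<lambda>x p. u x p - v x p) \<in> L2"
  using S.ad_in[OF _ S.sc_in[of v "-1"], of u] by simp

lemma ip_triangle: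
  assumes "u \<in> L2" "v \<in> L2" "w \<in> L2"
  shows "sqrt (sqdist u w) \<le>
    sqrt (sqdist u v) + sqrt (sqdist v w)"
  using S.sqrt_B_triangle[OF L2_diff[OF assms(1,2)] L2_diff[OF assms(2,3)]] by simp

text \<open>Riesz-Fischer: a rapidly convergent sequence converges pointwise almost everywhere.\<close>

lemma AE_pointwise_geometric:
  assumes u: "\<And>n. u n \<in> L2"
    and rate: "\<And>n. sqdist (u n) (u (Suc n)) \<le> (1/4) ^ n"
  shows "AE x in M. \<exists>B. \<forall>n. qdist V (K x) (u n x) (u (Suc n) x) \<le> B * (1/2) ^ n"
proof -
  let ?q = "\<lambda>n x. qdist V (K x) (u n x) (u (Suc n) x)"
  have int: "integrable M (?q n)" for n
    using L2_integrable[OF L2_diff[OF u u]] by (simp add: quad_bil)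
  have nn: "AE x in M. 0 \<le> ?q n x" for n
    using K_psd by eventually_elim (simp add: psd_matrix_def)
  have "(\<integral>\<^sup>+x. (\<Sum>n. ennreal (2 ^ n * ?q n x)) \<partial>M) = (\<Sum>n. \<integral>\<^sup>+x. ennreal (2 ^ n * ?q n x) \<partial>M)"
    by (intro nn_integral_suminf measurable_compose[OF _ measurable_ennreal] borel_measurable_times
        borel_measurable_const borel_measurable_integrable int)
  also have "\<dots> \<le> (\<Sum>n. ennreal ((1/2) ^ n))"
  proof (intro suminf_le)
    fix n
    have "(\<integral>\<^sup>+x. ennreal (2 ^ n * ?q n x) \<partial>M) = ennreal (LINT x|M. 2 ^ n * ?q n x)"
      using nn[of n] by (intro nn_integral_eq_integral integrable_mult_right int) (auto elim: eventually_mono)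
    also have "(LINT x|M. 2 ^ n * ?q n x) \<le> 2 ^ n * (1/4) ^ n"
      using rate[of n] by (simp add: ip_def quad_bil)
    also have "(2::real) ^ n * (1/4) ^ n = (1/2) ^ n" by (simp flip: power_mult_distrib)
    finally show "(\<integral>\<^sup>+x. ennreal (2 ^ n * ?q n x) \<partial>M) \<le> ennreal ((1/2) ^ n)" by (simp add: ennreal_leI)
  qed auto
  also have "\<dots> = ennreal (\<Sum>n. (1/2) ^ n)"
    by (rule suminf_ennreal2) (simp_all add: summable_geometric)
  also have "\<dots> < \<infinity>" by simp
  finally have "AE x in M. (\<Sum>n. ennreal (2 ^ n * ?q n x)) \<noteq> \<infinity>"
    by (intro nn_integral_PInf_AE borel_measurable_suminf_order measurable_compose[OF _ measurable_ennreal]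
        borel_measurable_times borel_measurable_const borel_measurable_integrable int) auto
  then show ?thesis
    using K_psd
  proof eventually_elim
    case (elim x)
    define B where "B = enn2real (\<Sum>n. ennreal (2 ^ n * ?q n x))"
    have "?q n x \<le> B * (1/2) ^ n" for n
    proof -
      have "ennreal (2 ^ n * ?q n x) \<le> (\<Sum>n. ennreal (2 ^ n * ?q n x))"
        using sum_le_suminf[of "\<lambda>n. ennreal (2 ^ n * ?q n x)" "{n}"] by auto
      then have "ennreal (2 ^ n * ?q n x) \<le> ennreal B"
        using elim(1) by (simp add: B_def ennreal_enn2real less_top)
      then have "2 ^ n * ?q n x \<le> B" by (simp add: ennreal_le_iff B_def)
      then show ?thesis by (simp add: field_simps)
    qed
    then show ?case by blast
  qed
qed

text \<open>By Fatou's lemma the pointwise limit is the limit in norm. On a null set the matrices are replaced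
by \<open>0\<close>, so that the pointwise sequences are Cauchy everywhere.\<close>

lemma L2_complete:
  assumes u: "\<And>n. u n \<in> L2"
    and rate: "\<And>n. sqdist (u n) (u (Suc n)) \<le> (1/4) ^ n"
  shows "\<exists>v\<in>L2. (\<lambda>n. sqdist (u n) v) \<longlonglongrightarrow> 0"
proof -
  let ?good = "\<lambda>x. psd_matrix V (K x) \<and> (\<exists>B. \<forall>n. qdist V (K x) (u n x) (u (Suc n) x) \<le> B * (1/2) ^ n)"
  have "AE x in M. ?good x" using K_psd AE_pointwise_geometric[OF u rate] by eventually_elim blast
  then obtain E where E: "{x \<in> space M. \<not> ?good x} \<subseteq> E" "emeasure M E = 0" "E \<in> sets M" by (rule AE_E)
  define G where "G = space M - E"
  have G: "G \<in> sets M" "AE x in M. x \<in> G" "\<And>x. x \<in> G \<Longrightarrow> ?good x"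
    using E AE_not_in[of E M] by (auto simp: G_def null_sets_def elim!: eventually_mono)
  define K' where "K' x p q = indicator G x * K x p q" for x p q
  have K': "K' x = K x" if "x \<in> G" for x using that by (intro ext) (simp add: K'_def)
  have "\<exists>v. (\<forall>p\<in>V. (\<lambda>x. v x p) \<in> borel_measurable M) \<and>
    (\<forall>x. (\<lambda>n. qdist V (K' x) (u n x) (v x)) \<longlonglongrightarrow> 0)"
  proof (rule ex_measurable_limit[OF finite_V])
    show "(\<lambda>x. K' x p q) \<in> borel_measurable M" if "p \<in> V" "q \<in> V" for p q
      unfolding K'_def by (intro borel_measurable_times borel_measurable_indicator G K_measurable that)
    show "psd_matrix V (K' x)" for x
    proof (cases "x \<in> G")
      case False
      then show ?thesis by (simp add: psd_matrix_def K'_def quad_def)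
    qed (use K' G(3) in simp)
    show "\<And>n p. p \<in> V \<Longrightarrow> (\<lambda>x. u n x p) \<in> borel_measurable M" by (rule L2_measurable[OF u])
    show "\<exists>N. \<forall>m\<ge>N. \<forall>n\<ge>N. qdist V (K' x) (u m x) (u n x) < e" if e: "e > 0" for x e
    proof (cases "x \<in> G")
      case False
      then show ?thesis using e by (simp add: K'_def quad_def)
    next
      case True
      then obtain B where psd: "psd_matrix V (K x)"
        and B: "\<And>n. qdist V (K x) (u n x) (u (Suc n) x) \<le> B * (1/2) ^ n" using G(3) by blast
      have B0: "0 \<le> B" using B[of 0] psd by (auto simp: psd_matrix_def intro: order_trans)
      \<comment> \<open>the norms are square roots of the quadratic forms, hence so is the rate\<close>
      define r where "r = sqrt (1/2)"
      have r: "0 \<le> r" "r < 1" by (auto simp: r_def real_sqrt_divide)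
      let ?d = "\<lambda>m n. sqrt (qdist V (K x) (u m x) (u n x))"
      have d: "?d n m \<le> sqrt B * r ^ n / (1 - r)" if "n \<le> m" for n m
      proof (rule geometric_chain_le[OF _ _ _ r that])
        show "?d n n = 0" by (simp add: quad_def)
        show "?d n (Suc m) \<le> ?d n m + sqrt B * r ^ m" if "m \<ge> n" for m
        proof -
          have "?d m (Suc m) \<le> sqrt (B * (1/2) ^ m)" using B by (intro real_sqrt_le_mono)
          also have "\<dots> = sqrt B * r ^ m" by (simp add: real_sqrt_mult r_def real_sqrt_power)
          finally show ?thesis using qdist_triangle[OF psd, of "u n x" "u (Suc m) x" "u m x"] by linarith
        qed
      qed (use B0 in simp)
      have "(\<lambda>n. sqrt B * r ^ n / (1 - r)) \<longlonglongrightarrow> sqrt B * 0 / (1 - r)"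
        using r by (intro tendsto_intros LIMSEQ_realpow_zero) auto
      then have "\<forall>\<^sub>F n in sequentially. sqrt B * r ^ n / (1 - r) < sqrt e"
        using e by (intro order_tendstoD(2)[where y = 0]) auto
      then obtain N where N: "\<And>n. n \<ge> N \<Longrightarrow> sqrt B * r ^ n / (1 - r) < sqrt e"
        unfolding eventually_sequentially by blast
      have "qdist V (K x) (u m x) (u n x) < e" if mn: "m \<ge> N" "n \<ge> N" for m n
      proof -
        have "?d m n < sqrt e"
        proof (cases "m \<le> n")
          case True
          then show ?thesis using d[OF True] N[OF mn(1)] by linarith
        next
          case False
          then have "?d n m < sqrt e" using d[of n m] N[OF mn(2)] by linarith
          then show ?thesis using qdist_commute[of V "K x" "u m x" "u n x"] by simp
        qed
        then show ?thesis by simp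
      qed
      then show ?thesis using K'[OF True] by auto
    qed
  qed
  then obtain v where vm: "\<And>p. p \<in> V \<Longrightarrow> (\<lambda>x. v x p) \<in> borel_measurable M"
    and vlim: "\<And>x. (\<lambda>n. qdist V (K' x) (u n x) (v x)) \<longlonglongrightarrow> 0" by blast
  have dist: "sqrt (sqdist (u n) (u m)) \<le> 2 * (1/2) ^ n" if "n \<le> m" for n m
  proof -
    have "sqrt (sqdist (u n) (u m)) \<le> 1 * (1/2) ^ n / (1 - 1/2)"
    proof (rule geometric_chain_le[OF _ _ _ _ _ that])
      show "sqrt (sqdist (u n) (u n)) = 0" by (simp add: ip_def bil_def)
      fix m assume "n \<le> m"
      have "sqrt (sqdist (u m) (u (Suc m))) \<le> sqrt (((1/2) ^ m)\<^sup>2)"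
        using rate[of m] by (intro real_sqrt_le_mono) (simp add: power2_eq_square flip: power_mult_distrib)
      then show "sqrt (sqdist (u n) (u (Suc m))) \<le>
          sqrt (sqdist (u n) (u m)) + 1 * (1/2) ^ m"
        using ip_triangle[OF u u u, of n "Suc m" m] by simp
    qed auto
    then show ?thesis by simp
  qed
  have le: "(\<integral>\<^sup>+x. ennreal (qdist V (K x) (u n x) (v x)) \<partial>M) \<le> ennreal ((2 * (1/2) ^ n)\<^sup>2)" for n
  proof -
    have lim: "AE x in M. liminf (\<lambda>m. ennreal (qdist V (K x) (u n x) (u m x))) = ennreal (qdist V (K x) (u n x) (v x))"
      using G(2)
    proof eventually_elim
      case (elim x)
      have psd: "psd_matrix V (K x)" using G(3)[OF elim] by blast
      let ?d = "\<lambda>s t. sqrt (qdist V (K x) s t)"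
      have "(\<lambda>m. ?d (u n x) (u m x) - ?d (u n x) (v x)) \<longlonglongrightarrow> 0"
      proof (rule Lim_null_comparison)
        show "\<forall>\<^sub>F m in sequentially. norm (?d (u n x) (u m x) - ?d (u n x) (v x)) \<le> ?d (u m x) (v x)"
        proof (intro always_eventually allI)
          fix m
          have "?d (v x) (u m x) = ?d (u m x) (v x)" using qdist_commute[of V "K x" "v x" "u m x"] by simp
          then show "norm (?d (u n x) (u m x) - ?d (u n x) (v x)) \<le> ?d (u m x) (v x)"
            using qdist_triangle[OF psd, of "u n x" "v x" "u m x"] qdist_triangle[OF psd, of "u n x" "u m x" "v x"]
            by (simp add: abs_le_iff)
        qed
        show "(\<lambda>m. ?d (u m x) (v x)) \<longlonglongrightarrow> 0"
          using tendsto_real_sqrt[OF vlim[of x]] K'[OF elim] by simp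
      qed
      then have "(\<lambda>m. ?d (u n x) (u m x)) \<longlonglongrightarrow> ?d (u n x) (v x)" by (simp add: LIM_zero_iff)
      then have "(\<lambda>m. (?d (u n x) (u m x))\<^sup>2) \<longlonglongrightarrow> (?d (u n x) (v x))\<^sup>2" by (rule tendsto_power)
      moreover have "(?d s t)\<^sup>2 = qdist V (K x) s t" for s t
        using psd by (simp add: psd_matrix_def)
      ultimately have "(\<lambda>m. ennreal (qdist V (K x) (u n x) (u m x))) \<longlonglongrightarrow> ennreal (qdist V (K x) (u n x) (v x))"
        by (intro tendsto_ennrealI) simp
      then show ?case by (intro lim_imp_Liminf) auto
    qed
    have "(\<integral>\<^sup>+x. ennreal (qdist V (K x) (u n x) (v x)) \<partial>M)
        = (\<integral>\<^sup>+x. liminf (\<lambda>m. ennreal (qdist V (K x) (u n x) (u m x))) \<partial>M)"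
      using lim by (intro nn_integral_cong_AE) (auto elim: eventually_mono)
    also have "\<dots> \<le> liminf (\<lambda>m. \<integral>\<^sup>+x. ennreal (qdist V (K x) (u n x) (u m x)) \<partial>M)"
      using L2_measurable[OF L2_diff[OF u u]] unfolding quad_bil
      by (intro nn_integral_liminf measurable_compose[OF _ measurable_ennreal] bil_measurable) auto
    also have "\<dots> \<le> ennreal ((2 * (1/2) ^ n)\<^sup>2)"
    proof (rule Liminf_le)
      show "\<forall>\<^sub>F m in sequentially. (\<integral>\<^sup>+x. ennreal (qdist V (K x) (u n x) (u m x)) \<partial>M) \<le> ennreal ((2 * (1/2) ^ n)\<^sup>2)"
        unfolding eventually_sequentially
      proof (intro exI allI impI)
        fix m assume "n \<le> m"
        have "(\<integral>\<^sup>+x. ennreal (qdist V (K x) (u n x) (u m x)) \<partial>M) = ennreal (sqdist (u n) (u m))"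
          unfolding ip_def quad_bil
        proof (rule nn_integral_eq_integral[OF L2_integrable[OF L2_diff[OF u u]]])
          show "AE x in M. 0 \<le> bil V (K x) (\<lambda>p. u n x p - u m x p) (\<lambda>p. u n x p - u m x p)"
            using K_psd by eventually_elim (simp add: psd_matrix_def quad_bil)
        qed
        moreover have "sqdist (u n) (u m) \<le> (2 * (1/2) ^ n)\<^sup>2"
          using dist[OF \<open>n \<le> m\<close>] by (rule sqrt_le_D)
        ultimately show "(\<integral>\<^sup>+x. ennreal (qdist V (K x) (u n x) (u m x)) \<partial>M) \<le> ennreal ((2 * (1/2) ^ n)\<^sup>2)"
          by (simp add: ennreal_leI)
      qed
    qed simp
    finally show ?thesis .
  qed
  have diffL: "(\<lambda>x p. u n x p - v x p) \<in> L2" for n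
  proof -
    have m: "(\<lambda>x. u n x p - v x p) \<in> borel_measurable M" if "p \<in> V" for p
      by (intro borel_measurable_diff L2_measurable[OF u] vm that)
    have "integrable M (\<lambda>x. qdist V (K x) (u n x) (v x))"
    proof (rule integrableI_nonneg)
      show "(\<lambda>x. qdist V (K x) (u n x) (v x)) \<in> borel_measurable M"
        unfolding quad_bil by (intro bil_measurable m)
      show "AE x in M. 0 \<le> qdist V (K x) (u n x) (v x)"
        using K_psd by eventually_elim (simp add: psd_matrix_def)
      show "(\<integral>\<^sup>+x. ennreal (qdist V (K x) (u n x) (v x)) \<partial>M) < \<infinity>"
        using le[of n] by (simp add: order_le_less_trans)
    qed
    then show ?thesis using m by (simp add: L2_def)
  qed
  have "v = (\<lambda>x p. u 0 x p - (u 0 x p - v x p))" by simp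
  then have vL: "v \<in> L2" using L2_diff[OF u diffL, of 0 0] by simp
  have ub: "sqdist (u n) v \<le> (2 * (1/2) ^ n)\<^sup>2" for n
  proof -
    have "(\<integral>\<^sup>+x. ennreal (qdist V (K x) (u n x) (v x)) \<partial>M) = ennreal (sqdist (u n) v)"
      unfolding ip_def quad_bil
    proof (rule nn_integral_eq_integral[OF L2_integrable[OF diffL]])
      show "AE x in M. 0 \<le> bil V (K x) (\<lambda>p. u n x p - v x p) (\<lambda>p. u n x p - v x p)"
        using K_psd by eventually_elim (simp add: psd_matrix_def quad_bil)
    qed
    then have "ennreal (sqdist (u n) v) \<le> ennreal ((2 * (1/2) ^ n)\<^sup>2)"
      using le[of n] by (simp only:)
    then show ?thesis by (subst (asm) ennreal_le_iff) simp_all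
  qed
  have "(\<lambda>n. (2 * (1/2 :: real) ^ n)\<^sup>2) \<longlonglongrightarrow> (2 * 0)\<^sup>2"
    by (intro tendsto_intros LIMSEQ_realpow_zero) auto
  then have lim0: "(\<lambda>n. (2 * (1/2 :: real) ^ n)\<^sup>2) \<longlonglongrightarrow> 0" by (simp only: mult_zero_right zero_power2)
  have "(\<lambda>n. sqdist (u n) v) \<longlonglongrightarrow> 0"
    by (rule tendsto_sandwich[OF always_eventually always_eventually tendsto_const lim0])
      (intro allI S.B_nonneg[OF diffL] ub)+
  then show ?thesis using vL by blast
qed

end

section \<open>The matrix field\<close>

context kusuoka_form
begin

abbreviation "kus \<equiv> kusuoka X h"

abbreviation "H p \<equiv> harm_ext X (indicator {p})"

lemma H_harmonic: "harmonic X (H p)" and H_edom: "H p \<in> edom X"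
  by (rule harm_ext(1), rule harm_ext_edom)

lemma Zcell_eq: "a \<in> idx X \<Longrightarrow> Zcell X h a p q = cE a (H p) (H q) / nu a"
  by (simp add: Zcell_def Mmap_Dmat_Mmap nu_def)

text \<open>At a vertex no cell qualifies, and a cell of measure zero contributes \<open>x / 0 = 0\<close>, which agrees with
the dummy value.\<close>

lemma Zlev_eq: "Zlev X h n x p q = (\<Sum>a\<in>lev X n. indicator (open_cell a) x * (cE a (H p) (H q) / nu a))"
proof -
  let ?P = "\<lambda>a. a \<in> lev X n \<and> measure kus (cell X a) \<noteq> 0 \<and> x \<in> cell X a - vert X a"
  have P: "?P a \<longleftrightarrow> a \<in> lev X n \<and> nu a \<noteq> 0 \<and> x \<in> open_cell a" for a
    by (simp add: nu_def open_cell_def)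
  show ?thesis
  proof (cases "\<exists>a. ?P a")
    case True
    then obtain a where a: "a \<in> lev X n" "nu a \<noteq> 0" "x \<in> open_cell a" using P by blast
    have uniq: "b = a" if "b \<in> lev X n" "x \<in> open_cell b" for b
      using open_cell_disjoint[OF that(1) a(1)] that(2) a(3) by blast
    have "(THE a. ?P a) = a"
    proof (rule the_equality)
      show "?P a" using a P[of a] by blast
      show "b = a" if "?P b" for b using uniq[of b] P[of b] that by blast
    qed
    then have "Zlev X h n x p q = Zcell X h a p q" unfolding Zlev_def Let_def if_P[OF True] by (simp only:)
    also have "\<dots> = (\<Sum>b\<in>lev X n. if b = a then cE b (H p) (H q) / nu b else 0)"
      using a(1) finite_lev by (simp add: Zcell_eq[OF lev_idx[OF a(1)]])
    also have "\<dots> = (\<Sum>a\<in>lev X n. indicator (open_cell a) x * (cE a (H p) (H q) / nu a))"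
    proof (rule sum.cong[OF refl])
      fix b assume b: "b \<in> lev X n"
      show "(if b = a then cE b (H p) (H q) / nu b else 0) = indicator (open_cell b) x * (cE b (H p) (H q) / nu b)"
      proof (cases "b = a")
        case False
        then have "x \<notin> open_cell b" using uniq[OF b] by blast
        then show ?thesis using False by simp
      qed (use a(3) in simp)
    qed
    finally show ?thesis .
  next
    case False
    then have "Zlev X h n x p q = 0" unfolding Zlev_def Let_def by (simp only: if_False)
    moreover have "indicator (open_cell a) x * (cE a (H p) (H q) / nu a) = 0" if "a \<in> lev X n" for a
      using False P[of a] that by (auto simp: indicator_def)
    ultimately show ?thesis by (simp only: sum.neutral[OF ballI])
  qed
qed

lemma Zlev_sym: "Zlev X h n x p q = Zlev X h n x q p"
  unfolding Zlev_eq
  using semi_inner_space.B_sym[OF cE_semi_inner[OF lev_idx] H_edom H_edom, of _ n p q]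
  by (intro sum.cong refl) simp

lemma Zlim_sym: "Zlim X h x p q = Zlim X h x q p"
  unfolding Zlim_def by (simp add: Zlev_sym[of _ x p q])

lemma
  shows Zlim_measurable: "(\<lambda>x. Zlim X h x p q) \<in> borel_measurable kus"
    and Zlim_integrable: "integrable kus (\<lambda>x. Zlim X h x p q)"
    and Zlev_tendsto: "AE x in kus. (\<lambda>n. Zlev X h n x p q) \<longlonglongrightarrow> Zlim X h x p q"
    and integral_Zlim: "a \<in> lev X n \<Longrightarrow> (LINT x|kus. indicator (cell X a) x * Zlim X h x p q) = cE a (H p) (H q)"
proof -
  obtain C where "dominated_cell_function X kus (\<lambda>a. cE a (H p) (H q)) C"
    using ex_dominated_cell_function[OF H_harmonic H_harmonic] by blast
  then interpret D: dominated_cell_function X kus "\<lambda>a. cE a (H p) (H q)" C .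
  have lev: "D.quot_lev n x = Zlev X h n x p q" for n x
    by (simp add: D.quot_lev_def D.quot_def Zlev_eq)
  have lim: "D.density x = Zlim X h x p q" for x
    by (simp add: D.density_def Zlim_def lev)
  show "(\<lambda>x. Zlim X h x p q) \<in> borel_measurable kus" using D.density_measurable lim[abs_def] by simp
  show "integrable kus (\<lambda>x. Zlim X h x p q)" using D.density_integrable lim[abs_def] by simp
  show "AE x in kus. (\<lambda>n. Zlev X h n x p q) \<longlonglongrightarrow> Zlim X h x p q" using D.quot_lev_tendsto by (simp add: lev lim)
  show "a \<in> lev X n \<Longrightarrow> (LINT x|kus. indicator (cell X a) x * Zlim X h x p q) = cE a (H p) (H q)"
    using D.integral_density by (simp add: lim)
qed

lemma quad_Zlev_nonneg: "0 \<le> quad (Vlev X 0) (Zlev X h n x) t"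
proof -
  have "quad (Vlev X 0) (Zlev X h n x) t =
      (\<Sum>p\<in>Vlev X 0. \<Sum>q\<in>Vlev X 0. \<Sum>a\<in>lev X n. indicator (open_cell a) x * (t p * cE a (H p) (H q) * t q) / nu a)"
    unfolding quad_def Zlev_eq by (simp add: sum_distrib_left sum_distrib_right mult_ac)
  also have "\<dots> = (\<Sum>p\<in>Vlev X 0. \<Sum>a\<in>lev X n. \<Sum>q\<in>Vlev X 0. indicator (open_cell a) x * (t p * cE a (H p) (H q) * t q) / nu a)"
    by (intro sum.cong refl sum.swap)
  also have "\<dots> = (\<Sum>a\<in>lev X n. \<Sum>p\<in>Vlev X 0. \<Sum>q\<in>Vlev X 0. indicator (open_cell a) x * (t p * cE a (H p) (H q) * t q) / nu a)"
    by (rule sum.swap)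
  also have "\<dots> = (\<Sum>a\<in>lev X n. indicator (open_cell a) x * cE a (harm_ext X t) (harm_ext X t) / nu a)"
    by (intro sum.cong refl) (simp add: cE_harm_ext[OF lev_idx] quad_def sum_distrib_left sum_divide_distrib)
  also have "\<dots> \<ge> 0"
    using nu_nonneg cE_nonneg[OF lev_idx harm_ext_edom] by (intro sum_nonneg divide_nonneg_nonneg mult_nonneg_nonneg) auto
  finally show ?thesis .
qed

lemma Zlim_psd: "AE x in kus. psd_matrix (Vlev X 0) (Zlim X h x)"
proof -
  have "AE x in kus. \<forall>p\<in>Vlev X 0. \<forall>q\<in>Vlev X 0. (\<lambda>n. Zlev X h n x p q) \<longlonglongrightarrow> Zlim X h x p q"
    using Zlev_tendsto finite_Vlev by (intro AE_finite_allI)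
  then show ?thesis
  proof eventually_elim
    case (elim x)
    have "0 \<le> quad (Vlev X 0) (Zlim X h x) t" for t
    proof (rule LIMSEQ_le_const)
      show "(\<lambda>n. quad (Vlev X 0) (Zlev X h n x) t) \<longlonglongrightarrow> quad (Vlev X 0) (Zlim X h x) t"
        unfolding quad_def by (intro tendsto_intros) (use elim in blast)
    qed (use quad_Zlev_nonneg in blast)
    then show ?case using Zlim_sym by (auto simp: psd_matrix_def)
  qed
qed

sublocale F: psd_field "completion kus" "Vlev X 0" "Zlim X h"
proof
  show "finite (Vlev X 0)" by (rule finite_Vlev)
  show "(\<lambda>x. Zlim X h x p q) \<in> borel_measurable (completion kus)" for p q
    by (rule measurable_completion[OF Zlim_measurable])
  show "AE x in completion kus. psd_matrix (Vlev X 0) (Zlim X h x)"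
    by (rule AE_completion[OF Zlim_psd])
qed

text \<open>The entries of the matrix field integrate to the mutual energies of the harmonic functions \<open>H p\<close>,
which span the harmonic functions.\<close>

lemma integral_quad_Zlim:
  assumes a: "a \<in> lev X n"
  shows "integrable (completion kus) (\<lambda>x. indicator (cell X a) x * quad (Vlev X 0) (Zlim X h x) t)"
    and "(LINT x|completion kus. indicator (cell X a) x * quad (Vlev X 0) (Zlim X h x) t) = cE a (harm_ext X t) (harm_ext X t)"
proof -
  let ?f = "\<lambda>x. \<Sum>p\<in>Vlev X 0. \<Sum>q\<in>Vlev X 0. t p * t q * (indicator (cell X a) x * Zlim X h x p q)"
  have eq: "indicator (cell X a) x * quad (Vlev X 0) (Zlim X h x) t = ?f x" for x
    by (simp add: quad_def sum_distrib_left mult_ac)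
  have int: "integrable kus (\<lambda>x. indicator (cell X a) x * Zlim X h x p q)" for p q
    using integrable_mult_indicator[OF cell_in_sets[OF lev_idx[OF a]] Zlim_integrable] by simp
  have int': "integrable kus ?f"
    by (intro Bochner_Integration.integrable_sum integrable_mult_right int)
  then show "integrable (completion kus) (\<lambda>x. indicator (cell X a) x * quad (Vlev X 0) (Zlim X h x) t)"
    unfolding eq by (subst integrable_completion) auto
  have "(LINT x|completion kus. ?f x) = (LINT x|kus. ?f x)"
    using int' by (intro integral_completion) auto
  also have "\<dots> = (\<Sum>p\<in>Vlev X 0. \<Sum>q\<in>Vlev X 0. t p * t q * cE a (H p) (H q))"
    using int by (simp add: integral_Zlim[OF a])
  also have "\<dots> = cE a (harm_ext X t) (harm_ext X t)"
    by (simp add: cE_harm_ext[OF lev_idx[OF a]] quad_def mult_ac)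
  finally show "(LINT x|completion kus. indicator (cell X a) x * quad (Vlev X 0) (Zlim X h x) t) = cE a (harm_ext X t) (harm_ext X t)"
    unfolding eq .
qed

end

section \<open>Gradients of piecewise harmonic functions\<close>

context kusuoka_form
begin

abbreviation "sqE f \<equiv> energy X f f"
abbreviation "sqL u \<equiv> F.ip u u"

lemma L2Z_fun_iff: "u \<in> L2Z_fun X h \<longleftrightarrow> u \<in> F.L2 \<and> (\<forall>x\<in>carr X. u x \<in> ell (Vlev X 0))"
  by (auto simp: L2Z_fun_def F.L2_def)

lemma L2Z_fun_L2: "u \<in> L2Z_fun X h \<Longrightarrow> u \<in> F.L2"
  by (simp add: L2Z_fun_iff)

lemma L2Z_seminorm_eq: "L2Z_seminorm X h u = sqrt (sqL u)"
  by (simp add: L2Z_seminorm_def F.ip_def quad_bil)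

lemma L2Z_fun_add_scaled:
  "u \<in> L2Z_fun X h \<Longrightarrow> v \<in> L2Z_fun X h \<Longrightarrow> (\<lambda>x p. u x p + c * v x p) \<in> L2Z_fun X h"
  unfolding L2Z_fun_iff using F.S.ad_in[OF _ F.S.sc_in] by (auto simp: ell_def)

lemma zero_L2Z_fun: "(\<lambda>x p. 0) \<in> L2Z_fun X h"
  by (simp add: L2Z_fun_iff F.L2_def quad_def ell_def)

lemma zero_edom: "(\<lambda>x. 0) \<in> edom X"
  using form.dom_const[of 0] by (simp add: restr_def)

lemma edom_add_scaled: "f \<in> edom X \<Longrightarrow> g \<in> edom X \<Longrightarrow> (\<lambda>x. f x + c * g x) \<in> edom X"
  by (intro form.dom_add form.dom_scale)

text \<open>The field \<open>u\<close> consists of boundary values of harmonic functions that coincide with \<open>f\<close> on the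
  cells of level \<open>n\<close>. They need not be the minimal ones of \<open>Tan\<close>: the boundary
  values of harmonic functions that coincide on a cell differ by a null vector of the matrix field
  there. This freedom makes the relation linear.\<close>

definition tangent_field :: "nat \<Rightarrow> ('a \<Rightarrow> real) \<Rightarrow> ('a \<Rightarrow> 'a \<Rightarrow> real) \<Rightarrow> bool" where
  "tangent_field n f u \<longleftrightarrow> f \<in> edom X \<and> u \<in> L2Z_fun X h \<and>
     (\<exists>t. (\<forall>a\<in>lev X n. t a \<in> ell (Vlev X 0) \<and> coincide_on_cell X a (harm_ext X (t a)) f) \<and>
       (AE x in kus. \<forall>a\<in>lev X n. x \<in> cell X a \<longrightarrow> u x = t a))"

lemma harm_ext_add_scaled: "harm_ext X (\<lambda>p. s p + c * t p) = (\<lambda>x. harm_ext X s x + c * harm_ext X t x)"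
  by (rule harmonic_unique[OF harm_ext(1) harmonic_add[OF harm_ext(1) harmonic_scale[OF harm_ext(1)]]])
    (simp add: harm_ext(2))

text \<open>A subcell inherits the boundary values from the cell that contains it.\<close>

lemma tangent_field_Suc:
  assumes "tangent_field n f u"
  shows "tangent_field (Suc n) f u"
proof -
  obtain t where t: "\<forall>a\<in>lev X n. t a \<in> ell (Vlev X 0) \<and> coincide_on_cell X a (harm_ext X (t a)) f"
    "AE x in kus. \<forall>a\<in>lev X n. x \<in> cell X a \<longrightarrow> u x = t a"
    and fu: "f \<in> edom X" "u \<in> L2Z_fun X h"
    using assms unfolding tangent_field_def by auto
  have "\<forall>b\<in>lev X (Suc n). \<exists>a. a \<in> lev X n \<and> cell X b \<subseteq> cell X a" using ex_parent_Suc by blast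
  then obtain P where P: "\<And>b. b \<in> lev X (Suc n) \<Longrightarrow> P b \<in> lev X n \<and> cell X b \<subseteq> cell X (P b)"
    unfolding bchoice_iff by auto
  have "\<forall>b\<in>lev X (Suc n). t (P b) \<in> ell (Vlev X 0) \<and> coincide_on_cell X b (harm_ext X (t (P b))) f"
    using t(1) P unfolding coincide_on_cell_def by blast
  moreover have "AE x in kus. \<forall>b\<in>lev X (Suc n). x \<in> cell X b \<longrightarrow> u x = t (P b)"
    using t(2) by eventually_elim (use P in blast)
  ultimately show ?thesis
    unfolding tangent_field_def using fu by (intro conjI exI[of _ "\<lambda>b. t (P b)"])
qed

lemma tangent_field_mono:
  assumes "tangent_field n f u" "n \<le> m"
  shows "tangent_field m f u"
  using assms(2) by (induction m rule: dec_induct) (auto intro: assms(1) tangent_field_Suc)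

definition tangent :: "('a \<Rightarrow> real) \<Rightarrow> ('a \<Rightarrow> 'a \<Rightarrow> real) \<Rightarrow> bool" where
  "tangent f u \<longleftrightarrow> (\<exists>n. tangent_field n f u)"

lemma tangent_edom: "tangent f u \<Longrightarrow> f \<in> edom X"
  and tangent_L2Z: "tangent f u \<Longrightarrow> u \<in> L2Z_fun X h"
  by (auto simp: tangent_def tangent_field_def)

lemma tangent_add_scaled:
  assumes "tangent f u" "tangent g v"
  shows "tangent (\<lambda>x. f x + c * g x) (\<lambda>x p. u x p + c * v x p)"
proof -
  obtain m n where "tangent_field m f u" "tangent_field n g v" using assms by (auto simp: tangent_def)
  then have fu: "tangent_field (max m n) f u" and gv: "tangent_field (max m n) g v"
    by (auto elim: tangent_field_mono)
  obtain t where t: "\<forall>a\<in>lev X (max m n). t a \<in> ell (Vlev X 0) \<and> coincide_on_cell X a (harm_ext X (t a)) f"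
    "AE x in kus. \<forall>a\<in>lev X (max m n). x \<in> cell X a \<longrightarrow> u x = t a"
    using fu unfolding tangent_field_def by auto
  obtain s where s: "\<forall>a\<in>lev X (max m n). s a \<in> ell (Vlev X 0) \<and> coincide_on_cell X a (harm_ext X (s a)) g"
    "AE x in kus. \<forall>a\<in>lev X (max m n). x \<in> cell X a \<longrightarrow> v x = s a"
    using gv unfolding tangent_field_def by auto
  have "\<forall>a\<in>lev X (max m n). (\<lambda>p. t a p + c * s a p) \<in> ell (Vlev X 0) \<and>
      coincide_on_cell X a (harm_ext X (\<lambda>p. t a p + c * s a p)) (\<lambda>x. f x + c * g x)"
    using t(1) s(1) by (auto simp: ell_def coincide_on_cell_def harm_ext_add_scaled)
  moreover have "AE x in kus. \<forall>a\<in>lev X (max m n). x \<in> cell X a \<longrightarrow> (\<lambda>p. u x p + c * v x p) = (\<lambda>p. t a p + c * s a p)"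
    using t(2) s(2) by eventually_elim auto
  ultimately show ?thesis
    unfolding tangent_def tangent_field_def
    using tangent_edom[OF assms(1)] tangent_edom[OF assms(2)] tangent_L2Z[OF assms(1)] tangent_L2Z[OF assms(2)]
    by (intro exI[of _ "max m n"] conjI edom_add_scaled L2Z_fun_add_scaled exI[of _ "\<lambda>a p. t a p + c * s a p"])
qed

lemma tangent_diff:
  "tangent f u \<Longrightarrow> tangent g v \<Longrightarrow> tangent (\<lambda>x. f x - g x) (\<lambda>x p. u x p - v x p)"
  using tangent_add_scaled[of f u g v "-1"] by simp

lemma sum_indicator_cell:
  fixes c :: "'i \<Rightarrow> real"
  assumes a: "a \<in> lev X n" "x \<in> cell X a" "x \<notin> Vlev X n"
  shows "(\<Sum>b\<in>lev X n. indicator (cell X b) x * c b) = c a"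
proof -
  have "(\<Sum>b\<in>lev X n. indicator (cell X b) x * c b) = (\<Sum>b\<in>lev X n. if b = a then c b else 0)"
  proof (rule sum.cong[OF refl])
    fix b assume b: "b \<in> lev X n"
    show "indicator (cell X b) x * c b = (if b = a then c b else 0)"
    proof (cases "b = a")
      case False
      then have "x \<notin> cell X b" using cell_unique[OF b a(1) _ a(2,3)] by blast
      then show ?thesis using False by simp
    qed (use a(2) in simp)
  qed
  then show ?thesis using a(1) finite_lev by simp
qed

lemma AE_quad_eq_sum:
  assumes "AE x in kus. \<forall>a\<in>lev X n. x \<in> cell X a \<longrightarrow> u x = t a"
  shows "AE x in completion kus. quad (Vlev X 0) (Zlim X h x) (u x) =
    (\<Sum>a\<in>lev X n. indicator (cell X a) x * quad (Vlev X 0) (Zlim X h x) (t a))"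
  using AE_completion[OF assms] AE_completion[OF AE_not_Vstar] AE_completion[OF AE_space]
proof eventually_elim
  case (elim x)
  obtain a where a: "a \<in> lev X n" "x \<in> cell X a" using ex_cell elim(3) space_N by blast
  have xV: "x \<notin> Vlev X n" using elim(2) Vlev_Vstar by blast
  then show ?case using sum_indicator_cell[OF a xV] elim(1) a by simp
qed

lemma tangent_isometric:
  assumes "tangent f u"
  shows "sqL u = sqE f"
proof -
  obtain n t where t: "\<forall>a\<in>lev X n. t a \<in> ell (Vlev X 0) \<and> coincide_on_cell X a (harm_ext X (t a)) f"
    "AE x in kus. \<forall>a\<in>lev X n. x \<in> cell X a \<longrightarrow> u x = t a"
    using assms unfolding tangent_def tangent_field_def by auto
  have u: "u \<in> F.L2" by (rule L2Z_fun_L2[OF tangent_L2Z[OF assms]])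
  have int: "integrable (completion kus) (\<lambda>x. indicator (cell X a) x * quad (Vlev X 0) (Zlim X h x) (t a))"
    if "a \<in> lev X n" for a by (rule integral_quad_Zlim[OF that])
  have "sqL u = (LINT x|completion kus. (\<Sum>a\<in>lev X n. indicator (cell X a) x * quad (Vlev X 0) (Zlim X h x) (t a)))"
    unfolding F.ip_def quad_bil[symmetric]
  proof (rule integral_cong_AE[OF _ _ AE_quad_eq_sum[OF t(2)]])
    show "(\<lambda>x. quad (Vlev X 0) (Zlim X h x) (u x)) \<in> borel_measurable (completion kus)"
      using F.L2_integrable[OF u] unfolding quad_bil by (rule borel_measurable_integrable)
    show "(\<lambda>x. \<Sum>a\<in>lev X n. indicator (cell X a) x * quad (Vlev X 0) (Zlim X h x) (t a)) \<in> borel_measurable (completion kus)"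
      by (intro borel_measurable_sum borel_measurable_integrable int)
  qed
  also have "\<dots> = (\<Sum>a\<in>lev X n. cE a (harm_ext X (t a)) (harm_ext X (t a)))"
    using int by (simp add: Bochner_Integration.integral_sum integral_quad_Zlim(2))
  also have "\<dots> = (\<Sum>a\<in>lev X n. cE a f f)"
    by (intro sum.cong refl cE_cong) (use t(1) in blast)
  also have "\<dots> = sqE f" by (rule energy_eq_sum[OF tangent_edom[OF assms], symmetric])
  finally show ?thesis .
qed

lemma ex_tangent_field:
  assumes f: "f \<in> edom X"
    and t: "\<And>a. a \<in> lev X n \<Longrightarrow> t a \<in> ell (Vlev X 0) \<and> coincide_on_cell X a (harm_ext X (t a)) f"
  shows "\<exists>u. tangent_field n f u \<and> (AE x in kus. \<forall>a\<in>lev X n. x \<in> cell X a \<longrightarrow> u x = t a)"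
proof -
  define u where "u x p = (\<Sum>a\<in>lev X n. indicator (cell X a) x * t a p)" for x p
  have ae: "AE x in kus. \<forall>a\<in>lev X n. x \<in> cell X a \<longrightarrow> u x = t a"
    using AE_not_Vstar
  proof eventually_elim
    case (elim x)
    show ?case
    proof (intro ballI impI ext)
      fix a p assume a: "a \<in> lev X n" "x \<in> cell X a"
      have xV: "x \<notin> Vlev X n" using elim Vlev_Vstar by blast
      show "u x p = t a p" unfolding u_def by (rule sum_indicator_cell[OF a xV])
    qed
  qed
  have m: "(\<lambda>x. u x p) \<in> borel_measurable (completion kus)" for p
    unfolding u_def using cell_in_sets[OF lev_idx]
    by (intro measurable_completion borel_measurable_sum borel_measurable_times borel_measurable_indicator) auto
  have "integrable (completion kus) (\<lambda>x. \<Sum>a\<in>lev X n. indicator (cell X a) x * quad (Vlev X 0) (Zlim X h x) (t a))"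
    by (intro Bochner_Integration.integrable_sum integral_quad_Zlim(1))
  moreover have "(\<lambda>x. quad (Vlev X 0) (Zlim X h x) (u x)) \<in> borel_measurable (completion kus)"
    unfolding quad_bil by (intro F.bil_measurable m)
  ultimately have "integrable (completion kus) (\<lambda>x. quad (Vlev X 0) (Zlim X h x) (u x))"
    using AE_quad_eq_sum[OF ae] by (subst integrable_cong_AE) auto
  then have "u \<in> F.L2" using m by (simp add: F.L2_def)
  moreover have "u x \<in> ell (Vlev X 0)" for x using t by (auto simp: u_def ell_def intro!: sum.neutral)
  ultimately have "u \<in> L2Z_fun X h" by (simp add: L2Z_fun_iff)
  then have "tangent_field n f u"
    unfolding tangent_field_def using f ae by (intro conjI exI[of _ t] ballI t)
  then show ?thesis using ae by blast
qed

text \<open>The harmonic functions that coincide with \<open>f\<close> on the cell have the form treated in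
\<open>minimizer_exists\<close>, with orthogonality to the functions that vanish on \<open>V\<^sub>0\<close> as the linear
constraints.\<close>

lemma Tan:
  assumes f: "n_piecewise_harmonic X n f" and a: "a \<in> lev X n"
  shows "Tan X a f \<in> ell (Vlev X 0)" "coincide_on_cell X a (harm_ext X (Tan X a f)) f"
proof -
  let ?W = "{w\<in>edom X. \<forall>x\<in>Vlev X 0. w x = 0}" and ?S = "Vstar X \<inter> cell X a"
  let ?C = "{g\<in>edom X. (\<forall>w\<in>?W. energy X g w = 0) \<and> (\<forall>x\<in>?S. g x = f x)}"
  have C: "g \<in> ?C \<longleftrightarrow> harmonic X g \<and> coincide_on_cell X a g f" for g
    unfolding harmonic_iff form.harm_on_def coincide_on_cell_def by auto
  obtain s where s: "s \<in> ?S" using vert_nonempty[OF lev_idx[OF a]] vert_Vstar[OF lev_idx[OF a]] vert_subset_cell[OF lev_idx[OF a]]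
    by blast
  obtain g0 where "harmonic X g0" "coincide_on_cell X a g0 f" using f a unfolding n_piecewise_harmonic_def by blast
  then have "g0 \<in> ?C" using C by blast
  then have "?C \<noteq> {}" by (metis empty_iff)
  then have "\<exists>g\<in>?C. \<forall>g'\<in>?C. energy X g g \<le> energy X g' g'"
    by (intro form.minimizer_exists[OF _ s]) simp_all
  then obtain g where gC: "g \<in> ?C" and gmin: "\<And>g'. g' \<in> ?C \<Longrightarrow> energy X g g \<le> energy X g' g'" by blast
  have g: "harmonic X g" "coincide_on_cell X a g f" using gC C by blast+
  have "\<exists>!t. t \<in> ell (Vlev X 0) \<and> coincide_on_cell X a (harm_ext X t) f \<and>
     (\<forall>g. harmonic X g \<and> coincide_on_cell X a g f \<longrightarrow>
        energy X (harm_ext X t) (harm_ext X t) \<le> energy X g g)" (is "\<exists>!t. ?P t")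
  proof (rule ex1I[of _ "restr (Vlev X 0) g"])
    show "?P (restr (Vlev X 0) g)"
      unfolding harm_ext_restrict[OF g(1)] using g gmin C by (auto simp: ell_def restr_def)
    fix t assume t: "?P t"
    have "harm_ext X t = g"
    proof (rule form.minimizer_unique[of ?S s ?W])
      show "harm_ext X t \<in> ?C" using t C harm_ext(1) by blast
      show "energy X (harm_ext X t) (harm_ext X t) \<le> energy X k k" if "k \<in> ?C" for k
        using t that C by blast
    qed (use s gC gmin in auto)
    then have "t p = g p" if "p \<in> Vlev X 0" for p using harm_ext(2)[OF that, of t] by simp
    then show "t = restr (Vlev X 0) g" using t by (auto simp: ell_def restr_def)
  qed
  from theI'[OF this] show "Tan X a f \<in> ell (Vlev X 0)" "coincide_on_cell X a (harm_ext X (Tan X a f)) f"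
    unfolding Tan_def by blast+
qed

lemma ex_tangent_Tan:
  assumes "n_piecewise_harmonic X n f"
  shows "\<exists>u. tangent f u \<and> (AE x in kus. \<forall>a\<in>lev X n. x \<in> cell X a \<longrightarrow> u x = Tan X a f)"
proof -
  have "f \<in> edom X" using assms by (simp add: n_piecewise_harmonic_def)
  then have "\<exists>u. tangent_field n f u \<and> (AE x in kus. \<forall>a\<in>lev X n. x \<in> cell X a \<longrightarrow> u x = Tan X a f)"
    by (rule ex_tangent_field) (use Tan[OF assms] in blast)
  then show ?thesis unfolding tangent_def by blast
qed

section \<open>The weak gradient\<close>

text \<open>The closure of the relation \<open>tangent\<close>. It is the graph of the weak gradient, up to the choice
  of representatives.\<close>

definition weak_gradient :: "('a \<Rightarrow> real) \<Rightarrow> ('a \<Rightarrow> 'a \<Rightarrow> real) \<Rightarrow> bool" where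
  "weak_gradient f u \<longleftrightarrow> f \<in> edom X \<and> u \<in> L2Z_fun X h \<and>
     (\<forall>e>0. \<exists>g v. tangent g v \<and> form.sqdist f g < e \<and> F.sqdist u v < e)"

lemma weak_gradient_edom: "weak_gradient f u \<Longrightarrow> f \<in> edom X"
  and weak_gradient_L2Z: "weak_gradient f u \<Longrightarrow> u \<in> L2Z_fun X h"
  by (auto simp: weak_gradient_def)

lemma sqE_zero: "sqE (\<lambda>x. 0) = 0"
  using form.B_sc_left[of "\<lambda>x. 0" "\<lambda>x. 0" 0] zero_edom by simp

lemma sqL_zero: "sqL (\<lambda>x p. 0) = 0"
  by (simp add: F.ip_def bil_def)

lemma tangent_imp_weak_gradient: assumes "tangent f u" shows "weak_gradient f u"
  unfolding weak_gradient_def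
proof (intro conjI allI impI)
  fix e :: real assume "e > 0"
  then show "\<exists>g v. tangent g v \<and> form.sqdist f g < e \<and> F.sqdist u v < e"
    using assms sqE_zero sqL_zero by (intro exI[of _ f] exI[of _ u]) simp
qed (use tangent_edom tangent_L2Z assms in blast)+

lemma tangent_zero: "tangent (\<lambda>x. 0) (\<lambda>x p. 0)"
  unfolding tangent_def tangent_field_def
proof (intro exI[of _ 0] conjI exI[of _ "\<lambda>a p. 0"] ballI zero_edom zero_L2Z_fun)
  have "harm_ext X (\<lambda>p. 0) = (\<lambda>x. 0)"
    by (rule harmonic_unique[OF harm_ext(1)]) (use harm_ext harmonic_scale[OF harm_ext(1), of 0] in simp_all)
  then show "coincide_on_cell X a (harm_ext X (\<lambda>p. 0)) (\<lambda>x. 0)" for a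
    by (simp add: coincide_on_cell_def)
qed (auto simp: ell_def)

lemma weak_gradient_add_scaled:
  assumes fu: "weak_gradient f u" and gv: "weak_gradient g v"
  shows "weak_gradient (\<lambda>x. f x + c * g x) (\<lambda>x p. u x p + c * v x p)"
  unfolding weak_gradient_def
proof (intro conjI allI impI)
  note D = weak_gradient_edom[OF fu] weak_gradient_edom[OF gv]
  note L = weak_gradient_L2Z[OF fu] weak_gradient_L2Z[OF gv]
  show "(\<lambda>x. f x + c * g x) \<in> edom X" "(\<lambda>x p. u x p + c * v x p) \<in> L2Z_fun X h"
    by (intro edom_add_scaled L2Z_fun_add_scaled D L)+
  fix e :: real assume e: "e > 0"
  define d where "d = e / (2 * (c\<^sup>2 + 1))"
  have pos: "c\<^sup>2 + 1 > 0" by (simp add: add_nonneg_pos)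
  then have "d > 0" using e by (simp add: d_def)
  then obtain f' u' g' v' where a: "tangent f' u'" "form.sqdist f f' < d" "F.sqdist u u' < d"
    and b: "tangent g' v'" "form.sqdist g g' < d" "F.sqdist v v' < d"
    using fu gv unfolding weak_gradient_def by meson
  note D' = tangent_edom[OF a(1)] tangent_edom[OF b(1)]
  note L' = L2Z_fun_L2[OF tangent_L2Z[OF a(1)]] L2Z_fun_L2[OF tangent_L2Z[OF b(1)]]
  have small: "2 * r + 2 * c\<^sup>2 * s < e" if "r < d" "s < d" for r s
  proof -
    have "c\<^sup>2 * s \<le> c\<^sup>2 * d" using that(2) by (intro mult_left_mono) auto
    moreover have "2 * d + 2 * (c\<^sup>2 * d) = 2 * (c\<^sup>2 + 1) * d" by (simp add: algebra_simps)
    moreover have "2 * (c\<^sup>2 + 1) * d = e" using pos by (simp add: d_def)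
    ultimately show ?thesis using that(1) by linarith
  qed
  have "sqE (\<lambda>x. (f x + c * g x) - (f' x + c * g' x)) = sqE (\<lambda>x. (f x - f' x) + c * (g x - g' x))"
    by (simp add: algebra_simps)
  also have "\<dots> \<le> 2 * form.sqdist f f' + 2 * c\<^sup>2 * form.sqdist g g'"
    by (intro form.B_ad_sc_le form.dom_diff D D')
  also have "\<dots> < e" by (rule small[OF a(2) b(2)])
  finally have 1: "sqE (\<lambda>x. (f x + c * g x) - (f' x + c * g' x)) < e" .
  have "sqL (\<lambda>x p. (u x p + c * v x p) - (u' x p + c * v' x p)) = sqL (\<lambda>x p. (u x p - u' x p) + c * (v x p - v' x p))"
    by (simp add: algebra_simps)
  also have "\<dots> \<le> 2 * F.sqdist u u' + 2 * c\<^sup>2 * F.sqdist v v'"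
    by (intro F.S.B_ad_sc_le F.L2_diff L2Z_fun_L2 L L')
  also have "\<dots> < e" by (rule small[OF a(3) b(3)])
  finally show "\<exists>k w. tangent k w \<and> sqE (\<lambda>x. f x + c * g x - k x) < e \<and> sqL (\<lambda>x p. u x p + c * v x p - w x p) < e"
    using 1 tangent_add_scaled[OF a(1) b(1), of c] by (intro exI conjI)
qed

lemma weak_gradient_add:
  "weak_gradient f u \<Longrightarrow> weak_gradient g v \<Longrightarrow> weak_gradient (\<lambda>x. f x + g x) (\<lambda>x p. u x p + v x p)"
  using weak_gradient_add_scaled[of f u g v 1] by simp

lemma weak_gradient_scale: "weak_gradient f u \<Longrightarrow> weak_gradient (\<lambda>x. c * f x) (\<lambda>x p. c * u x p)"
  using weak_gradient_add_scaled[OF tangent_imp_weak_gradient[OF tangent_zero], of f u c] by simp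

lemma sqL_diff_commute: "F.sqdist v u = F.sqdist u v"
  unfolding F.ip_def quad_bil[symmetric] by (simp add: qdist_commute[of _ _ "v x" "u x" for x])

lemma weak_gradient_isometric:
  assumes fu: "weak_gradient f u"
  shows "sqL u = sqE f"
proof -
  note D = weak_gradient_edom[OF fu] and L = L2Z_fun_L2[OF weak_gradient_L2Z[OF fu]]
  have "\<bar>sqrt (sqL u) - sqrt (sqE f)\<bar> \<le> 0 + e" if e: "e > 0" for e
  proof -
    have "(e/2)\<^sup>2 > 0" using e by simp
    then obtain g v where gv: "tangent g v" "form.sqdist f g < (e/2)\<^sup>2" "F.sqdist u v < (e/2)\<^sup>2"
      using fu unfolding weak_gradient_def by meson
    note D' = tangent_edom[OF gv(1)] and L' = L2Z_fun_L2[OF tangent_L2Z[OF gv(1)]]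
    have f1: "sqrt (form.sqdist f g) \<le> e/2" and u1: "sqrt (F.sqdist u v) \<le> e/2"
      using gv(2,3) e by (intro real_le_lsqrt; simp)+
    have "sqrt (form.sqdist g f) = sqrt (form.sqdist f g)"
      using form.En_diff[OF D D'] form.En_diff[OF D' D] form.En_sym[OF D D'] by simp
    moreover have "sqrt (sqE f) \<le> sqrt (form.sqdist f g) + sqrt (sqE g)"
      using form.sqrt_B_triangle[OF form.dom_diff[OF D D'] D'] by simp
    moreover have "sqrt (sqE g) \<le> sqrt (form.sqdist g f) + sqrt (sqE f)"
      using form.sqrt_B_triangle[OF form.dom_diff[OF D' D] D] by simp
    ultimately have 1: "\<bar>sqrt (sqE f) - sqrt (sqE g)\<bar> \<le> e/2" using f1 by linarith
    have "sqrt (F.sqdist v u) = sqrt (F.sqdist u v)"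
      by (simp add: sqL_diff_commute[of v u])
    moreover have "sqrt (sqL u) \<le> sqrt (F.sqdist u v) + sqrt (sqL v)"
      using F.S.sqrt_B_triangle[OF F.L2_diff[OF L L'] L'] by simp
    moreover have "sqrt (sqL v) \<le> sqrt (F.sqdist v u) + sqrt (sqL u)"
      using F.S.sqrt_B_triangle[OF F.L2_diff[OF L' L] L] by simp
    ultimately have 2: "\<bar>sqrt (sqL u) - sqrt (sqL v)\<bar> \<le> e/2" using u1 by linarith
    show ?thesis using 1 2 unfolding tangent_isometric[OF gv(1)] by linarith
  qed
  then have "\<bar>sqrt (sqL u) - sqrt (sqE f)\<bar> \<le> 0" by (rule field_le_epsilon)
  then show ?thesis by simp
qed

lemma weak_gradient_unique:
  assumes "weak_gradient f u" "weak_gradient f v"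
  shows "F.sqdist u v = 0"
proof -
  have "weak_gradient (\<lambda>x. 0) (\<lambda>x p. u x p - v x p)"
    using weak_gradient_add_scaled[OF assms, of "-1"] by simp
  then show ?thesis using weak_gradient_isometric sqE_zero by simp
qed

lemma weak_gradient_null:
  assumes fu: "weak_gradient f u" and v: "v \<in> L2Z_fun X h" and null: "F.sqdist u v = 0"
  shows "weak_gradient f v"
  unfolding weak_gradient_def
proof (intro conjI allI impI weak_gradient_edom[OF fu] v)
  fix e :: real assume "e > 0"
  then have "e / 2 > 0" by simp
  then obtain g w where gw: "tangent g w" "form.sqdist f g < e / 2" "F.sqdist u w < e / 2"
    using fu unfolding weak_gradient_def by meson
  note L = L2Z_fun_L2[OF v] L2Z_fun_L2[OF weak_gradient_L2Z[OF fu]] L2Z_fun_L2[OF tangent_L2Z[OF gw(1)]]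
  have "F.sqdist v w = sqL (\<lambda>x p. (v x p - u x p) + (u x p - w x p))" by simp
  also have "\<dots> \<le> 2 * F.sqdist v u + 2 * F.sqdist u w"
    by (intro F.S.B_ad_le F.L2_diff L)
  also have "\<dots> < e" using gw(3) null sqL_diff_commute[of v u] by simp
  finally show "\<exists>g w. tangent g w \<and> form.sqdist f g < e \<and> F.sqdist v w < e"
    using gw(1,2) \<open>e > 0\<close> by (intro exI[of _ g] exI[of _ w]) auto
qed

text \<open>Approximations of \<open>f\<close> at a geometric rate have fields that converge at this rate.\<close>

lemma weak_gradient_exists:
  assumes wn: "weakly_nondegenerate X" and f: "f \<in> edom X"
  shows "\<exists>u. weak_gradient f u"
proof -
  \<comment> \<open>the factor \<open>1/4\<close> compensates for the inequality \<open>(x + y)\<^sup>2 \<le> 2 x\<^sup>2 + 2 y\<^sup>2\<close> used below\<close>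
  have "\<exists>g v. tangent g v \<and> form.sqdist f g < 1/4 * (1/4) ^ n" for n
  proof -
    obtain g where g: "piecewise_harmonic X g" "form.sqdist f g < 1/4 * (1/4) ^ n"
      using wn f unfolding weakly_nondegenerate_def
      by (metis mult_pos_pos zero_less_divide_1_iff zero_less_numeral zero_less_power)
    then show ?thesis using ex_tangent_Tan unfolding piecewise_harmonic_def by blast
  qed
  then obtain g v where gv: "\<And>n. tangent (g n) (v n)" and close: "\<And>n. form.sqdist f (g n) < 1/4 * (1/4) ^ n"
    by metis
  note D = tangent_edom[OF gv] and L = L2Z_fun_L2[OF tangent_L2Z[OF gv]]
  have rate: "F.sqdist (v n) (v (Suc n)) \<le> (1/4) ^ n" for n
  proof -
    have "F.sqdist (v n) (v (Suc n)) = form.sqdist (g n) (g (Suc n))"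
      by (rule tangent_isometric[OF tangent_diff[OF gv gv]])
    also have "\<dots> = sqE (\<lambda>x. (g n x - f x) + (f x - g (Suc n) x))" by simp
    also have "\<dots> \<le> 2 * form.sqdist (g n) f + 2 * form.sqdist f (g (Suc n))"
      by (intro form.B_ad_le form.dom_diff D f)
    also have "form.sqdist (g n) f = form.sqdist f (g n)"
      using form.En_diff[OF D f] form.En_diff[OF f D] form.En_sym[OF D f] by simp
    also have "2 * form.sqdist f (g n) + 2 * form.sqdist f (g (Suc n)) \<le> 2 * (1/4 * (1/4) ^ n) + 2 * (1/4 * (1/4) ^ Suc n)"
      using close[of n] close[of "Suc n"] by linarith
    also have "\<dots> \<le> (1/4 :: real) ^ n" by simp
    finally show ?thesis .
  qed
  obtain w where w: "w \<in> F.L2" "(\<lambda>n. F.sqdist (v n) w) \<longlonglongrightarrow> 0"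
    using F.L2_complete[of v, OF L rate] by blast
  define u where "u x = restr (Vlev X 0) (w x)" for x
  have q: "quad (Vlev X 0) (Zlim X h x) (u x) = quad (Vlev X 0) (Zlim X h x) (w x)" for x
    by (rule quad_cong) (simp add: u_def restr_def)
  have q': "qdist (Vlev X 0) (Zlim X h x) (u x) (v n x) = qdist (Vlev X 0) (Zlim X h x) (v n x) (w x)" for x n
    unfolding qdist_commute[of _ _ "v n x"] by (rule quad_cong) (simp add: u_def restr_def)
  have uL: "u \<in> L2Z_fun X h"
    unfolding L2Z_fun_iff F.L2_def mem_Collect_eq q
  proof (intro conjI ballI)
    show "(\<lambda>x. u x p) \<in> borel_measurable (completion kus)" if "p \<in> Vlev X 0" for p
      using F.L2_measurable[OF w(1) that] that by (simp add: u_def restr_def)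
    show "integrable (completion kus) (\<lambda>x. quad (Vlev X 0) (Zlim X h x) (w x))"
      using F.L2_integrable[OF w(1)] by (simp add: quad_bil)
    show "u x \<in> ell (Vlev X 0)" for x by (simp add: u_def ell_def restr_def)
  qed
  have "weak_gradient f u"
    unfolding weak_gradient_def
  proof (intro conjI allI impI f uL)
    fix e :: real assume e: "e > 0"
    have "(\<lambda>n. 1/4 * (1/4 :: real) ^ n) \<longlonglongrightarrow> 1/4 * 0"
      by (intro tendsto_intros LIMSEQ_realpow_zero) auto
    then have "\<forall>\<^sub>F n in sequentially. 1/4 * (1/4 :: real) ^ n < e"
      using e by (intro order_tendstoD(2)) auto
    moreover have "\<forall>\<^sub>F n in sequentially. F.sqdist (v n) w < e"
      using w(2) e by (rule order_tendstoD(2))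
    ultimately have "\<forall>\<^sub>F n in sequentially. 1/4 * (1/4 :: real) ^ n < e \<and> F.sqdist (v n) w < e"
      by (rule eventually_conj)
    then obtain n where n: "1/4 * (1/4 :: real) ^ n < e" "F.sqdist (v n) w < e"
      unfolding eventually_sequentially by blast
    have "F.sqdist u (v n) = F.sqdist (v n) w"
      unfolding F.ip_def quad_bil[symmetric] q' ..
    then show "\<exists>g v. tangent g v \<and> form.sqdist f g < e \<and> F.sqdist u v < e"
      using gv close[of n] n by (intro exI[of _ "g n"] exI[of _ "v n"]) auto
  qed
  then show ?thesis by blast
qed

definition weak_gradient_class :: "('a \<Rightarrow> real) \<Rightarrow> ('a \<Rightarrow> 'a \<Rightarrow> real) set" where
  "weak_gradient_class f = {u. weak_gradient f u}"

lemma weak_gradient_class_eq: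
  assumes "weak_gradient f u"
  shows "weak_gradient_class f = L2Z_rel X h `` {u}"
  unfolding weak_gradient_class_def L2Z_rel_def Image_singleton mem_Collect_eq case_prod_conv L2Z_seminorm_eq real_sqrt_eq_0_iff
  using assms weak_gradient_unique[OF assms] weak_gradient_null[OF assms] weak_gradient_L2Z by blast

lemma weak_gradient_class_L2Z: "weak_gradient f u \<Longrightarrow> weak_gradient_class f \<in> L2Z X h"
  unfolding L2Z_def weak_gradient_class_eq by (rule quotientI[OF weak_gradient_L2Z])

text \<open>Equivalence classes that share an element are equal.\<close>

lemma weak_gradient_class_eq_L2Z:
  assumes U: "U \<in> L2Z X h" and u: "u \<in> U" "weak_gradient f u"
  shows "U = weak_gradient_class f"
proof -
  obtain w where w: "w \<in> L2Z_fun X h" "U = L2Z_rel X h `` {w}" using U unfolding L2Z_def by (rule quotientE)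
  have *: "v \<in> U \<longleftrightarrow> v \<in> L2Z_fun X h \<and> F.sqdist w v = 0" for v
    using w by (simp add: L2Z_rel_def L2Z_seminorm_eq)
  have "F.sqdist u w = 0" using * u(1) sqL_diff_commute[of u w] by simp
  then have "weak_gradient f w" by (rule weak_gradient_null[OF u(2) w(1)])
  then show ?thesis using weak_gradient_class_eq w(2) by simp
qed

lemma weak_gradient_class_Grad:
  assumes "piecewise_harmonic X f"
  shows "weak_gradient_class f = Grad X h f"
proof -
  obtain m where m: "n_piecewise_harmonic X m f" using assms by (auto simp: piecewise_harmonic_def)
  let ?Q = "\<lambda>U. U \<in> L2Z X h \<and> (\<forall>n. n_piecewise_harmonic X n f \<longrightarrow>
        (\<exists>u\<in>U. \<forall>a\<in>lev X n. AE x in kus. x \<in> cell X a \<longrightarrow> u x = Tan X a f))"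
  have "(THE U. ?Q U) = weak_gradient_class f"
  proof (rule the_equality)
    obtain u0 where "tangent f u0" using ex_tangent_Tan[OF m] by blast
    then have "weak_gradient_class f \<in> L2Z X h" using weak_gradient_class_L2Z tangent_imp_weak_gradient by blast
    moreover have "\<exists>u\<in>weak_gradient_class f. \<forall>a\<in>lev X n. AE x in kus. x \<in> cell X a \<longrightarrow> u x = Tan X a f"
      if n: "n_piecewise_harmonic X n f" for n
    proof -
      obtain u where u: "tangent f u" "AE x in kus. \<forall>a\<in>lev X n. x \<in> cell X a \<longrightarrow> u x = Tan X a f"
        using ex_tangent_Tan[OF n] by blast
      have "AE x in kus. x \<in> cell X a \<longrightarrow> u x = Tan X a f" if "a \<in> lev X n" for a
        using u(2) by eventually_elim (use that in blast)
      then show ?thesis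
        using tangent_imp_weak_gradient[OF u(1)] unfolding weak_gradient_class_def by blast
    qed
    ultimately show "?Q (weak_gradient_class f)" by blast
    fix U assume U: "?Q U"
    then obtain u where u: "u \<in> U" "\<forall>a\<in>lev X m. AE x in kus. x \<in> cell X a \<longrightarrow> u x = Tan X a f" using m by blast
    have "AE x in kus. \<forall>a\<in>lev X m. x \<in> cell X a \<longrightarrow> u x = Tan X a f"
      using u(2) finite_lev by (intro AE_finite_allI) auto
    moreover have "u \<in> L2Z_fun X h"
      using U u(1) unfolding L2Z_def quotient_def L2Z_rel_def by auto
    moreover have "f \<in> edom X" using m by (simp add: n_piecewise_harmonic_def)
    ultimately have "tangent_field m f u"
      unfolding tangent_field_def by (intro conjI exI[of _ "\<lambda>a. Tan X a f"] ballI Tan[OF m])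
    then have "weak_gradient f u" by (intro tangent_imp_weak_gradient) (auto simp: tangent_def)
    then show "U = weak_gradient_class f" using weak_gradient_class_eq_L2Z U u(1) by blast
  qed
  then show ?thesis unfolding Grad_def by (rule sym)
qed

lemma weak_gradient_class_add:
  assumes "weak_gradient f u" "weak_gradient g v"
  shows "weak_gradient_class (\<lambda>x. f x + g x) = L2Z_add X h (weak_gradient_class f) (weak_gradient_class g)"
proof -
  have "L2Z_rel X h `` {\<lambda>x p. u' x p + v' x p} = weak_gradient_class (\<lambda>x. f x + g x)"
    if "u' \<in> weak_gradient_class f" "v' \<in> weak_gradient_class g" for u' v'
    using that unfolding weak_gradient_class_def mem_Collect_eq
    by (intro weak_gradient_class_eq[OF weak_gradient_add, unfolded weak_gradient_class_def, symmetric])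
  moreover have "weak_gradient_class f \<noteq> {}" "weak_gradient_class g \<noteq> {}"
    using assms by (auto simp: weak_gradient_class_def)
  ultimately show ?thesis unfolding L2Z_add_def by (simp only: UN_constant if_False cong: SUP_cong)
qed

lemma weak_gradient_class_scale:
  assumes "weak_gradient f u"
  shows "weak_gradient_class (\<lambda>x. c * f x) = L2Z_scale X h c (weak_gradient_class f)"
proof -
  have "L2Z_rel X h `` {\<lambda>x p. c * u' x p} = weak_gradient_class (\<lambda>x. c * f x)"
    if "u' \<in> weak_gradient_class f" for u'
    using that unfolding weak_gradient_class_def mem_Collect_eq
    by (intro weak_gradient_class_eq[OF weak_gradient_scale, unfolded weak_gradient_class_def, symmetric])
  moreover have "weak_gradient_class f \<noteq> {}"
    using assms by (auto simp: weak_gradient_class_def)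
  ultimately show ?thesis unfolding L2Z_scale_def by (simp only: UN_constant if_False cong: SUP_cong)
qed

lemma weak_gradient_class_norm:
  assumes "weak_gradient f u"
  shows "L2Z_norm X h (weak_gradient_class f) = sqrt (sqE f)"
proof -
  have "L2Z_seminorm X h ` weak_gradient_class f = {sqrt (sqE f)}"
    using assms weak_gradient_isometric by (auto simp: weak_gradient_class_def L2Z_seminorm_eq image_def)
  then show ?thesis by (simp add: L2Z_norm_def)
qed

end

theorem theorem5:
  fixes X :: "('a::metric_space, 'i) rfrf"
    and h :: "nat \<Rightarrow> 'a \<Rightarrow> real"
  assumes "finitely_ramified_fractal X"
    and "split_resistance_form X"
    and "\<And>g. harmonic X g \<Longrightarrow> extends_continuously X g"
    and "harmonic_orthonormal_basis X h"
    and "weakly_nondegenerate X"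
  shows "\<exists>G :: ('a \<Rightarrow> real) \<Rightarrow> ('a \<Rightarrow> 'a \<Rightarrow> real) set.
    (\<forall>f\<in>edom X. G f \<in> L2Z X h) \<and>
    (\<forall>f\<in>edom X. \<forall>g\<in>edom X. G (\<lambda>x. f x + g x) = L2Z_add X h (G f) (G g)) \<and>
    (\<forall>f\<in>edom X. \<forall>c. G (\<lambda>x. c * f x) = L2Z_scale X h c (G f)) \<and>
    (\<forall>f\<in>edom X. L2Z_norm X h (G f) = sqrt (energy X f f)) \<and>
    (\<forall>f. piecewise_harmonic X f \<longrightarrow> G f = Grad X h f)"
proof -
  interpret kusuoka_form X h
    by unfold_locales (use assms in auto)
  have ex: "\<exists>u. weak_gradient f u" if "f \<in> edom X" for f
    by (rule weak_gradient_exists[OF assms(5) that])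
  show ?thesis
  proof (intro exI[of _ weak_gradient_class] conjI ballI allI impI)
    fix f assume f: "f \<in> edom X"
    show "weak_gradient_class f \<in> L2Z X h" using ex[OF f] weak_gradient_class_L2Z by blast
    show "weak_gradient_class (\<lambda>x. f x + g x) = L2Z_add X h (weak_gradient_class f) (weak_gradient_class g)"
      if "g \<in> edom X" for g using ex[OF f] ex[OF that] weak_gradient_class_add by blast
    show "weak_gradient_class (\<lambda>x. c * f x) = L2Z_scale X h c (weak_gradient_class f)" for c
      using ex[OF f] weak_gradient_class_scale by blast
    show "L2Z_norm X h (weak_gradient_class f) = sqrt (energy X f f)"
      using ex[OF f] weak_gradient_class_norm by blast
  qed (rule weak_gradient_class_Grad)
qed

end
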